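(* Let $\gamma\in(0,1)$ and let $f$ be a positive function of $n$. Given a single machine with memory $\tilde{\Omega}(n^{1+f(n)})$ and $\Omega(m/n^{\gamma})$ machines with memory $\tilde{\Omega}(n^{\gamma})$, operating in the synchronous message-passing model described in the context on an input undirected graph with $n$ vertices and $m$ edges, there is an $O(1/f(n))$-round algorithm that computes a maximal matching with high probability.
   Context: Computational model (heterogeneous massively parallel computation): one "large" machine and many "small" machines with the memory sizes given in the claim. The input is an undirected graph $G=(V,E)$ with $n$ vertices and $m$ edges; the vertex set is known in advance and the edges are initially stored arbitrarily on the small machines. Computation proceeds in synchronous rounds; in each round every machine may send messages to any other machines, subject to each machine sending and receiving in total at most as many bits as its memory size. Local computation is unbounded; each machine has private randomness. The output is stored on the large machine if it fits. A maximal matching is a set of vertex-disjoint edges to which no edge of $G$ can be added while remaining a matching. "With high probability" means with probability at least $1-1/n^{c}$ for some constant $c\ge1$; $\tilde{\Omega}$ hides polylogarithmic factors in $n$.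
   Formalization: The round bound O(1/f(n)) is read as O(⌈1/f(n)⌉): the two agree for bounded f, while for unbounded f (e.g. f(n)=n) the literal bound would force zero rounds, which is impossible since the large machine starts without any edges. *)

theory Defs
  imports "HOL-Probability.Probability" "HOL-Library.Landau_Symbols" "HOL-Library.Log_Nat"
begin

section \<open>Graphs and matchings\<close>

definition simple_graph :: "nat \<Rightarrow> nat set set \<Rightarrow> bool" where
  "simple_graph n E \<longleftrightarrow> (\<forall>e\<in>E. e \<subseteq> {..<n} \<and> card e = 2)"

definition matching :: "'a set set \<Rightarrow> 'a set set \<Rightarrow> bool" where
  "matching E M \<longleftrightarrow> M \<subseteq> E \<and> pairwise disjnt M"

definition maximal_matching :: "'a set set \<Rightarrow> 'a set set \<Rightarrow> bool" where
  "maximal_matching E M \<longleftrightarrow> matching E M \<and> (\<forall>e\<in>E - M. \<not> matching E (insert e M))"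

section \<open>Machines\<close>

text \<open>
  Machine \<open>0\<close> is the large machine; machines \<open>1, \<dots>, K\<close> are the small ones.
  Memory contents and messages are bit strings, and memory is measured in bits.
  The empty bit string stands for the absence of a message.
\<close>

type_synonym bits = "bool list"

text \<open>Outboxes are indexed by the receiver, inboxes by the sender.\<close>

type_synonym mailbox = "nat \<Rightarrow> bits"

text \<open>
  The local computation of a machine in one round: from its number, the round number, its memory
  contents and the messages delivered at the end of the previous round, it obtains (using private
  coins) its new memory contents and the messages it sends.
\<close>

type_synonym program = "nat \<Rightarrow> nat \<Rightarrow> bits \<Rightarrow> mailbox \<Rightarrow> (bits \<times> mailbox) pmf"

text \<open>The memory contents and the inboxes of all machines.\<close>

type_synonym config = "(nat \<Rightarrow> bits) \<times> (nat \<Rightarrow> mailbox)"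

definition memory :: "nat \<Rightarrow> nat \<Rightarrow> nat \<Rightarrow> nat" where
  "memory s_large s_small i = (if i = 0 then s_large else s_small)"

definition legal_round :: "nat \<Rightarrow> (nat \<Rightarrow> nat) \<Rightarrow> (nat \<Rightarrow> bits \<times> mailbox) \<Rightarrow> bool" where
  "legal_round K mem w \<longleftrightarrow>
     (\<forall>i\<le>K. length (fst (w i)) \<le> mem i \<and>
            (\<Sum>j\<le>K. length (snd (w i) j)) \<le> mem i \<and>
            (\<Sum>j\<le>K. length (snd (w j) i)) \<le> mem i)"

definition next_config :: "(nat \<Rightarrow> bits \<times> mailbox) \<Rightarrow> config" where
  "next_config w = (\<lambda>i. fst (w i), \<lambda>i j. snd (w j) i)"

text \<open>
  The product distribution makes the coins of different machines independent; coins are fresh in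
  each round, so a machine that wants to reuse them has to store them. A round that exceeds the
  memory or communication bound of some machine aborts the execution.
\<close>

definition round_step :: "nat \<Rightarrow> (nat \<Rightarrow> nat) \<Rightarrow> program \<Rightarrow> nat \<Rightarrow> config \<Rightarrow> config spmf" where
  "round_step K mem P r cfg =
     map_pmf (\<lambda>w. if legal_round K mem w then Some (next_config w) else None)
       (Pi_pmf {..K} ([], \<lambda>_. []) (\<lambda>i. P i r (fst cfg i) (snd cfg i)))"

primrec execution :: "nat \<Rightarrow> (nat \<Rightarrow> nat) \<Rightarrow> program \<Rightarrow> config \<Rightarrow> nat \<Rightarrow> config spmf" where
  "execution K mem P cfg 0 = return_spmf cfg"
| "execution K mem P cfg (Suc r) = bind_spmf (execution K mem P cfg r) (round_step K mem P r)"

section \<open>Input and output\<close>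

definition encode_vertex :: "nat \<Rightarrow> nat \<Rightarrow> bits" where
  "encode_vertex n v = map (bit v) [0..<ceillog2 n]"

definition encode_edges :: "nat \<Rightarrow> (nat \<times> nat) list \<Rightarrow> bits" where
  "encode_edges n es = concat (map (\<lambda>(u, v). encode_vertex n u @ encode_vertex n v) es)"

definition unordered :: "nat \<times> nat \<Rightarrow> nat set" where
  "unordered p = {fst p, snd p}"

text \<open>
  \<open>D i\<close> lists the edges stored on the small machine \<open>i\<close>, in any order and with any orientation.
  Every edge of the graph is stored exactly once.
\<close>

definition input_distribution ::
  "nat \<Rightarrow> nat set set \<Rightarrow> nat \<Rightarrow> nat \<Rightarrow> (nat \<Rightarrow> (nat \<times> nat) list) \<Rightarrow> bool" where
  "input_distribution n E K s_small D \<longleftrightarrow>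
     (let es = map unordered (concat (map D [1..<Suc K])) in distinct es \<and> set es = E) \<and>
     (\<forall>i\<in>{1..K}. length (encode_edges n (D i)) \<le> s_small)"

definition initial_config :: "nat \<Rightarrow> (nat \<Rightarrow> (nat \<times> nat) list) \<Rightarrow> config" where
  "initial_config n D = (\<lambda>i. if i = 0 then [] else encode_edges n (D i), \<lambda>i j. [])"

definition outputs_maximal_matching :: "nat \<Rightarrow> nat set set \<Rightarrow> config \<Rightarrow> bool" where
  "outputs_maximal_matching n E cfg \<longleftrightarrow>
     (\<exists>es. fst cfg 0 = encode_edges n es \<and> maximal_matching E (unordered ` set es))"

end

theory Submission
  imports Defs "HOL-Real_Asymp.Real_Asymp"
begin

text \<open>
  The large machine maintains a matching \<open>M\<close>. In each phase every edge without an endpoint covered by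
  \<open>M\<close> is sampled with probability \<open>p\<close>, the sample is sent to the large machine, and \<open>M\<close> is extended
  to a matching that is maximal on it. The vertices that are still uncovered span no sampled edge, so
  by a union bound over all \<open>2 ^ n\<close> vertex sets they span at most \<open>2 n / p\<close> edges. Hence \<open>p\<close> can be
  multiplied by \<open>max 2 (n powr f n)\<close> from one phase to the next, and after \<open>O(1 / f n)\<close> phases
  \<open>p = 1\<close> and \<open>M\<close> is maximal.

  The small machines have to learn which endpoints of their edges are covered. After the edges have
  been placed at random, each machine requests the state of its endpoints through a butterfly network
  with \<open>L = O(1 / \<gamma>)\<close> levels that leads all requests for a vertex \<open>u\<close> to the machine \<open>h u\<close>, and the
  answers travel back along the same paths. A random hash function \<open>h\<close> balances the network but is too
  long to be stored, so \<open>h\<close> is drawn from a fixed family of \<open>n ^ 6\<close> functions most of which work,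
  whatever the placement is; such a family exists by the probabilistic method.
\<close>

text \<open>The obstacle is memory on both sides. A small machine is only guaranteed about
  \<open>n powr \<gamma>\<close> words, so the set of covered vertices cannot be broadcast to it;
  the large machine cannot answer the small machines separately, since up to \<open>n ^ 2\<close>
  edges would cause as many requests. Merging the requests on the way leaves one request per vertex,
  hence at most \<open>n\<close> at the large machine, and bounds the traffic of every relay. The
  requests are routed only once, before the first phase; every phase reuses the recorded paths. The
  input may fill some memories completely, and the number of machines may be enormous. Placing the
  edges afresh on \<open>N \<le> n ^ 2\<close> machines makes room for requests, keeps machine
  numbers at O(log n) bits and keeps union bounds over machines polynomial. Randomness enters in
  three places only: the placement, the seed and one sample per phase. Their failure probabilities
  are at most \<open>1 / (4 * n)\<close>, \<open>1 / (4 * n)\<close> and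
  \<open>2 * exp (- n)\<close> per sample; all other rounds are deterministic.\<close>

section \<open>Tail bounds, product distributions and the probabilistic method\<close>

lemma two_powr_le_affine:
  fixes y :: real
  assumes "0 \<le> y" "y \<le> 1"
  shows "2 powr y \<le> 1 + y"
proof -
  \<comment> \<open>Convexity puts the curve below its chord from (0, 1) to (1, 2). Base 2 is what
    gives this chord slope 1, so that no constant appears in front of the mean in the tail
    bound.\<close>
  have "convex_on {0..1} (\<lambda>y::real. 2 powr y)"
    by (rule convex_on_realI[where f' = "\<lambda>y. 2 powr y * ln 2"])
       (auto intro!: derivative_eq_intros mult_right_mono powr_mono)
  from convex_onD[OF this, of y 0 1] assms show ?thesis by simp
qed

text \<open>Markov's inequality for \<open>2 powr (X / b)\<close>, whose expectation is at most \<open>exp (E X / b)\<close>.\<close>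

lemma weighted_chernoff:
  fixes c :: "'a \<Rightarrow> real"
  assumes A: "finite A" and c: "\<And>x. x \<in> A \<Longrightarrow> 0 \<le> c x \<and> c x \<le> b" and b: "0 < b"
    and mu: "(\<Sum>x\<in>A. c x * measure_pmf.prob (p x) (S x)) \<le> \<mu>"
  shows "measure_pmf.prob (Pi_pmf A d p) {\<omega>. t \<le> (\<Sum>x\<in>A. if \<omega> x \<in> S x then c x else 0)}
           \<le> exp (\<mu> / b) * 2 powr (- t / b)"
proof -
  let ?M = "Pi_pmf A d p"
  define f where "f = (\<lambda>x v. 2 powr ((if v \<in> S x then c x else 0) / b) :: real)"
  have f_eq: "f x v = 1 + indicator (S x) v * (2 powr (c x / b) - 1)" for x v
    by (auto simp: f_def)
  have int: "integrable (measure_pmf (p x)) (f x)" for x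
    unfolding f_eq by (intro Bochner_Integration.integrable_add integrable_mult_left
      measure_pmf.integrable_const_bound[where B = 1]) (auto simp: indicator_def)
  have E: "measure_pmf.expectation (p x) (f x) \<le> exp (c x * measure_pmf.prob (p x) (S x) / b)"
    if "x \<in> A" for x
  proof -
    have ind: "measure_pmf.expectation (p x) (indicator (S x)) = measure_pmf.prob (p x) (S x)"
      by simp
    have "measure_pmf.expectation (p x) (f x)
        = 1 + measure_pmf.prob (p x) (S x) * (2 powr (c x / b) - 1)"
      unfolding f_eq ind[symmetric]
      by (subst Bochner_Integration.integral_add)
         (auto intro!: integrable_mult_left measure_pmf.integrable_const_bound[where B = 1]
           simp del: Bochner_Integration.integral_indicator)
    also have "\<dots> \<le> 1 + measure_pmf.prob (p x) (S x) * (c x / b)"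
      using two_powr_le_affine[of "c x / b"] c[OF that] b
      by (intro add_left_mono mult_left_mono) (auto simp: field_simps)
    also have "\<dots> \<le> exp (c x * measure_pmf.prob (p x) (S x) / b)"
      using exp_ge_add_one_self[of "c x * measure_pmf.prob (p x) (S x) / b"]
      by (simp add: mult.commute)
    finally show ?thesis .
  qed
  have g: "(\<Prod>x\<in>A. f x (\<omega> x)) = 2 powr ((\<Sum>x\<in>A. if \<omega> x \<in> S x then c x else 0) / b)" for \<omega>
    unfolding f_def by (simp add: powr_sum sum_divide_distrib)
  have "measure_pmf.prob ?M {\<omega>. t \<le> (\<Sum>x\<in>A. if \<omega> x \<in> S x then c x else 0)}
      \<le> measure_pmf.prob ?M {\<omega> \<in> space ?M. 2 powr (t / b) \<le> (\<Prod>x\<in>A. f x (\<omega> x))}"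
    unfolding g using b by (intro measure_pmf.finite_measure_mono)
      (auto intro!: divide_right_mono)
  also have "\<dots> \<le> measure_pmf.expectation ?M (\<lambda>\<omega>. \<Prod>x\<in>A. f x (\<omega> x)) / 2 powr (t / b)"
    by (intro integral_Markov_inequality_measure[where A = UNIV, simplified]
        integrable_prod_Pi_pmf A int) (auto simp: f_def intro!: prod_nonneg)
  also have "measure_pmf.expectation ?M (\<lambda>\<omega>. \<Prod>x\<in>A. f x (\<omega> x))
      = (\<Prod>x\<in>A. measure_pmf.expectation (p x) (f x))"
    by (intro expectation_prod_Pi_pmf A int) (auto simp: f_def)
  also have "\<dots> \<le> (\<Prod>x\<in>A. exp (c x * measure_pmf.prob (p x) (S x) / b))"
    by (intro prod_mono conjI E) (auto simp: f_def intro!: integral_nonneg)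
  also have "\<dots> = exp ((\<Sum>x\<in>A. c x * measure_pmf.prob (p x) (S x)) / b)"
    by (simp add: exp_sum[OF A] sum_divide_distrib)
  also have "\<dots> \<le> exp (\<mu> / b)"
    using mu b by (simp add: divide_right_mono)
  finally show ?thesis
    by (simp add: powr_minus_divide divide_right_mono)
qed

text \<open>Lets the private coins of all machines be read off one product over the disjoint union
  of their blocks. Each \<open>F i\<close> sees the joint outcome masked to its own block, so events
  about the coins of several machines live in one space.\<close>

lemma Pi_pmf_blocks:
  assumes "finite I" "\<And>i. i \<in> I \<Longrightarrow> finite (A i)" "disjoint_family_on A I"
  shows "Pi_pmf I d (\<lambda>i. map_pmf (F i) (Pi_pmf (A i) d' q))
    = map_pmf (\<lambda>\<omega> i. if i \<in> I then F i (\<lambda>x. if x \<in> A i then \<omega> x else d') else d)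
        (Pi_pmf (\<Union>i\<in>I. A i) d' q)"
  using assms
proof (induction rule: finite_induct)
  case empty
  then show ?case by (simp add: map_return_pmf)
next
  case (insert j I)
  let ?U = "\<Union>i\<in>I. A i"
  have fin: "finite (A j)" "finite ?U" using insert by auto
  have disj: "A j \<inter> ?U = {}"
    using insert.prems(2) insert.hyps(2) by (auto simp: disjoint_family_on_def)
  have "Pi_pmf (insert j I) d (\<lambda>i. map_pmf (F i) (Pi_pmf (A i) d' q))
     = map_pmf (\<lambda>(y,f). f(j:=y)) (pair_pmf (map_pmf (F j) (Pi_pmf (A j) d' q))
         (map_pmf (\<lambda>\<omega> i. if i \<in> I then F i (\<lambda>x. if x \<in> A i then \<omega> x else d') else d)
        (Pi_pmf ?U d' q)))"
    using insert by (subst Pi_pmf_insert) (auto simp: disjoint_family_on_def)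
  also have "\<dots> = map_pmf (\<lambda>(g,h). (\<lambda>i. if i \<in> I then F i (\<lambda>x. if x \<in> A i then h x else d') else d)(j := F j g))
      (pair_pmf (Pi_pmf (A j) d' q) (Pi_pmf ?U d' q))"
    by (simp add: map_pair[symmetric] pmf.map_comp o_def case_prod_unfold)
  also have "\<dots> = map_pmf (\<lambda>(g,h). (\<lambda>i. if i \<in> insert j I then F i (\<lambda>x. if x \<in> A i then (if x \<in> A j then g x else h x) else d') else d))
      (pair_pmf (Pi_pmf (A j) d' q) (Pi_pmf ?U d' q))"
  proof (intro map_pmf_cong refl, safe, rule ext)
    fix g h i
    assume "(g, h) \<in> set_pmf (pair_pmf (Pi_pmf (A j) d' q) (Pi_pmf ?U d' q))"
    then have g: "g \<in> set_pmf (Pi_pmf (A j) d' q)" by simp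
    have j: "(\<lambda>x. if x \<in> A j then g x else d') = g"
      using set_Pi_pmf_subset[OF fin(1), of d' q] g by (auto simp: fun_eq_iff)
    have I: "(\<lambda>x. if x \<in> A i then if x \<in> A j then g x else h x else d')
        = (\<lambda>x. if x \<in> A i then h x else d')" if "i \<in> I"
      using disj that by (auto simp: fun_eq_iff)
    show "((\<lambda>i. if i \<in> I then F i (\<lambda>x. if x \<in> A i then h x else d') else d)(j := F j g)) i =
      (if i \<in> insert j I
       then F i (\<lambda>x. if x \<in> A i then if x \<in> A j then g x else h x else d') else d)"
      using j I insert.hyps(2) by (cases "i = j") (simp_all cong: if_cong)
  qed
  also have "\<dots> = map_pmf (\<lambda>\<omega> i. if i \<in> insert j I then F i (\<lambda>x. if x \<in> A i then \<omega> x else d') else d)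
        (Pi_pmf (A j \<union> ?U) d' q)"
    using fin disj by (subst Pi_pmf_union) (simp_all add: pmf.map_comp o_def case_prod_unfold)
  finally show ?case by simp
qed

text \<open>A union bound for sequential composition. It needs no independence, because the second
  bound holds for every intermediate result in \<open>C\<close>. As \<open>C\<close> is lifted by
  \<open>Some\<close>, an aborted first part counts as a failure.\<close>

lemma prob_bind_spmf_ge:
  assumes "0 \<le> e" "0 \<le> e'" "measure_pmf.prob p (Some ` C) \<ge> 1 - e"
    "\<And>c. c \<in> C \<Longrightarrow> measure_pmf.prob (f c) D \<ge> 1 - e'"
  shows "measure_pmf.prob (bind_spmf p f) D \<ge> 1 - (e + e')"
proof (cases "e' \<le> 1")
  case True
  let ?g = "\<lambda>x. measure_pmf.prob (case x of None \<Rightarrow> return_pmf None | Some c \<Rightarrow> f c) D"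
  have int: "integrable (measure_pmf p) ?g"
    by (intro measure_pmf.integrable_const_bound[where B = 1]) auto
  have "1 - (e + e') \<le> (1 - e') * (1 - e)"
    using assms(1,2) by (simp add: algebra_simps)
  also have "\<dots> \<le> (1 - e') * measure_pmf.prob p (Some ` C)"
    using True assms by (intro mult_left_mono) auto
  also have "\<dots> = measure_pmf.expectation p (\<lambda>x. (1 - e') * indicator (Some ` C) x)"
    by simp
  also have "\<dots> \<le> measure_pmf.expectation p ?g"
  proof (intro integral_mono int)
    show "integrable (measure_pmf p) (\<lambda>x. (1 - e') * indicator (Some ` C) x :: real)"
      by (intro integrable_mult_right measure_pmf.integrable_const_bound[where B = 1])
         (auto simp: indicator_def)
    show "(1 - e') * indicator (Some ` C) x \<le> ?g x" for x
      using assms(4) by (auto simp: indicator_def)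
  qed
  also have "\<dots> = measure_pmf.prob (bind_spmf p f) D"
  proof -
    have "ennreal (measure_pmf.prob (bind_spmf p f) D)
        = (\<integral>\<^sup>+x. ennreal (?g x) \<partial>measure_pmf p)"
      unfolding bind_spmf_def by (simp add: measure_pmf.emeasure_eq_measure[symmetric])
    also have "\<dots> = ennreal (measure_pmf.expectation p ?g)"
      by (intro nn_integral_eq_integral int) auto
    finally show ?thesis
      by (subst (asm) ennreal_inj) (auto intro!: integral_nonneg)
  qed
  finally show ?thesis .
next
  case False
  then show ?thesis using assms by (intro order.trans[OF _ measure_nonneg]) auto
qed

text \<open>
  Averaging over independent functions \<open>H 0, \<dots>, H (R - 1)\<close> shows that a fixed family works
  for every input at once, so that only the index of a function has to be drawn at random.
\<close>

lemma exists_good_family: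
  fixes q :: "'h pmf"
  assumes X: "finite X" "card X \<le> 2 ^ k"
    and bad: "\<And>x. x \<in> X \<Longrightarrow> measure_pmf.prob q (Bad x) \<le> \<epsilon>" and eps: "real R * \<epsilon> \<le> 1 / 2"
  shows "\<exists>H. (\<forall>s<R. H s \<in> set_pmf q) \<and> (\<forall>x\<in>X. card {s. s < R \<and> H s \<in> Bad x} \<le> k + 1)"
proof -
  let ?M = "Pi_pmf {..<R} undefined (\<lambda>_::nat. q)"
  define B where "B = (\<lambda>x. {H. real (k + 2) \<le> (\<Sum>s<R. if H s \<in> Bad x then 1 else (0::real))})"
  have cardeq: "(\<Sum>s<R. if H s \<in> Bad x then 1 else (0::real)) = real (card {s. s < R \<and> H s \<in> Bad x})"
    for H x
    by (subst sum.If_cases) (auto intro!: arg_cong[where f = card])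
  have one: "measure_pmf.prob ?M (B x) \<le> exp (1/2) * (1/2) ^ (k + 2)" if "x \<in> X" for x
  proof -
    \<comment> \<open>On average at most 1/2 of a function is bad for \<open>x\<close>, so
      \<open>k + 2\<close> bad ones occur with probability at most
      \<open>exp (1/2) * (1/2) ^ (k + 2)\<close>; the union bound over \<open>2 ^ k\<close> inputs
      leaves \<open>exp (1/2) / 4 < 1\<close>.\<close>
    have "(\<Sum>s<R. (1::real) * measure_pmf.prob q (Bad x)) \<le> 1 / 2"
      using mult_left_mono[OF bad[OF that], of "real R"] eps by simp
    from weighted_chernoff[OF _ _ _ this, where b = 1 and t = "real (k+2)" and d = undefined]
    have "measure_pmf.prob ?M (B x) \<le> exp (1/2) * 2 powr (- real (k + 2))"
      unfolding B_def by simp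
    also have "2 powr (- real (k + 2)) = (1/2) ^ (k + 2)"
      by (simp only: powr_minus powr_realpow power_one_over) (simp add: divide_simps)
    finally show ?thesis .
  qed
  have "measure_pmf.prob ?M (\<Union>x\<in>X. B x) \<le> (\<Sum>x\<in>X. measure_pmf.prob ?M (B x))"
    by (intro measure_pmf.finite_measure_subadditive_finite X) auto
  also have "\<dots> \<le> real (card X) * (exp (1/2) * (1/2) ^ (k + 2))"
    using sum_mono[OF one] by simp
  also have "\<dots> \<le> 2 ^ k * (exp (1/2) * (1/2) ^ (k + 2))"
    using X(2) of_nat_mono[OF X(2), where 'a = real] by (intro mult_right_mono) auto
  also have "\<dots> = exp (1/2) / 4" by (simp add: power_add power_one_over)
  also have "\<dots> < 1"
    using exp_half_le2 by simp
  finally have lt: "measure_pmf.prob ?M (\<Union>x\<in>X. B x) < 1" .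
  have "\<exists>H\<in>set_pmf ?M. H \<notin> (\<Union>x\<in>X. B x)"
  proof (rule ccontr)
    assume "\<not> ?thesis"
    then have "measure_pmf.prob ?M (\<Union>x\<in>X. B x) = 1"
      by (subst measure_pmf.prob_eq_1) (auto simp: AE_measure_pmf_iff)
    with lt show False by simp
  qed
  then obtain H where H: "H \<in> set_pmf ?M" "H \<notin> (\<Union>x\<in>X. B x)" by blast
  have "card {s. s < R \<and> H s \<in> Bad x} \<le> k + 1" if "x \<in> X" for x
    using H(2) that unfolding B_def cardeq by (auto simp del: of_nat_add)
  moreover have "H s \<in> set_pmf q" if "s < R" for s
    using H(1) that by (auto simp: set_Pi_pmf PiE_dflt_def)
  ultimately show ?thesis by blast
qed

section \<open>Bit encodings by words of fixed length\<close>

text \<open>Code words of one positive length can be cut apart without separators; with length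
  \<open>0\<close> the number of entries would be lost.\<close>

lemma inj_on_concat_map:
  assumes len: "\<And>x. x \<in> A \<Longrightarrow> length (f x) = k" and "0 < k" and inj: "inj_on f A"
  shows "inj_on (\<lambda>xs. concat (map f xs)) (lists A)"
proof (rule inj_onI)
  fix xs ys
  assume "xs \<in> lists A" "ys \<in> lists A" "concat (map f xs) = concat (map f ys)"
  then show "xs = ys"
  proof (induction xs arbitrary: ys rule: list.induct)
    case Nil
    then show ?case using len \<open>0 < k\<close> by (cases ys) auto
  next
    case (Cons x xs)
    then obtain y ys' where ys: "ys = y # ys'"
      using len \<open>0 < k\<close> by (cases ys) auto
    have A: "x \<in> A" "y \<in> A" "xs \<in> lists A" "ys' \<in> lists A" using Cons.prems(1,2) ys by auto
    from Cons.prems(3) have "f x @ concat (map f xs) = f y @ concat (map f ys')" by (simp add: ys)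
    then have "f x = f y" "concat (map f xs) = concat (map f ys')"
      using len A by (simp_all add: append_eq_append_conv)
    then show ?case using Cons.IH A inj ys by (auto dest: inj_onD)
  qed
qed

definition bin :: "nat \<Rightarrow> nat \<Rightarrow> bits" where
  "bin w x = map (bit x) [0..<w]"

lemma length_bin [simp]: "length (bin w x) = w"
  by (simp add: bin_def)

lemma inj_on_bin: "inj_on (bin w) {..<2 ^ w}"
proof (rule inj_onI)
  fix x y :: nat
  assume x: "x \<in> {..<2 ^ w}" and y: "y \<in> {..<2 ^ w}" and eq: "bin w x = bin w y"
  have "bit x i = bit y i" if "i < w" for i
    using eq that by (auto simp: bin_def)
  then have "take_bit w x = take_bit w y"
    by (auto simp: bit_eq_iff bit_take_bit_iff)
  then show "x = y" using x y by (simp add: take_bit_nat_eq_self)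
qed

text \<open>From round \<open>1\<close> on, every message sent and every small memory is the code of
  a set of such triples, so costs can be counted in facts of \<open>3 * w\<close> bits each.\<close>

type_synonym fact = "nat \<times> nat \<times> nat"

definition facts :: "nat \<Rightarrow> fact set" where
  "facts w = {..<2 ^ w} \<times> {..<2 ^ w} \<times> {..<2 ^ w}"

definition code_fact :: "nat \<Rightarrow> fact \<Rightarrow> bits" where
  "code_fact w = (\<lambda>(a, b, c). bin w a @ bin w b @ bin w c)"

text \<open>The enumeration of \<open>S\<close> is arbitrary but fixed, so the code depends on the
  set alone. The empty set yields the empty string, which stands for the absence of a
  message.\<close>

definition code :: "nat \<Rightarrow> fact set \<Rightarrow> bits" where
  "code w S = concat (map (code_fact w) (SOME xs. distinct xs \<and> set xs = S))"

definition decode :: "nat \<Rightarrow> bits \<Rightarrow> fact set" where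
  "decode w bs = (SOME S. S \<subseteq> facts w \<and> code w S = bs)"

definition decode_edges :: "nat \<Rightarrow> bits \<Rightarrow> (nat \<times> nat) list" where
  "decode_edges n bs = (SOME es. set es \<subseteq> {..<n} \<times> {..<n} \<and> encode_edges n es = bs)"

lemma finite_facts [simp]: "finite (facts w)"
  by (simp add: facts_def)

lemma mem_facts [simp]: "(a, b, c) \<in> facts w \<longleftrightarrow> a < 2 ^ w \<and> b < 2 ^ w \<and> c < 2 ^ w"
  by (auto simp: facts_def)

lemma length_code_fact: "length (code_fact w x) = 3 * w"
  by (simp add: code_fact_def case_prod_unfold)

lemma enum_props:
  assumes "finite S"
  shows "distinct (SOME xs. distinct xs \<and> set xs = S)" "set (SOME xs. distinct xs \<and> set xs = S) = S"
  using someI_ex[of "\<lambda>xs. distinct xs \<and> set xs = S"] finite_distinct_list[OF assms] by auto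

lemma code_empty [simp]: "code w {} = []"
  using enum_props(2)[of "{} :: fact set"] by (simp add: code_def)

lemma length_code:
  assumes "finite S"
  shows "length (code w S) = 3 * w * card S"
proof -
  let ?xs = "SOME xs. distinct xs \<and> set xs = S"
  have "length (code w S) = sum_list (map (\<lambda>_. 3 * w) ?xs)"
    unfolding code_def by (simp add: length_concat o_def length_code_fact)
  also have "\<dots> = 3 * w * card (set ?xs)"
    using enum_props(1)[OF assms] by (simp add: sum_list_triv distinct_card)
  finally show ?thesis by (simp only: enum_props(2)[OF assms])
qed

lemma inj_on_code:
  assumes "0 < w"
  shows "inj_on (code w) (Pow (facts w))"
proof (rule inj_onI)
  fix S T assume S: "S \<in> Pow (facts w)" and T: "T \<in> Pow (facts w)" and eq: "code w S = code w T"
  have fin: "finite S" "finite T" using S T by (auto intro: finite_subset)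
  have "inj_on (code_fact w) (facts w)"
    by (rule inj_onI) (auto simp: code_fact_def dest!: inj_onD[OF inj_on_bin])
  from inj_on_concat_map[OF _ _ this, of "3 * w"] assms
  have "inj_on (\<lambda>xs. concat (map (code_fact w) xs)) (lists (facts w))"
    by (auto simp: length_code_fact)
  then have inj: "inj_on (\<lambda>xs. concat (map (code_fact w) xs)) {xs. set xs \<subseteq> facts w}"
    by (simp only: lists_eq_set)
  define xs ys where "xs = (SOME xs. distinct xs \<and> set xs = S)"
    and "ys = (SOME xs. distinct xs \<and> set xs = T)"
  have xs: "set xs = S" "set ys = T"
    unfolding xs_def ys_def by (rule enum_props(2)[OF fin(1)], rule enum_props(2)[OF fin(2)])
  have "concat (map (code_fact w) xs) = concat (map (code_fact w) ys)"
    using eq by (simp only: code_def xs_def ys_def)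
  then have "xs = ys" using inj_onD[OF inj, of xs ys] S T xs by blast
  then show "S = T" using xs by simp
qed

lemma decode_code [simp]:
  assumes "0 < w" "S \<subseteq> facts w"
  shows "decode w (code w S) = S"
proof -
  let ?T = "decode w (code w S)"
  have "?T \<subseteq> facts w \<and> code w ?T = code w S"
    unfolding decode_def by (rule someI[where x = S]) (use assms in auto)
  then show ?thesis using inj_onD[OF inj_on_code[OF assms(1)], of ?T S] assms by auto
qed

lemma encode_vertex_bin: "encode_vertex n v = bin (ceillog2 n) v"
  by (simp add: encode_vertex_def bin_def)

lemma length_encode_edges: "length (encode_edges n es) = 2 * ceillog2 n * length es"
  by (induction es) (auto simp: encode_edges_def encode_vertex_bin)

lemma encode_edges_Nil [simp]: "encode_edges n [] = []"
  by (simp add: encode_edges_def)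

lemma ceillog2_pos: "2 \<le> n \<Longrightarrow> 0 < ceillog2 n"
  using ceillog2_mono[of 2 n] by simp

lemma decode_encode_edges [simp]:
  assumes n: "2 \<le> n" and es: "set es \<subseteq> {..<n} \<times> {..<n}"
  shows "decode_edges n (encode_edges n es) = es"
proof -
  let ?f = "\<lambda>(u, v). encode_vertex n u @ encode_vertex n v"
  let ?es = "decode_edges n (encode_edges n es)"
  have lt: "u < 2 ^ ceillog2 n" if "u < n" for u
    using that le_two_power_ceillog2[of n] by linarith
  have "inj_on ?f ({..<n} \<times> {..<n})"
    by (rule inj_onI) (auto simp: encode_vertex_bin lt dest!: inj_onD[OF inj_on_bin])
  from inj_on_concat_map[OF _ _ this, of "2 * ceillog2 n"] ceillog2_pos[OF n]
  have inj: "inj_on (encode_edges n) (lists ({..<n} \<times> {..<n}))"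
    unfolding encode_edges_def by (auto simp: encode_vertex_bin)
  have "set ?es \<subseteq> {..<n} \<times> {..<n} \<and> encode_edges n ?es = encode_edges n es"
    unfolding decode_edges_def by (rule someI[where x = es]) (use es in auto)
  then show ?thesis using inj_onD[OF inj, of ?es es] es by (auto simp: lists_eq_set)
qed

lemma decode_edges_Nil [simp]: "2 \<le> n \<Longrightarrow> decode_edges n [] = []"
  using decode_encode_edges[of n "[]"] by simp

section \<open>Routing\<close>

text \<open>
  A request of machine \<open>i\<close> for vertex \<open>u\<close> is at machine \<open>node B h l i u\<close> after \<open>l\<close> hops. With
  machines numbered from \<open>1\<close>, hop \<open>l\<close> replaces the \<open>l\<close>-th base-\<open>B\<close> digit of the current machine
  by that of \<open>h u\<close>. Requests for the same vertex that meet on the way are merged, so a vertex of high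
  degree does not overload the machine \<open>h u\<close>.
\<close>

definition node :: "nat \<Rightarrow> (nat \<Rightarrow> nat) \<Rightarrow> nat \<Rightarrow> nat \<Rightarrow> nat \<Rightarrow> nat" where
  "node B h l i u = Suc ((i - 1) div B ^ l * B ^ l + h u mod B ^ l)"

definition reaching :: "nat \<Rightarrow> nat \<Rightarrow> (nat \<Rightarrow> nat) \<Rightarrow> (nat \<Rightarrow> nat set) \<Rightarrow> nat \<Rightarrow> nat \<Rightarrow> nat set" where
  "reaching B N h Q l j = {u. \<exists>i\<in>{1..N}. u \<in> Q i \<and> node B h l i u = j}"

text \<open>A set, not a multiset: requests for one vertex that meet in \<open>j\<close> continue as
  one. Its cardinality bounds the traffic of the link both for the requests and for the answers on
  the way back.\<close>

definition hop :: "nat \<Rightarrow> nat \<Rightarrow> (nat \<Rightarrow> nat) \<Rightarrow> (nat \<Rightarrow> nat set) \<Rightarrow> nat \<Rightarrow> nat \<Rightarrow> nat \<Rightarrow> nat set" where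
  "hop B N h Q l j j' =
     {u. \<exists>i\<in>{1..N}. u \<in> Q i \<and> node B h l i u = j \<and> node B h (Suc l) i u = j'}"

text \<open>Constrains incoming load only. A machine never sends more requests than it holds, and
  beyond level \<open>0\<close> these are bounded by what it received in the previous hop.\<close>

definition balanced :: "nat \<Rightarrow> nat \<Rightarrow> nat \<Rightarrow> nat \<Rightarrow> (nat \<Rightarrow> nat set) \<Rightarrow> (nat \<Rightarrow> nat) \<Rightarrow> bool" where
  "balanced B N L t Q h \<longleftrightarrow>
     (\<forall>l<L. \<forall>j'\<in>{1..N}. (\<Sum>j\<in>{1..N}. card (hop B N h Q l j j')) \<le> t)"

lemma node_0: "1 \<le> i \<Longrightarrow> node B h 0 i u = i"
  by (simp add: node_def)

lemma pred_node_div: "0 < B \<Longrightarrow> (node B h l i u - 1) div B ^ l = (i - 1) div B ^ l"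
  by (simp add: node_def)

text \<open>The position after \<open>l\<close> hops still carries the digits of \<open>i\<close>
  from the \<open>l\<close>-th on. Hence a relay finds the next position from its own number and
  \<open>u\<close>, without knowing the origin.\<close>

lemma node_Suc_node:
  assumes "0 < B"
  shows "node B h (Suc l) (node B h l i u) u = node B h (Suc l) i u"
proof -
  have "(node B h l i u - 1) div B ^ Suc l = (node B h l i u - 1) div B ^ l div B"
    by (simp only: power_Suc mult.commute[of B] div_mult2_eq)
  also have "\<dots> = (i - 1) div B ^ l div B" by (simp only: pred_node_div[OF assms])
  also have "\<dots> = (i - 1) div B ^ Suc l"
    by (simp only: power_Suc mult.commute[of B] div_mult2_eq)
  finally show ?thesis unfolding node_def[of B h "Suc l"] by simp
qed

lemma node_top:
  assumes "i \<in> {1..B ^ L}" "h u < B ^ L"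
  shows "node B h L i u = Suc (h u)"
proof -
  have "(i - 1) div B ^ L = 0" using assms by (intro div_less) auto
  then show ?thesis using assms by (simp add: node_def)
qed

lemma node_range:
  assumes "0 < B" "l \<le> L" "i \<in> {1..B ^ L}"
  shows "node B h l i u \<in> {1..B ^ L}"
proof -
  have N: "B ^ L = B ^ (L - l) * B ^ l" using assms by (simp flip: power_add)
  have "i - 1 < B ^ (L - l) * B ^ l" using assms(3) N by auto
  then have "(i - 1) div B ^ l < B ^ (L - l)" by (simp add: less_mult_imp_div_less)
  then have "Suc ((i - 1) div B ^ l) * B ^ l \<le> B ^ (L - l) * B ^ l" by (intro mult_right_mono) auto
  moreover have "h u mod B ^ l < B ^ l" using assms(1) by simp
  ultimately have "(i - 1) div B ^ l * B ^ l + h u mod B ^ l < B ^ L" unfolding N by simp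
  then show ?thesis by (simp add: node_def)
qed

lemma reaching_0: "j \<in> {1..N} \<Longrightarrow> reaching B N h Q 0 j = Q j"
  by (auto simp: reaching_def node_0)

lemma reaching_0_empty: "j \<notin> {1..N} \<Longrightarrow> reaching B N h Q 0 j = {}"
  by (auto simp: reaching_def node_0)

lemma hop_eq: "0 < B \<Longrightarrow> hop B N h Q l j j' = {u \<in> reaching B N h Q l j. node B h (Suc l) j u = j'}"
  by (auto simp: hop_def reaching_def node_Suc_node)

lemma reaching_Suc:
  assumes "0 < B" "l < L" "N = B ^ L"
  shows "reaching B N h Q (Suc l) j' = (\<Union>j\<in>{1..N}. hop B N h Q l j j')"
  using node_range[OF assms(1), of l L] assms by (fastforce simp: reaching_def hop_def)

lemma reaching_eq_UN_hop:
  assumes "0 < B" "l < L" "N = B ^ L"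
  shows "reaching B N h Q l j = (\<Union>j'\<in>{1..N}. hop B N h Q l j j')"
  using node_range[OF assms(1), of "Suc l" L] assms by (fastforce simp: reaching_def hop_def)

lemma reaching_top:
  assumes "N = B ^ L" "\<And>i u. i \<in> {1..N} \<Longrightarrow> u \<in> Q i \<Longrightarrow> h u < N"
  shows "reaching B N h Q L j = {u. \<exists>i\<in>{1..N}. u \<in> Q i \<and> j = Suc (h u)}"
  using assms node_top[of _ B L h] by (fastforce simp: reaching_def)

lemma reaching_subset: "reaching B N h Q l j \<subseteq> (\<Union>i\<in>{1..N}. Q i)"
  by (auto simp: reaching_def)

lemma hop_subset: "hop B N h Q l j j' \<subseteq> (\<Union>i\<in>{1..N}. Q i)"
  by (auto simp: hop_def)

lemma hop_cong: "(\<And>i. i \<in> {1..N} \<Longrightarrow> Q i = Q' i) \<Longrightarrow> hop B N h Q l j j' = hop B N h Q' l j j'"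
  by (auto simp: hop_def)

lemma sum_card_hop_out_le:
  assumes "0 < B" "finite (reaching B N h Q l j)"
  shows "(\<Sum>j'\<in>{1..N}. card (hop B N h Q l j j')) \<le> card (reaching B N h Q l j)"
proof -
  have "(\<Sum>j'\<in>{1..N}. card (hop B N h Q l j j')) = card (\<Union>j'\<in>{1..N}. hop B N h Q l j j')"
    using assms by (subst card_UN_disjoint) (auto simp: hop_eq)
  also have "\<dots> \<le> card (reaching B N h Q l j)"
    using assms by (intro card_mono) (auto simp: hop_eq)
  finally show ?thesis .
qed

section \<open>Load of the butterfly under a random hash function\<close>

lemma card_div_eq_le:
  fixes b c :: nat
  assumes "0 < b"
  shows "finite {x. x div b = c}" "card {x. x div b = c} \<le> b"
proof -
  have *: "{x. x div b = c} \<subseteq> {c * b..<c * b + b}"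
  proof
    fix x assume "x \<in> {x. x div b = c}"
    then have "x = c * b + x mod b" using div_mult_mod_eq[of x b] by simp
    moreover have "x mod b < b" using assms by simp
    ultimately show "x \<in> {c * b..<c * b + b}" unfolding atLeastLessThan_iff by linarith
  qed
  then show "finite {x. x div b = c}" by (rule finite_subset) auto
  show "card {x. x div b = c} \<le> b" using card_mono[OF _ *] by simp
qed

lemma prob_mod_eq_le:
  fixes b m :: nat
  assumes "0 < b" "0 < m"
  shows "measure_pmf.prob (pmf_of_set {..<b * m}) {y. y mod b = x} \<le> 1 / b"
proof -
  have ne: "{..<b * m} \<noteq> {}" using assms by (auto simp: lessThan_empty_iff)
  have "card ({..<b * m} \<inter> {y. y mod b = x}) \<le> card {..<m}"
  proof (rule card_inj_on_le[where f = "\<lambda>y. y div b"])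
    show "inj_on (\<lambda>y. y div b) ({..<b * m} \<inter> {y. y mod b = x})"
      by (rule inj_onI) (metis IntD2 div_mult_mod_eq mem_Collect_eq)
  qed (use assms in \<open>auto simp: less_mult_imp_div_less mult.commute\<close>)
  then show ?thesis
    using assms ne by (subst measure_pmf_of_set) (auto simp: field_simps simp flip: of_nat_mult)
qed

text \<open>Hop \<open>l\<close> leads to \<open>j'\<close> only if the low \<open>l + 1\<close>
  digits of \<open>h u\<close> agree with those of \<open>j' - 1\<close>, and only for requests
  issued in the block \<open>I\<close> of machines sharing the higher digits of
  \<open>j' - 1\<close>. The weight \<open>c u\<close> counts the digit patterns above the replaced
  ones with which \<open>u\<close> can arrive: at most \<open>B\<close>, because only digit
  \<open>l\<close> is free, and in total at most the number of requests issued in the block. The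
  weights do not depend on \<open>h\<close>, so the load is dominated by a weighted sum of
  independent events.\<close>

lemma load_le_weighted_sum:
  assumes B: "0 < B" and l: "l < L" and N: "N = B ^ L" and j': "j' \<in> {1..N}"
    and Q: "\<forall>i\<in>{1..N}. Q i \<subseteq> {..<n} \<and> card (Q i) \<le> q"
  obtains c :: "nat \<Rightarrow> nat" where "\<And>u. c u \<le> B" "(\<Sum>u<n. c u) \<le> B ^ Suc l * q"
    "\<And>h. (\<Sum>j\<in>{1..N}. card (hop B N h Q l j j'))
        \<le> (\<Sum>u<n. if h u \<in> {y. y mod B ^ Suc l = (j' - 1) mod B ^ Suc l} then c u else 0)"
proof -
  note Q = bspec[OF Q, THEN conjunct1] bspec[OF Q, THEN conjunct2]
  let ?b = "B ^ Suc l"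
  define I where "I = {i \<in> {1..N}. (i - 1) div ?b = (j' - 1) div ?b}"
  define C where "C = (\<lambda>u. {(i - 1) div B ^ l | i. i \<in> I \<and> u \<in> Q i})"
  have finI: "finite I" by (simp add: I_def)
  have finC: "finite (C u)" for u
    by (rule finite_surj[OF finI, of _ "\<lambda>i. (i - 1) div B ^ l"]) (auto simp: C_def)
  have finQ: "finite (Q i)" if "i \<in> I" for i
    using Q(1)[of i] that by (auto simp: I_def intro: finite_subset)
  have cardI: "card I \<le> ?b"
  proof -
    have "card I \<le> card {x. x div ?b = (j' - 1) div ?b}"
      using B by (intro card_inj_on_le[where f = "\<lambda>i. i - 1"] card_div_eq_le(1))
        (auto simp: I_def inj_on_def)
    also have "\<dots> \<le> ?b" using B by (intro card_div_eq_le) auto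
    finally show ?thesis .
  qed
  show ?thesis
  proof (rule that[of "\<lambda>u. card (C u)"])
    fix u
    have "C u \<subseteq> {x. x div B = (j' - 1) div ?b}"
    proof
      fix x assume "x \<in> C u"
      then obtain i where i: "i \<in> I" "x = (i - 1) div B ^ l" by (auto simp: C_def)
      then have "x div B = (i - 1) div ?b"
        by (simp only: power_Suc mult.commute[of B] div_mult2_eq)
      with i show "x \<in> {x. x div B = (j' - 1) div ?b}" by (simp add: I_def)
    qed
    then have "card (C u) \<le> card {x. x div B = (j' - 1) div ?b}"
      by (intro card_mono card_div_eq_le(1)[OF B])
    then show "card (C u) \<le> B" using card_div_eq_le(2)[OF B] le_trans by blast
  next
    have "(\<Sum>u<n. card (C u)) = card (SIGMA u:{..<n}. C u)"
      by (subst card_SigmaI) (auto simp: finC)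
    also have "\<dots> \<le> card (SIGMA i:I. Q i)"
    proof (rule surj_card_le[of _ _ "\<lambda>(i, u). (u, (i - 1) div B ^ l)"])
      show "finite (SIGMA i:I. Q i)" using finI finQ by auto
      show "(SIGMA u:{..<n}. C u) \<subseteq> (\<lambda>(i, u). (u, (i - 1) div B ^ l)) ` (SIGMA i:I. Q i)"
        by (auto simp: C_def image_iff intro!: bexI)
    qed
    also have "\<dots> = (\<Sum>i\<in>I. card (Q i))"
      using finI finQ by (subst card_SigmaI) auto
    also have "\<dots> \<le> card I * q"
      using sum_mono[of I "\<lambda>i. card (Q i)" "\<lambda>_. q"] Q(2) by (auto simp: I_def)
    also have "\<dots> \<le> ?b * q" using cardI by (intro mult_right_mono) auto
    finally show "(\<Sum>u<n. card (C u)) \<le> ?b * q" .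
  next
    fix h
    let ?U = "{u \<in> {..<n}. h u \<in> {y. y mod ?b = (j' - 1) mod ?b}}"
    have finh: "finite (hop B N h Q l j j')" for j
      by (rule finite_subset[OF hop_subset]) (auto intro: finite_subset[OF Q(1)])
    have "(\<Sum>j\<in>{1..N}. card (hop B N h Q l j j')) = card (SIGMA j:{1..N}. hop B N h Q l j j')"
      by (subst card_SigmaI) (auto simp: finh)
    also have "\<dots> \<le> card (SIGMA u:?U. C u)"
    proof (rule card_inj_on_le[where f = "\<lambda>(j, u). (u, (j - 1) div B ^ l)"])
      \<comment> \<open>For fixed \<open>u\<close> the low digits of \<open>j - 1\<close> are forced
        by \<open>h u\<close>, so the quotient by \<open>B ^ l\<close> determines
        \<open>j\<close>.\<close>
      have j: "j = Suc ((j - 1) div B ^ l * B ^ l + h u mod B ^ l)"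
        if "u \<in> hop B N h Q l j j'" for j u
        using that B by (auto simp: hop_def node_def)
      show "inj_on (\<lambda>(j, u). (u, (j - 1) div B ^ l)) (SIGMA j:{1..N}. hop B N h Q l j j')"
      proof (rule inj_onI, clarsimp)
        fix j1 j2 u
        assume "u \<in> hop B N h Q l j1 j'" "u \<in> hop B N h Q l j2 j'"
          and e: "(j1 - Suc 0) div B ^ l = (j2 - Suc 0) div B ^ l"
        from j[OF this(1)] j[OF this(2)] e show "j1 = j2" by simp
      qed
      show "(\<lambda>(j, u). (u, (j - 1) div B ^ l)) ` (SIGMA j:{1..N}. hop B N h Q l j j')
          \<subseteq> (SIGMA u:?U. C u)"
      proof clarify
        fix j u assume u: "u \<in> hop B N h Q l j j'"
        then obtain i where i: "i \<in> {1..N}" "u \<in> Q i" "node B h l i u = j" "node B h (Suc l) i u = j'"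
          by (auto simp: hop_def)
        have "(j' - 1) mod ?b = h u mod ?b"
          using i(4) B by (auto simp: node_def)
        moreover have "(j' - 1) div ?b = (i - 1) div ?b"
          using i(4) pred_node_div[OF B, of h "Suc l" i u] by simp
        moreover have "(j - 1) div B ^ l = (i - 1) div B ^ l"
          using i(3) pred_node_div[OF B, of h l i u] by simp
        ultimately show "u \<in> ?U \<and> (j - 1) div B ^ l \<in> C u"
          using i Q(1)[OF i(1)] by (auto simp: C_def I_def)
      qed
      show "finite (SIGMA u:?U. C u)" by (auto simp: finC)
    qed
    also have "\<dots> = (\<Sum>u\<in>?U. card (C u))" by (subst card_SigmaI) (auto simp: finC)
    also have "\<dots> = (\<Sum>u<n. if h u \<in> {y. y mod ?b = (j' - 1) mod ?b} then card (C u) else 0)"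
      by (subst sum.inter_filter) auto
    finally show "(\<Sum>j\<in>{1..N}. card (hop B N h Q l j j'))
        \<le> (\<Sum>u<n. if h u \<in> {y. y mod ?b = (j' - 1) mod ?b} then card (C u) else 0)" .
  qed
qed

text \<open>Each weight goes with an event of probability at most \<open>1 / B ^ Suc l\<close>,
  which cancels the size of the block: the mean load is at most \<open>q\<close>. As the weights are
  bounded by \<open>B\<close>, the exponents are measured in units of \<open>B\<close>, which is why
  \<open>B\<close> is later kept well below \<open>q\<close>.\<close>

lemma prob_overload_le:
  assumes B: "0 < B" and l: "l < L" and N: "N = B ^ L" and j': "j' \<in> {1..N}"
    and Q: "\<forall>i\<in>{1..N}. Q i \<subseteq> {..<n} \<and> card (Q i) \<le> q"
  shows "measure_pmf.prob (Pi_pmf {..<n} 0 (\<lambda>_. pmf_of_set {..<N}))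
     {h. t \<le> (\<Sum>j\<in>{1..N}. card (hop B N h Q l j j'))} \<le> exp (q / B) * 2 powr (- real t / B)"
proof -
  obtain c where c: "\<And>u. c u \<le> B" "(\<Sum>u<n. c u) \<le> B ^ Suc l * q"
    "\<And>h. (\<Sum>j\<in>{1..N}. card (hop B N h Q l j j'))
        \<le> (\<Sum>u<n. if h u \<in> {y. y mod B ^ Suc l = (j' - 1) mod B ^ Suc l} then c u else 0)"
    using load_le_weighted_sum[OF assms] by blast
  let ?S = "{y. y mod B ^ Suc l = (j' - 1) mod B ^ Suc l}"
  let ?M = "Pi_pmf {..<n} 0 (\<lambda>_. pmf_of_set {..<N})"
  have Nm: "N = B ^ Suc l * B ^ (L - Suc l)"
    using l N by (simp only: power_add[symmetric]) simp
  have p: "measure_pmf.prob (pmf_of_set {..<N}) ?S \<le> 1 / (B ^ Suc l)"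
    unfolding Nm using prob_mod_eq_le[of "B ^ Suc l" "B ^ (L - Suc l)"] B by auto
  have "(\<Sum>u<n. real (c u) * measure_pmf.prob (pmf_of_set {..<N}) ?S)
      \<le> (\<Sum>u<n. real (c u) * (1 / (B ^ Suc l)))"
    using p by (intro sum_mono mult_left_mono) auto
  also have "\<dots> = real (\<Sum>u<n. c u) / real (B ^ Suc l)"
    by (simp add: sum_divide_distrib)
  also have "\<dots> \<le> real (B ^ Suc l * q) / real (B ^ Suc l)"
    using c(2) by (intro divide_right_mono of_nat_mono) auto
  also have "\<dots> = q" using B by simp
  finally have mu: "(\<Sum>u<n. real (c u) * measure_pmf.prob (pmf_of_set {..<N}) ?S) \<le> q" .
  have "measure_pmf.prob ?M {h. t \<le> (\<Sum>j\<in>{1..N}. card (hop B N h Q l j j'))}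
      \<le> measure_pmf.prob ?M {h. real t \<le> (\<Sum>u<n. if h u \<in> ?S then real (c u) else 0)}"
  proof (intro measure_pmf.finite_measure_mono subsetI CollectI)
    fix h assume "h \<in> {h. t \<le> (\<Sum>j\<in>{1..N}. card (hop B N h Q l j j'))}"
    then have "t \<le> (\<Sum>u<n. if h u \<in> ?S then c u else 0)" using c(3)[of h] by simp
    then have "real t \<le> real (\<Sum>u<n. if h u \<in> ?S then c u else 0)" by (rule of_nat_mono)
    also have "\<dots> = (\<Sum>u<n. if h u \<in> ?S then real (c u) else 0)"
      by (simp only: of_nat_sum if_distrib[of real] of_nat_0)
    finally show "real t \<le> (\<Sum>u<n. if h u \<in> ?S then real (c u) else 0)" .
  qed auto
  also have "\<dots> \<le> exp (q / B) * 2 powr (- real t / B)"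
    by (rule weighted_chernoff[OF _ _ _ mu]) (use c(1) B in auto)
  finally show ?thesis .
qed

text \<open>The inputs of the averaging argument are the request patterns \<open>Q\<close>. There
  are at most \<open>(2 ^ n) ^ N\<close> of them, whence the \<open>n * N + 1\<close> tolerated bad
  functions; the factor \<open>L * N\<close> counts the pairs of a level and a machine that may be
  overloaded.\<close>

lemma exists_hash_family:
  assumes B: "0 < B" and N: "N = B ^ L"
    and eps: "real R * (real L * real N * (exp (q / B) * 2 powr (- real t / B))) \<le> 1 / 2"
  shows "\<exists>H. (\<forall>s<R. \<forall>u<n. H s u < N) \<and>
    (\<forall>Q. (\<forall>i\<in>{1..N}. Q i \<subseteq> {..<n} \<and> card (Q i) \<le> q) \<longrightarrow>
       card {s. s < R \<and> \<not> balanced B N L t Q (H s)} \<le> n * N + 1)"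
proof -
  let ?M = "Pi_pmf {..<n} 0 (\<lambda>_. pmf_of_set {..<N})"
  define X where "X = PiE_dflt {1..N} {} (\<lambda>_. {S. S \<subseteq> {..<n} \<and> card S \<le> q})"
  have N0: "0 < N" using B N by simp
  have finS: "finite {S. S \<subseteq> {..<n} \<and> card S \<le> q}" by simp
  have "card {S. S \<subseteq> {..<n} \<and> card S \<le> q} \<le> card (Pow {..<n})"
    by (intro card_mono) auto
  then have cS: "card {S. S \<subseteq> {..<n} \<and> card S \<le> q} \<le> 2 ^ n" by (simp add: card_Pow)
  have finX: "finite X" unfolding X_def by (intro finite_PiE_dflt) auto
  have "card X = card {S. S \<subseteq> {..<n} \<and> card S \<le> q} ^ N"
    unfolding X_def by (subst card_PiE_dflt) auto
  also have "\<dots> \<le> (2 ^ n) ^ N" by (intro power_mono cS) auto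
  finally have cX: "card X \<le> 2 ^ (n * N)" by (simp add: power_mult)
  define Bad where "Bad = (\<lambda>Q. {h. \<not> balanced B N L t Q h})"
  have bad: "measure_pmf.prob ?M (Bad Q) \<le> real L * real N * (exp (q / B) * 2 powr (- real t / B))"
    if "Q \<in> X" for Q
  proof -
    have Q: "\<forall>i\<in>{1..N}. Q i \<subseteq> {..<n} \<and> card (Q i) \<le> q"
      using \<open>Q \<in> X\<close> by (auto simp: X_def PiE_dflt_def)
    let ?E = "\<lambda>(l, j'). {h. t \<le> (\<Sum>j\<in>{1..N}. card (hop B N h Q l j j'))}"
    have "measure_pmf.prob ?M (Bad Q) \<le> measure_pmf.prob ?M (\<Union>x\<in>{..<L} \<times> {1..N}. ?E x)"
      by (intro measure_pmf.finite_measure_mono) (force simp: Bad_def balanced_def)+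
    also have "\<dots> \<le> (\<Sum>x\<in>{..<L} \<times> {1..N}. measure_pmf.prob ?M (?E x))"
      by (intro measure_pmf.finite_measure_subadditive_finite) auto
    also have "\<dots> \<le> (\<Sum>x\<in>{..<L} \<times> {1..N}. exp (q / B) * 2 powr (- real t / B))"
    proof (rule sum_mono)
      fix x assume "x \<in> {..<L} \<times> {1..N}"
      then obtain l j' where x: "x = (l, j')" "l < L" "j' \<in> {1..N}" by auto
      show "measure_pmf.prob ?M (?E x) \<le> exp (q / B) * 2 powr (- real t / B)"
        unfolding x(1) prod.case using prob_overload_le[OF B x(2) N x(3) Q] by simp
    qed
    also have "\<dots> = real L * real N * (exp (q / B) * 2 powr (- real t / B))"
      by (simp add: card_cartesian_product)
    finally show ?thesis .
  qed
  have "\<exists>H. (\<forall>s<R. H s \<in> set_pmf ?M) \<and>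
      (\<forall>Q\<in>X. card {s. s < R \<and> H s \<in> Bad Q} \<le> n * N + 1)"
    by (rule exists_good_family[OF finX cX _ eps]) (rule bad)
  then obtain H where
    H: "\<And>s. s < R \<Longrightarrow> H s \<in> set_pmf ?M" "\<And>Q. Q \<in> X \<Longrightarrow> card {s. s < R \<and> H s \<in> Bad Q} \<le> n * N + 1"
    by blast
  show ?thesis
  proof (intro exI[of _ H] conjI allI impI)
    fix s u assume "s < R" "u < n"
    with H(1)[of s] N0 show "H s u < N"
      by (auto simp: set_Pi_pmf PiE_dflt_def set_pmf_of_set lessThan_empty_iff)
  next
    fix Q assume Q: "\<forall>i\<in>{1..N}. Q i \<subseteq> {..<n} \<and> card (Q i) \<le> q"
    let ?Q = "\<lambda>i. if i \<in> {1..N} then Q i else {}"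
    have "balanced B N L t Q h = balanced B N L t ?Q h" for h
      unfolding balanced_def using hop_cong[of N Q ?Q] by simp
    moreover have "?Q \<in> X" using Q by (auto simp: X_def PiE_dflt_def)
    ultimately show "card {s. s < R \<and> \<not> balanced B N L t Q (H s)} \<le> n * N + 1"
      using H(2)[of ?Q] by (simp add: Bad_def)
  qed
qed

section \<open>Matchings\<close>

definition covered :: "(nat \<times> nat) set \<Rightarrow> nat set" where
  "covered M = (\<Union>p\<in>M. unordered p)"

definition indep :: "(nat \<times> nat) set \<Rightarrow> bool" where
  "indep M \<longleftrightarrow> (\<forall>p\<in>M. \<forall>q\<in>M. p \<noteq> q \<longrightarrow> disjnt (unordered p) (unordered q))"

definition alive :: "(nat \<times> nat) set \<Rightarrow> (nat \<times> nat) set \<Rightarrow> (nat \<times> nat) set" where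
  "alive X M = {p \<in> X. unordered p \<inter> covered M = {}}"

text \<open>Local computation is unbounded, so any extension of \<open>M\<close> that is maximal on
  \<open>S\<close> may be picked; the sampling bound holds for whichever is chosen. It is a list
  because the memory of the large machine encodes a list of edges.\<close>

definition grow :: "(nat \<times> nat) set \<Rightarrow> (nat \<times> nat) set \<Rightarrow> (nat \<times> nat) list" where
  "grow M S = (SOME es. distinct es \<and> M \<subseteq> set es \<and> set es \<subseteq> M \<union> S \<and> indep (set es) \<and>
     alive S (set es) = {})"

lemma grow:
  assumes "finite M" "finite S" "indep M"
  shows "distinct (grow M S)" "M \<subseteq> set (grow M S)" "set (grow M S) \<subseteq> M \<union> S"
    "indep (set (grow M S))" "alive S (set (grow M S)) = {}"
proof -
  let ?X = "{M'. M \<subseteq> M' \<and> M' \<subseteq> M \<union> S \<and> indep M'}"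
  have "finite ?X" by (rule finite_subset[of _ "Pow (M \<union> S)"]) (use assms in auto)
  moreover have "?X \<noteq> {}" using assms by auto
  ultimately have "\<exists>M'\<in>?X. \<forall>M''\<in>?X. M' \<subseteq> M'' \<longrightarrow> M' = M''"
    by (rule finite_has_maximal)
  then obtain M' where M': "M' \<in> ?X" and maximal: "\<forall>M''\<in>?X. M' \<subseteq> M'' \<longrightarrow> M' = M''"
    by (rule bexE)
  have max: "M' = M''" if "M'' \<in> ?X" "M' \<subseteq> M''" for M''
    using maximal[rule_format, OF that] .
  have "alive S M' = {}"
  proof (rule ccontr)
    assume "alive S M' \<noteq> {}"
    then obtain p where p: "p \<in> S" "unordered p \<inter> covered M' = {}" by (auto simp: alive_def)
    then have dis: "disjnt (unordered p) (unordered q)" if "q \<in> M'" for q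
      using that by (auto simp: covered_def disjnt_def)
    have "indep (insert p M')"
      using M' dis disjnt_sym[OF dis] unfolding indep_def by blast
    then have "insert p M' \<in> ?X" using M' p by auto
    then have "M' = insert p M'" by (rule max) blast
    then have "p \<in> M'" by blast
    then show False using dis[of p] by (auto simp: unordered_def disjnt_def)
  qed
  moreover obtain es where "set es = M'" "distinct es"
    using finite_distinct_list[of M'] M' assms finite_subset[of M' "M \<union> S"] by auto
  ultimately have "\<exists>es. distinct es \<and> M \<subseteq> set es \<and> set es \<subseteq> M \<union> S \<and> indep (set es) \<and>
     alive S (set es) = {}" using M' by blast
  then have "distinct (grow M S) \<and> M \<subseteq> set (grow M S) \<and> set (grow M S) \<subseteq> M \<union> S \<and>
      indep (set (grow M S)) \<and> alive S (set (grow M S)) = {}"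
    unfolding grow_def by (rule someI_ex)
  then show "distinct (grow M S)" "M \<subseteq> set (grow M S)"
    "set (grow M S) \<subseteq> M \<union> S" "indep (set (grow M S))" "alive S (set (grow M S)) = {}" by auto
qed

lemma covered_mono: "M \<subseteq> M' \<Longrightarrow> covered M \<subseteq> covered M'"
  by (auto simp: covered_def)

lemma card_indep_le:
  assumes "indep M" "M \<subseteq> {..<n} \<times> {..<n}"
  shows "card M \<le> n"
proof -
  have "inj_on fst M"
  proof (rule inj_onI, rule ccontr)
    fix p q assume pq: "p \<in> M" "q \<in> M" "fst p = fst q" "p \<noteq> q"
    then have "fst p \<in> unordered p \<inter> unordered q" by (simp add: unordered_def)
    moreover have "unordered p \<inter> unordered q = {}"
      using assms(1) pq by (simp add: indep_def disjnt_def)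
    ultimately show False by simp
  qed
  then have "card M \<le> card {..<n}"
    by (rule card_inj_on_le) (use assms(2) in auto)
  then show ?thesis by simp
qed

lemma maximal_matchingI:
  assumes "M \<subseteq> X" "indep M" "alive X M = {}"
  shows "maximal_matching (unordered ` X) (unordered ` M)"
proof -
  have "\<not> matching (unordered ` X) (insert (unordered p) (unordered ` M))"
    if p: "p \<in> X" "unordered p \<notin> unordered ` M" for p
  proof
    assume "matching (unordered ` X) (insert (unordered p) (unordered ` M))"
    then have pw: "pairwise disjnt (insert (unordered p) (unordered ` M))"
      by (simp add: matching_def)
    have "disjnt (unordered p) (unordered q)" if "q \<in> M" for q
      by (rule pairwiseD[OF pw]) (use that p in auto)
    then have "p \<in> alive X M" using p by (auto simp: alive_def covered_def disjnt_def)
    with assms show False by simp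
  qed
  moreover have "matching (unordered ` X) (unordered ` M)"
    unfolding matching_def pairwise_def
  proof (intro conjI ballI impI)
    show "unordered ` M \<subseteq> unordered ` X" using assms(1) by (rule image_mono)
    fix e e' assume "e \<in> unordered ` M" "e' \<in> unordered ` M" "e \<noteq> e'"
    then obtain p q where "p \<in> M" "q \<in> M" "e = unordered p" "e' = unordered q" "p \<noteq> q" by auto
    then show "disjnt e e'" using assms(2) by (simp add: indep_def)
  qed
  ultimately show ?thesis by (auto simp: maximal_matching_def)
qed

section \<open>Random placement and sampling\<close>

lemma prob_uneven_placement_le:
  fixes N t :: nat
  assumes X: "finite X" and N: "0 < N"
  shows "measure_pmf.prob (Pi_pmf X d (\<lambda>_. pmf_of_set {1..N}))
     {\<omega>. \<exists>j\<in>{1..N}. t \<le> card {x \<in> X. \<omega> x = j}} \<le> N * (exp (card X / N) * 2 powr (- real t))"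
proof -
  let ?M = "Pi_pmf X d (\<lambda>_. pmf_of_set {1..N::nat})"
  have one: "measure_pmf.prob ?M {\<omega>. t \<le> card {x \<in> X. \<omega> x = j}} \<le> exp (card X / N) * 2 powr (- real t)"
    if "j \<in> {1..N}" for j
  proof -
    have "measure_pmf.prob (pmf_of_set {1..N}) {j} = 1 / N"
      using that N by (subst measure_pmf_of_set) auto
    then have mu: "(\<Sum>x\<in>X. (1::real) * measure_pmf.prob (pmf_of_set {1..N}) {j}) \<le> card X / N"
      by simp
    have eq: "(\<Sum>x\<in>X. if \<omega> x \<in> {j} then 1 else (0::real)) = card {x \<in> X. \<omega> x = j}" for \<omega>
      using X by (subst sum.inter_filter[symmetric]) auto
    from weighted_chernoff[OF X _ _ mu, where b = 1 and t = t and d = d] show ?thesis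
      unfolding eq by simp
  qed
  have "measure_pmf.prob ?M {\<omega>. \<exists>j\<in>{1..N}. t \<le> card {x \<in> X. \<omega> x = j}}
     = measure_pmf.prob ?M (\<Union>j\<in>{1..N}. {\<omega>. t \<le> card {x \<in> X. \<omega> x = j}})"
    by (intro arg_cong[where f = "measure_pmf.prob ?M"]) auto
  also have "\<dots> \<le> (\<Sum>j\<in>{1..N}. measure_pmf.prob ?M {\<omega>. t \<le> card {x \<in> X. \<omega> x = j}})"
    by (intro measure_pmf.finite_measure_subadditive_finite) auto
  also have "\<dots> \<le> (\<Sum>j\<in>{1..N}. exp (card X / N) * 2 powr (- real t))"
    by (intro sum_mono one)
  finally show ?thesis by simp
qed

text \<open>
  The union bound runs over the possible sets \<open>U\<close> of unmatched vertices, so the bound on the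
  edges inside \<open>U\<close> applies to whatever matching is computed from the sample.
\<close>

lemma prob_bad_sample_le:
  fixes p b b' :: real
  assumes A: "finite A" and p: "0 < p" "p \<le> 1" and b: "real (card A) \<le> b"
  defines "M \<equiv> Pi_pmf A 0 (\<lambda>_. map_pmf of_bool (bernoulli_pmf p) :: nat pmf)"
  shows "measure_pmf.prob M {\<omega>. t \<le> card {x \<in> A. \<omega> x = 1} \<or>
      (\<exists>U\<subseteq>{..<n}. b' < card {x \<in> A. unordered x \<subseteq> U} \<and> (\<forall>x\<in>A. unordered x \<subseteq> U \<longrightarrow> \<omega> x \<noteq> 1))}
    \<le> exp (p * b) * 2 powr (- real t) + 2 ^ n * exp (- p * b')"
proof -
  let ?q = "map_pmf of_bool (bernoulli_pmf p) :: nat pmf"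
  have "of_bool -` {1::nat} = {True}" by (auto split: if_splits simp: of_bool_def)
  then have q1: "measure_pmf.prob ?q {1} = p"
    using p by (simp only: measure_map_pmf) (simp add: measure_pmf_single)
  have "measure_pmf.prob ?q (- {1}) = 1 - measure_pmf.prob ?q {1}"
    using measure_pmf.prob_compl[of "{1}" ?q] by (simp add: Compl_eq_Diff_UNIV)
  then have q0: "measure_pmf.prob ?q (- {1}) = 1 - p" using q1 by simp
  have mu: "(\<Sum>x\<in>A. (1::real) * measure_pmf.prob ?q {1}) \<le> p * b"
    using b p by (simp only: q1) (simp add: mult.commute)
  have eq: "(\<Sum>x\<in>A. if \<omega> x \<in> {1} then 1 else (0::real)) = card {x \<in> A. \<omega> x = 1}" for \<omega> :: "nat \<times> nat \<Rightarrow> nat"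
    using A by (subst sum.inter_filter[symmetric]) auto
  from weighted_chernoff[OF A _ _ mu, where b = 1 and t = t and d = 0]
  have 1: "measure_pmf.prob M {\<omega>. t \<le> card {x \<in> A. \<omega> x = 1}} \<le> exp (p * b) * 2 powr (- real t)"
    unfolding eq M_def by simp
  let ?E = "\<lambda>U. {\<omega> :: nat \<times> nat \<Rightarrow> nat. b' < card {x \<in> A. unordered x \<subseteq> U} \<and> (\<forall>x\<in>A. unordered x \<subseteq> U \<longrightarrow> \<omega> x \<noteq> 1)}"
  \<comment> \<open>If \<open>U\<close> has more than \<open>b'\<close> inner edges, all of them
    have to miss the sample independently; otherwise the event is empty.\<close>
  have 2: "measure_pmf.prob M (?E U) \<le> exp (- p * b')" for U
  proof (cases "b' < card {x \<in> A. unordered x \<subseteq> U}")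
    case True
    have "measure_pmf.prob M (?E U)
        = measure_pmf.prob M (Pi A (\<lambda>x. if unordered x \<subseteq> U then - {1} else UNIV))"
      using True by (intro arg_cong[where f = "measure_pmf.prob M"]) (auto simp: Pi_def split: if_splits)
    also have "\<dots> = (\<Prod>x\<in>A. measure_pmf.prob ?q (if unordered x \<subseteq> U then - {1} else UNIV))"
      unfolding M_def by (rule measure_Pi_pmf_Pi[OF A])
    also have "\<dots> = (\<Prod>x\<in>A. if unordered x \<subseteq> U then 1 - p else 1)"
      using q0 by (intro prod.cong refl) (simp split: if_splits)
    also have "\<dots> = (1 - p) ^ card {x \<in> A. unordered x \<subseteq> U}"
      using A by (subst prod.inter_filter[symmetric]) auto
    also have "\<dots> \<le> exp (- p) ^ card {x \<in> A. unordered x \<subseteq> U}"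
      using p exp_ge_add_one_self[of "- p"] by (intro power_mono) auto
    also have "\<dots> = exp (- p * card {x \<in> A. unordered x \<subseteq> U})"
      by (simp add: exp_of_nat_mult[symmetric] mult.commute)
    also have "\<dots> \<le> exp (- p * b')" using True p by simp
    finally show ?thesis .
  next
    case False
    then have "?E U = {}" by blast
    then show ?thesis by (simp only: measure_empty) simp
  qed
  have "measure_pmf.prob M {\<omega>. t \<le> card {x \<in> A. \<omega> x = 1} \<or>
      (\<exists>U\<subseteq>{..<n}. b' < card {x \<in> A. unordered x \<subseteq> U} \<and> (\<forall>x\<in>A. unordered x \<subseteq> U \<longrightarrow> \<omega> x \<noteq> 1))}
    = measure_pmf.prob M ({\<omega>. t \<le> card {x \<in> A. \<omega> x = 1}} \<union> (\<Union>U\<in>Pow {..<n}. ?E U))"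
    by (intro arg_cong[where f = "measure_pmf.prob M"]) auto
  also have "\<dots> \<le> measure_pmf.prob M {\<omega>. t \<le> card {x \<in> A. \<omega> x = 1}}
      + measure_pmf.prob M (\<Union>U\<in>Pow {..<n}. ?E U)"
    by (intro measure_Un_le) auto
  also have "measure_pmf.prob M (\<Union>U\<in>Pow {..<n}. ?E U) \<le> (\<Sum>U\<in>Pow {..<n}. measure_pmf.prob M (?E U))"
    by (intro measure_pmf.finite_measure_subadditive_finite) auto
  also have "\<dots> \<le> (\<Sum>U\<in>Pow {..<n}. exp (- p * b'))" by (intro sum_mono 2)
  also have "\<dots> = 2 ^ n * exp (- p * b')" by (simp add: card_Pow)
  finally show ?thesis using 1 by simp
qed

section \<open>The algorithm\<close>

text \<open>\<open>g i j\<close> is the message from \<open>i\<close> to \<open>j\<close>, whereas a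
  configuration is indexed by the receiver first; hence the transposition.\<close>

definition conf :: "nat \<Rightarrow> (nat \<Rightarrow> bits) \<Rightarrow> (nat \<Rightarrow> nat \<Rightarrow> bits) \<Rightarrow> config \<Rightarrow> bool" where
  "conf K m g cfg \<longleftrightarrow> (\<forall>i\<le>K. fst cfg i = m i \<and> (\<forall>j\<le>K. snd cfg i j = g j i))"

definition legal_traffic :: "nat \<Rightarrow> (nat \<Rightarrow> nat) \<Rightarrow> (nat \<Rightarrow> bits) \<Rightarrow> (nat \<Rightarrow> nat \<Rightarrow> bits) \<Rightarrow> bool" where
  "legal_traffic K mem m g \<longleftrightarrow> (\<forall>i\<le>K. length (m i) \<le> mem i \<and>
     (\<Sum>j\<le>K. length (g i j)) \<le> mem i \<and> (\<Sum>j\<le>K. length (g j i)) \<le> mem i)"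

type_synonym coins = "nat \<times> nat \<Rightarrow> nat"

text \<open>The coins of a round are named by the edges they decide about, and every edge lives on
  one machine. All private coins therefore form a single product over the edges, however these are
  distributed, and a round can be analysed for one joint outcome \<open>\<omega>\<close>: for each
  good one it remains to exhibit the resulting memories \<open>m\<close> and traffic
  \<open>g\<close>.\<close>

lemma prob_round_step_ge:
  fixes act :: "nat \<Rightarrow> nat \<Rightarrow> bits \<Rightarrow> mailbox \<Rightarrow> coins \<Rightarrow> bits \<times> mailbox"
    and keys :: "nat \<Rightarrow> nat \<Rightarrow> bits \<Rightarrow> mailbox \<Rightarrow> (nat \<times> nat) set"
    and cfg :: config
  assumes P: "\<And>i m b. P i r m b = map_pmf (act i r m b) (Pi_pmf (keys i r m b) 0 (\<lambda>_. q))"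
    and A: "\<And>i. i \<le> K \<Longrightarrow> keys i r (fst cfg i) (snd cfg i) = A i"
    and fin: "\<And>i. i \<le> K \<Longrightarrow> finite (A i)" and disj: "disjoint_family_on A {..K}"
    and prob: "measure_pmf.prob (Pi_pmf (\<Union>i\<in>{..K}. A i) 0 (\<lambda>_. q)) G \<ge> 1 - e"
    and step: "\<And>\<omega>. \<omega> \<in> G \<Longrightarrow> \<omega> \<in> set_pmf (Pi_pmf (\<Union>i\<in>{..K}. A i) 0 (\<lambda>_. q)) \<Longrightarrow>
      \<exists>m g. (\<forall>i\<le>K. fst (act i r (fst cfg i) (snd cfg i) (\<lambda>x. if x \<in> A i then \<omega> x else 0)) = m i \<and>
         (\<forall>j\<le>K. snd (act i r (fst cfg i) (snd cfg i) (\<lambda>x. if x \<in> A i then \<omega> x else 0)) j = g i j)) \<and>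
       legal_traffic K mem m g \<and> Collect (conf K m g) \<subseteq> C"
  shows "measure_pmf.prob (round_step K mem P r cfg) (Some ` C) \<ge> 1 - e"
proof -
  let ?M = "Pi_pmf (\<Union>i\<in>{..K}. A i) 0 (\<lambda>_. q)"
  let ?F = "\<lambda>i. act i r (fst cfg i) (snd cfg i)"
  let ?w = "\<lambda>\<omega> i. if i \<in> {..K} then ?F i (\<lambda>x. if x \<in> A i then \<omega> x else 0) else ([], \<lambda>_. [])"
  let ?out = "\<lambda>w. if legal_round K mem w then Some (next_config w) else None"
  have "round_step K mem P r cfg
      = map_pmf ?out (Pi_pmf {..K} ([], \<lambda>_. []) (\<lambda>i. map_pmf (?F i) (Pi_pmf (A i) 0 (\<lambda>_. q))))"
    unfolding round_step_def P by (intro arg_cong[where f = "map_pmf ?out"] Pi_pmf_cong) (auto simp: A)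
  also have "\<dots> = map_pmf ?out (map_pmf ?w ?M)"
    using fin disj by (subst Pi_pmf_blocks) auto
  finally have eq: "round_step K mem P r cfg = map_pmf (\<lambda>\<omega>. ?out (?w \<omega>)) ?M"
    by (simp only: pmf.map_comp o_def)
  \<comment> \<open>Intersecting with the support lets \<open>step\<close> assume that coins take
    possible values, such as machine numbers in \<open>{1..N}\<close>.\<close>
  have "1 - e \<le> measure_pmf.prob ?M (G \<inter> set_pmf ?M)"
    using prob by (simp add: measure_Int_set_pmf)
  also have "\<dots> \<le> measure_pmf.prob ?M ((\<lambda>\<omega>. ?out (?w \<omega>)) -` (Some ` C))"
  proof (intro measure_pmf.finite_measure_mono subsetI)
    fix \<omega> assume "\<omega> \<in> G \<inter> set_pmf ?M"
    define W where "W = ?w \<omega>"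
    from step[of \<omega>] \<open>\<omega> \<in> G \<inter> set_pmf ?M\<close> obtain m g where
      mg: "\<And>i. i \<le> K \<Longrightarrow> fst (W i) = m i" "\<And>i j. i \<le> K \<Longrightarrow> j \<le> K \<Longrightarrow> snd (W i) j = g i j"
      and legal: "legal_traffic K mem m g" and sub: "Collect (conf K m g) \<subseteq> C"
      by (auto simp: W_def)
    have "legal_round K mem W"
      using legal unfolding legal_round_def legal_traffic_def by (simp add: mg)
    moreover have "conf K m g (next_config W)"
      unfolding conf_def next_config_def by (simp add: mg)
    ultimately have "?out W \<in> Some ` C" using sub by auto
    then show "\<omega> \<in> (\<lambda>\<omega>. ?out (?w \<omega>)) -` (Some ` C)"
      unfolding W_def vimage_def mem_Collect_eq .
  qed auto
  also have "\<dots> = measure_pmf.prob (round_step K mem P r cfg) (Some ` C)"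
    unfolding eq by (simp only: measure_map_pmf)
  finally show ?thesis .
qed

definition edges :: "fact set \<Rightarrow> (nat \<times> nat) set" where
  "edges S = {(u, v). (0, u, v) \<in> S}"

definition seed :: "fact set \<Rightarrow> nat" where
  "seed S = (THE s. (1, s, 0) \<in> S)"

text \<open>
  A small machine stores its edges \<open>(u, v)\<close> as facts \<open>(0, u, v)\<close>, the seed \<open>s\<close> as \<open>(1, s, 0)\<close> and
  the request for vertex \<open>u\<close> that it received from machine \<open>j\<close> at level \<open>l\<close> as \<open>(l + 2, j, u)\<close>.
\<close>

definition requested :: "fact set \<Rightarrow> nat \<Rightarrow> nat set" where
  "requested S l = (if l = 0 then covered (edges S) else {u. \<exists>j. (l + 1, j, u) \<in> S})"

definition vertex_facts :: "nat set \<Rightarrow> fact set" where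
  "vertex_facts U = (\<lambda>u. (0, u, 0)) ` U"

definition edge_facts :: "(nat \<times> nat) set \<Rightarrow> fact set" where
  "edge_facts X = (\<lambda>(u, v). (0, u, v)) ` X"

definition query_facts :: "nat set \<Rightarrow> fact set" where
  "query_facts U = (\<lambda>u. (1, u, 0)) ` U"

text \<open>\<open>w\<close> is the number of bits per component of a fact, \<open>H s\<close> for
  \<open>s < R\<close> are the hash functions, \<open>pr k\<close> is the sampling probability of
  phase \<open>k\<close>, and \<open>B\<close> and \<open>L\<close> are the base and the number of
  levels of the butterfly.\<close>

locale algorithm =
  fixes n K B L w R :: nat and H :: "nat \<Rightarrow> nat \<Rightarrow> nat" and pr :: "nat \<Rightarrow> real"
begin

abbreviation N :: nat where
  "N \<equiv> B ^ L"

text \<open>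
  Schedule: in round \<open>0\<close> the edges are placed at random on the machines \<open>1, \<dots>, N\<close>, in round \<open>1\<close> the
  large machine draws the index \<open>s\<close> of a hash function, rounds \<open>2, \<dots>, L + 1\<close> spread it, and rounds
  \<open>L + 2, \<dots>, 2 * L + 2\<close> route the requests. The remaining rounds form phases of length \<open>L + 2\<close>:
  sample live edges, extend the matching, and send the covered vertices back along the requests.
\<close>

definition prelude :: nat where "prelude = 2 * L + 3"

definition heard :: "mailbox \<Rightarrow> fact set" where
  "heard b = (\<Union>j\<in>{..K}. decode w (b j))"

definition dead :: "mailbox \<Rightarrow> nat set" where
  "dead b = {u. (0, u, 0) \<in> heard b}"

text \<open>A small machine never stores which vertices are covered: the answers of each phase
  concern the whole current matching, so the inbox alone decides which edges are live.\<close>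

definition live_edges :: "bits \<Rightarrow> mailbox \<Rightarrow> (nat \<times> nat) set" where
  "live_edges m b = {p \<in> edges (decode w m). unordered p \<inter> dead b = {}}"

text \<open>The names of the coins drawn in round \<open>r\<close>: one per stored edge for the
  placement, one per live edge for a sample, and the dummy name \<open>(0, 0)\<close> for the
  seed.\<close>

definition keys :: "nat \<Rightarrow> nat \<Rightarrow> bits \<Rightarrow> mailbox \<Rightarrow> (nat \<times> nat) set" where
  "keys i r m b =
     (if i = 0 then if r = 1 then {(0, 0)} else {}
      else if r = 0 then set (decode_edges n m)
      else if i \<in> {1..N} \<and> prelude \<le> r \<and> (r - prelude) mod (L + 2) = 0 then live_edges m b else {})"

definition coin :: "nat \<Rightarrow> nat pmf" where
  "coin r =
     (if r = 0 then pmf_of_set {1..N}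
      else if r = 1 then pmf_of_set {..<R}
      else map_pmf of_bool (bernoulli_pmf (pr ((r - prelude) div (L + 2)))))"

text \<open>Each sender is told about the vertices it has just asked for. The queries are repeated
  in every phase, so the large machine stores nothing but the matching.\<close>

definition large_act :: "nat \<Rightarrow> bits \<Rightarrow> mailbox \<Rightarrow> coins \<Rightarrow> bits \<times> mailbox" where
  "large_act r m b \<omega> =
     (if r = 1 then (m, \<lambda>j. if j = 1 then code w {(0, \<omega> (0, 0), 0)} else [])
      else if prelude \<le> r \<and> (r - prelude) mod (L + 2) = 1 then
        (let es = grow (set (decode_edges n m)) (edges (heard b)) in
         (encode_edges n es,
          \<lambda>j. code w (vertex_facts {u \<in> covered (set es). (1, u, 0) \<in> decode w (b j)})))
      else (m, \<lambda>_. []))"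

definition place_act :: "bits \<Rightarrow> coins \<Rightarrow> bits \<times> mailbox" where
  "place_act m \<omega> = ([], \<lambda>j. encode_edges n (filter (\<lambda>p. \<omega> p = j) (decode_edges n m)))"

definition store_act :: "mailbox \<Rightarrow> bits \<times> mailbox" where
  "store_act b = (code w (edge_facts (\<Union>j\<in>{..K}. set (decode_edges n (b j)))), \<lambda>_. [])"

text \<open>Counted from \<open>0\<close>, the machines below \<open>B ^ l\<close> know the seed and
  each serves \<open>B\<close> targets, itself included: until the requests are routed the seed
  lives in the inboxes only, so a machine has to send it to itself again.\<close>

definition spread_act :: "nat \<Rightarrow> nat \<Rightarrow> bits \<Rightarrow> mailbox \<Rightarrow> bits \<times> mailbox" where
  "spread_act l i m b =
     (m, \<lambda>j. if j \<in> {1..N} \<and> j - 1 < B ^ Suc l \<and> (j - 1) mod B ^ l = i - 1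
             then code w (heard b) else [])"

text \<open>Records the requests of hop \<open>l - 1\<close> with their senders, which later tells
  \<open>down_act\<close> where to send the answers, and then performs hop \<open>l\<close>. For
  \<open>l = 0\<close> the seed is recorded instead; for \<open>l = L\<close> nothing is left to
  forward.\<close>

definition up_act :: "nat \<Rightarrow> nat \<Rightarrow> bits \<Rightarrow> mailbox \<Rightarrow> bits \<times> mailbox" where
  "up_act l i m b =
     (let S = decode w m \<union>
        (if l = 0 then (\<lambda>s. (1, s, 0)) ` {s. (0, s, 0) \<in> heard b}
         else (\<Union>j\<in>{..K}. (\<lambda>u. (l + 1, j, u)) ` {u. (0, u, 0) \<in> decode w (b j)}))
      in (code w S,
          \<lambda>j. if l < L then code w (vertex_facts
                {u \<in> requested S l. node B (H (seed S)) (Suc l) i u = j}) else []))"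

definition sample_act :: "bits \<Rightarrow> mailbox \<Rightarrow> coins \<Rightarrow> bits \<times> mailbox" where
  "sample_act m b \<omega> =
     (m, \<lambda>j. if j = 0
             then code w (edge_facts {p \<in> live_edges m b. \<omega> p = 1} \<union> query_facts (requested (decode w m) L))
             else [])"

definition down_act :: "nat \<Rightarrow> bits \<Rightarrow> mailbox \<Rightarrow> bits \<times> mailbox" where
  "down_act l m b = (m, \<lambda>j. code w (vertex_facts {u \<in> dead b. (l + 1, j, u) \<in> decode w m}))"

definition small_act :: "nat \<Rightarrow> nat \<Rightarrow> bits \<Rightarrow> mailbox \<Rightarrow> coins \<Rightarrow> bits \<times> mailbox" where
  "small_act i r m b \<omega> =
     (if r = 0 then place_act m \<omega>
      else if r = 1 then store_act b
      else if i \<notin> {1..N} then ([], \<lambda>_. [])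
      else if r < L + 2 then spread_act (r - 2) i m b
      else if r < prelude then up_act (r - (L + 2)) i m b
      else let t = (r - prelude) mod (L + 2)
        in if t = 0 then sample_act m b \<omega>
           else if t = 1 then (m, \<lambda>_. [])
           else down_act (L + 2 - t) m b)"

definition act :: "nat \<Rightarrow> nat \<Rightarrow> bits \<Rightarrow> mailbox \<Rightarrow> coins \<Rightarrow> bits \<times> mailbox" where
  "act i r m b = (if i = 0 then large_act r m b else small_act i r m b)"

definition program :: program where
  "program i r m b = map_pmf (act i r m b) (Pi_pmf (keys i r m b) 0 (\<lambda>_. coin r))"

end

section \<open>Executions of the algorithm\<close>

lemma vertex_facts_iff [simp]: "(a, u, c) \<in> vertex_facts U \<longleftrightarrow> a = 0 \<and> c = 0 \<and> u \<in> U"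
  by (auto simp: vertex_facts_def)

lemma query_facts_iff [simp]: "(a, u, c) \<in> query_facts U \<longleftrightarrow> a = 1 \<and> c = 0 \<and> u \<in> U"
  by (auto simp: query_facts_def)

lemma edge_facts_iff [simp]: "(a, u, v) \<in> edge_facts Y \<longleftrightarrow> a = 0 \<and> (u, v) \<in> Y"
  by (auto simp: edge_facts_def)

lemma vertex_facts_empty [simp]: "vertex_facts {} = {}"
  and edge_facts_empty [simp]: "edge_facts {} = {}"
  by (auto simp: vertex_facts_def edge_facts_def)

lemma card_vertex_facts [simp]: "card (vertex_facts U) = card U"
  unfolding vertex_facts_def by (rule card_image) (auto simp: inj_on_def)

lemma card_edge_facts [simp]: "card (edge_facts Y) = card Y"
  unfolding edge_facts_def by (rule card_image) (auto simp: inj_on_def)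

lemma card_query_facts [simp]: "card (query_facts U) = card U"
  unfolding query_facts_def by (rule card_image) (auto simp: inj_on_def)

context algorithm
begin

lemma act_spread:
  "l < L \<Longrightarrow> i \<in> {1..N} \<Longrightarrow> act i (2 + l) m b \<omega> = spread_act l i m b"
  by (auto simp: act_def small_act_def)

lemma act_up:
  "l \<le> L \<Longrightarrow> i \<in> {1..N} \<Longrightarrow> act i (L + 2 + l) m b \<omega> = up_act l i m b"
  by (auto simp: act_def small_act_def prelude_def)

lemma act_sample:
  "prelude \<le> r \<Longrightarrow> (r - prelude) mod (L + 2) = 0 \<Longrightarrow> i \<in> {1..N} \<Longrightarrow>
   act i r m b \<omega> = sample_act m b \<omega>"
  by (auto simp: act_def small_act_def prelude_def)

lemma act_wait:
  "prelude \<le> r \<Longrightarrow> (r - prelude) mod (L + 2) = 1 \<Longrightarrow> i \<in> {1..N} \<Longrightarrow>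
   act i r m b \<omega> = (m, \<lambda>_. [])"
  by (auto simp: act_def small_act_def prelude_def)

lemma act_down:
  "prelude \<le> r \<Longrightarrow> (r - prelude) mod (L + 2) = L + 2 - l \<Longrightarrow> 1 \<le> l \<Longrightarrow> l \<le> L \<Longrightarrow> i \<in> {1..N} \<Longrightarrow>
   act i r m b \<omega> = down_act l m b"
  by (auto simp: act_def small_act_def prelude_def Let_def)

lemma act_idle:
  "2 \<le> r \<Longrightarrow> i \<noteq> 0 \<Longrightarrow> i \<notin> {1..N} \<Longrightarrow> act i r m b \<omega> = ([], \<lambda>_. [])"
  by (auto simp: act_def small_act_def)

lemma act_large_idle:
  "r \<noteq> 1 \<Longrightarrow> r < prelude \<or> (r - prelude) mod (L + 2) \<noteq> 1 \<Longrightarrow> act 0 r m b \<omega> = (m, \<lambda>_. [])"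
  by (auto simp: act_def large_act_def)

lemma keys_empty:
  "2 \<le> r \<Longrightarrow> r < prelude \<or> (r - prelude) mod (L + 2) \<noteq> 0 \<Longrightarrow> keys i r m b = {}"
  by (auto simp: keys_def)

lemma prelude_ge: "2 \<le> prelude"
  by (simp add: prelude_def)

definition enc_mem :: "(nat \<times> nat) list \<Rightarrow> (nat \<Rightarrow> fact set) \<Rightarrow> nat \<Rightarrow> bits" where
  "enc_mem es S i = (if i = 0 then encode_edges n es else code w (S i))"

definition econf :: "(nat \<times> nat) list \<Rightarrow> (nat \<Rightarrow> fact set) \<Rightarrow> (nat \<Rightarrow> nat \<Rightarrow> fact set) \<Rightarrow> config \<Rightarrow> bool" where
  "econf es S G = conf K (enc_mem es S) (\<lambda>i j. code w (G i j))"

definition valid :: "(nat \<times> nat) list \<Rightarrow> (nat \<Rightarrow> fact set) \<Rightarrow> (nat \<Rightarrow> nat \<Rightarrow> fact set) \<Rightarrow> bool" where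
  "valid es S G \<longleftrightarrow> set es \<subseteq> {..<n} \<times> {..<n} \<and> (\<forall>i\<in>{1..K}. S i \<subseteq> facts w) \<and>
     (\<forall>i\<le>K. \<forall>j\<le>K. G i j \<subseteq> facts w)"

end

text \<open>
  A small machine holds at most \<open>q0\<close> edges and forwards at most \<open>t\<close> requests per level; a sample
  has at most \<open>cy\<close> edges; \<open>cs\<close> and \<open>cl\<close> bound the number of facts in the memory and the traffic of
  the small machines and the large machine; \<open>bnd k\<close> bounds the number of live edges before phase \<open>k\<close>.
\<close>

locale run = algorithm +
  fixes D :: "nat \<Rightarrow> (nat \<times> nat) list" and sl ss q0 t cs cy cl :: nat and bnd :: "nat \<Rightarrow> real"
  assumes n: "2 \<le> n" and B: "0 < B" and L: "0 < L" and NK: "N \<le> K"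
    and w: "n \<le> 2 ^ w" "R \<le> 2 ^ w" "N < 2 ^ w" "L + 2 < 2 ^ w" "ceillog2 n \<le> w"
    and R: "0 < R"
    and H: "\<And>s u. s < R \<Longrightarrow> u < n \<Longrightarrow> H s u < N"
    and D: "\<And>i. i \<in> {1..K} \<Longrightarrow> set (D i) \<subseteq> {..<n} \<times> {..<n}" "\<And>i. i \<in> {1..K} \<Longrightarrow> distinct (D i)"
      "disjoint_family_on (\<lambda>i. set (D i)) {1..K}"
      "\<And>i. i \<in> {1..K} \<Longrightarrow> length (encode_edges n (D i)) \<le> ss"
    and small: "3 * w * cs \<le> ss" "q0 + 1 + L * t \<le> cs" "B \<le> cs" "2 * q0 \<le> t"
    and large: "3 * w * cl \<le> sl" "cy + n \<le> cl"
begin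

definition X :: "(nat \<times> nat) set" where
  "X = (\<Union>i\<in>{1..K}. set (D i))"

lemma w0: "0 < w"
  using w(5) ceillog2_pos[OF n] by simp

lemma X_subset: "X \<subseteq> {..<n} \<times> {..<n}"
  unfolding X_def by (rule UN_least) (rule D(1))

lemma finite_X: "finite X"
  by (simp add: X_def)

lemma t_le: "t \<le> cs" "q0 + t \<le> cs"
proof -
  have "t \<le> L * t" using L by simp
  then show "t \<le> cs" "q0 + t \<le> cs" using small(2) by linarith+
qed

lemma N0: "0 < N"
  using B by simp

definition fits :: "(nat \<times> nat) list \<Rightarrow> (nat \<Rightarrow> fact set) \<Rightarrow> (nat \<Rightarrow> nat \<Rightarrow> fact set) \<Rightarrow> bool" where
  "fits es S G \<longleftrightarrow> length es \<le> n \<and>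
     (\<Sum>j\<le>K. card (G 0 j)) \<le> cl \<and> (\<Sum>j\<le>K. card (G j 0)) \<le> cl \<and>
     (\<forall>i\<in>{1..K}. card (S i) \<le> cs \<and> (\<Sum>j\<le>K. card (G i j)) \<le> cs \<and> (\<Sum>j\<le>K. card (G j i)) \<le> cs)"

lemma legal_traffic_encoded:
  assumes "valid es S G" "fits es S G"
  shows "legal_traffic K (memory sl ss) (enc_mem es S) (\<lambda>i j. code w (G i j))"
  unfolding legal_traffic_def
proof (intro allI impI)
  fix i assume i: "i \<le> K"
  have fin: "finite (G i j)" "finite (G j i)" if "j \<le> K" for j
    by (rule finite_subset[OF _ finite_facts[of w]], use assms(1) i that in \<open>simp add: valid_def\<close>)+
  have sums: "(\<Sum>j\<le>K. length (code w (G i j))) = 3 * w * (\<Sum>j\<le>K. card (G i j))"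
    "(\<Sum>j\<le>K. length (code w (G j i))) = 3 * w * (\<Sum>j\<le>K. card (G j i))"
    by (simp_all add: sum_distrib_left length_code fin)
  have mono: "3 * w * a \<le> 3 * w * b" if "a \<le> b" for a b using that by simp
  show "length (enc_mem es S i) \<le> memory sl ss i \<and>
     (\<Sum>j\<le>K. length (code w (G i j))) \<le> memory sl ss i \<and>
     (\<Sum>j\<le>K. length (code w (G j i))) \<le> memory sl ss i"
  proof (cases "i = 0")
    case True
    have "2 * ceillog2 n * length es \<le> 3 * w * cl"
      using w(5) assms(2) large(2) by (intro mult_mono) (auto simp: fits_def)
    then have "2 * ceillog2 n * length es \<le> sl" using large(1) by (rule le_trans)
    then show ?thesis
      using True assms(2) le_trans[OF mono large(1)] large(1) unfolding sums
      by (auto simp: memory_def enc_mem_def length_encode_edges fits_def)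
  next
    case False
    then have "S i \<subseteq> facts w" and cards: "card (S i) \<le> cs" "(\<Sum>j\<le>K. card (G i j)) \<le> cs"
      "(\<Sum>j\<le>K. card (G j i)) \<le> cs"
      using assms i by (auto simp: valid_def fits_def simp del: subset_iff)
    then have "finite (S i)" by (simp add: finite_subset[OF _ finite_facts])
    then show ?thesis
      using False cards le_trans[OF mono small(1)] unfolding sums
      by (simp add: memory_def enc_mem_def length_code)
  qed
qed

lemma
  assumes "econf es S G cfg" "valid es S G"
  shows decode_mem: "i \<in> {1..K} \<Longrightarrow> decode w (fst cfg i) = S i"
    and decode_large: "decode_edges n (fst cfg 0) = es"
    and decode_msg: "i \<le> K \<Longrightarrow> j \<le> K \<Longrightarrow> decode w (snd cfg i j) = G j i"
    and heard_eq: "i \<le> K \<Longrightarrow> heard (snd cfg i) = (\<Union>j\<in>{..K}. G j i)"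
    and fst_cfg: "i \<le> K \<Longrightarrow> fst cfg i = enc_mem es S i"
  using assms w0 n by (auto simp: econf_def conf_def enc_mem_def valid_def heard_def)

text \<open>With no coin names anywhere, the product is over the empty set and the only outcome is
  the default one. All rounds except the placement, the seed and the samples are of this
  kind.\<close>

lemma round_det:
  assumes C: "Collect (econf es S G) \<subseteq> C"
    and keys: "\<And>i. i \<le> K \<Longrightarrow> keys i r (fst cfg i) (snd cfg i) = {}"
    and act: "\<And>i. i \<le> K \<Longrightarrow> fst (act i r (fst cfg i) (snd cfg i) (\<lambda>_. 0)) = enc_mem es S i"
      "\<And>i j. i \<le> K \<Longrightarrow> j \<le> K \<Longrightarrow> snd (act i r (fst cfg i) (snd cfg i) (\<lambda>_. 0)) j = code w (G i j)"
    and "valid es S G" "fits es S G"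
  shows "measure_pmf.prob (round_step K (memory sl ss) program r cfg) (Some ` C) \<ge> 1 - 0"
proof (rule prob_round_step_ge[where P = program and act = act and keys = keys and q = "coin r"
      and A = "\<lambda>_. {}" and G = UNIV, OF program_def keys])
  fix \<omega>
  show "\<exists>m g. (\<forall>i\<le>K. fst (act i r (fst cfg i) (snd cfg i) (\<lambda>x. if x \<in> {} then \<omega> x else 0)) = m i \<and>
      (\<forall>j\<le>K. snd (act i r (fst cfg i) (snd cfg i) (\<lambda>x. if x \<in> {} then \<omega> x else 0)) j = g i j)) \<and>
     legal_traffic K (memory sl ss) m g \<and> Collect (conf K m g) \<subseteq> C"
    using legal_traffic_encoded[OF assms(5,6)] C
    by (intro exI[of _ "enc_mem es S"] exI[of _ "\<lambda>i j. code w (G i j)"])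
       (auto simp: act econf_def)
qed (auto simp: disjoint_family_on_def)

end

text \<open>Fixes one outcome of the placement that respects the load bound; the later rounds are
  analysed for each such outcome.\<close>

locale placed = run +
  fixes \<rho> :: "nat \<times> nat \<Rightarrow> nat"
  assumes \<rho>: "\<And>p. p \<in> X \<Longrightarrow> \<rho> p \<in> {1..N}"
    and even: "\<And>j. j \<in> {1..N} \<Longrightarrow> card {p \<in> X. \<rho> p = j} \<le> q0"
begin

definition F :: "nat \<Rightarrow> (nat \<times> nat) set" where
  "F i = {p \<in> X. \<rho> p = i}"

definition Q :: "nat \<Rightarrow> nat set" where
  "Q i = covered (F i)"

lemma F_empty: "i \<notin> {1..N} \<Longrightarrow> F i = {}"
  using \<rho> by (auto simp: F_def)

lemma UN_F: "(\<Union>i\<in>{1..N}. F i) = X"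
  using \<rho> by (auto simp: F_def)

lemma F_subset: "F i \<subseteq> X"
  by (auto simp: F_def)

lemma finite_F: "finite (F i)"
  using finite_X by (simp add: F_def)

lemma card_F: "card (F i) \<le> q0"
proof (cases "i \<in> {1..N}")
  case True
  then show ?thesis using even by (simp add: F_def)
qed (simp add: F_empty del: atLeastAtMost_iff)

lemma Q_subset: "Q i \<subseteq> {..<n}"
  using F_subset[of i] X_subset by (fastforce simp: Q_def covered_def unordered_def)

lemma card_Q: "card (Q i) \<le> 2 * q0"
proof -
  have "card (Q i) \<le> (\<Sum>p\<in>F i. card (unordered p))"
    unfolding Q_def covered_def by (rule card_UN_le[OF finite_F])
  also have "\<dots> \<le> (\<Sum>p\<in>F i. 2)"
    by (intro sum_mono) (simp add: unordered_def card_insert_if)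
  also have "\<dots> \<le> 2 * q0" using card_F[of i] by simp
  finally show ?thesis .
qed

end

text \<open>Fixes in addition a seed that balances the requests of this placement. From here on only
  the samples are random.\<close>

locale seeded = placed +
  fixes s :: nat
  assumes s: "s < R" and bal: "balanced B N L t Q (H s)"
begin

abbreviation rch :: "nat \<Rightarrow> nat \<Rightarrow> nat set" where
  "rch \<equiv> reaching B N (H s) Q"

abbreviation hp :: "nat \<Rightarrow> nat \<Rightarrow> nat \<Rightarrow> nat set" where
  "hp \<equiv> hop B N (H s) Q"

lemma rch_subset: "rch l j \<subseteq> {..<n}"
  using reaching_subset[of B N "H s" Q l j] Q_subset by blast

lemma hp_subset: "hp l j j' \<subseteq> {..<n}"
  using hop_subset[of B N "H s" Q l j j'] Q_subset by blast

lemma finite_rch: "finite (rch l j)"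
  by (rule finite_subset[OF rch_subset]) simp

lemma finite_hp: "finite (hp l j j')"
  by (rule finite_subset[OF hp_subset]) simp

lemma rch_empty: "l \<le> L \<Longrightarrow> j \<notin> {1..N} \<Longrightarrow> rch l j = {}"
  using node_range[OF B, of l L] by (auto simp: reaching_def simp del: atLeastAtMost_iff)

lemma hp_empty: "l < L \<Longrightarrow> j \<notin> {1..N} \<or> j' \<notin> {1..N} \<Longrightarrow> hp l j j' = {}"
  using node_range[OF B, of l L] node_range[OF B, of "Suc l" L]
  by (auto simp: hop_def simp del: atLeastAtMost_iff)

lemma sum_le_K: "(\<And>j. j \<notin> {1..N} \<Longrightarrow> f j = 0) \<Longrightarrow> (\<Sum>j\<le>K. f j) = (\<Sum>j\<in>{1..N}. f j :: nat)"
  using NK by (intro sum.mono_neutral_right) auto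

lemma sum_in: "l < L \<Longrightarrow> (\<Sum>j\<le>K. card (hp l j j')) \<le> t"
proof (cases "j' \<in> {1..N}")
  case True
  assume l: "l < L"
  have "(\<Sum>j\<le>K. card (hp l j j')) = (\<Sum>j\<in>{1..N}. card (hp l j j'))"
    by (rule sum_le_K) (simp add: hp_empty[OF l])
  then show ?thesis using bal l True by (simp add: balanced_def)
qed (simp add: hp_empty)

lemma card_rch: "l \<le> L \<Longrightarrow> card (rch l j) \<le> t"
proof (cases l)
  case 0
  have "card (rch 0 j) \<le> 2 * q0"
    using card_Q[of j] reaching_0[of j N] reaching_0_empty[of j N] by (cases "j \<in> {1..N}") auto
  then show ?thesis using 0 small(4) by simp
next
  case (Suc l')
  assume "l \<le> L"
  with Suc have l': "l' < L" by simp
  have "card (rch l j) \<le> (\<Sum>j'\<in>{1..N}. card (hp l' j' j))"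
    unfolding Suc reaching_Suc[OF B l' refl] by (rule card_UN_le) simp
  also have "\<dots> = (\<Sum>j'\<le>K. card (hp l' j' j))"
    by (rule sum_le_K[symmetric]) (simp add: hp_empty[OF l'])
  also have "\<dots> \<le> t" by (rule sum_in[OF l'])
  finally show ?thesis .
qed

lemma sum_out: "l < L \<Longrightarrow> (\<Sum>j'\<le>K. card (hp l j j')) \<le> card (rch l j)"
  using sum_card_hop_out_le[OF B finite_rch] sum_le_K[of "\<lambda>j'. card (hp l j j')"] hp_empty by simp

lemma rch_top: "rch L j \<subseteq> {u \<in> {..<n}. Suc (H s u) = j}"
proof -
  have "H s u < N" if "u \<in> Q i" for i u using H[OF s] Q_subset that by blast
  then show ?thesis using reaching_top[of N B L Q "H s" j] rch_subset[of L j] by auto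
qed

text \<open>All requests for \<open>u\<close> end on the machine \<open>Suc (H s u)\<close>, so the
  sets at the top level are disjoint. This limits the large machine to \<open>n\<close> queries per
  phase.\<close>

lemma sum_rch_top: "(\<Sum>j\<le>K. card (rch L j)) \<le> n"
proof -
  have "(\<Sum>j\<le>K. card (rch L j)) = card (\<Union>j\<in>{..K}. rch L j)"
    using rch_top finite_rch by (subst card_UN_disjoint) blast+
  also have "\<dots> \<le> card {..<n}" using rch_subset by (intro card_mono) auto
  finally show ?thesis by simp
qed

text \<open>The requests that machine \<open>i\<close> received in the first \<open>l\<close> hops;
  the tags start at \<open>2\<close> because \<open>0\<close> and \<open>1\<close> mark edges and
  the seed.\<close>

definition HF :: "nat \<Rightarrow> nat \<Rightarrow> fact set" where
  "HF l i = (\<Union>l'\<in>{..<l}. \<Union>j\<in>{1..N}. (\<lambda>u. (l' + 2, j, u)) ` hp l' j i)"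

definition MS :: "nat \<Rightarrow> nat \<Rightarrow> fact set" where
  "MS l i = (if i \<in> {1..N} then edge_facts (F i) \<union> {(1, s, 0)} \<union> HF l i else {})"

lemma card_MS:
  assumes "l \<le> L"
  shows "card (MS l i) \<le> cs"
proof -
  have "card (HF l i) \<le> (\<Sum>l'\<in>{..<l}. card (\<Union>j\<in>{1..N}. (\<lambda>u. (l' + 2, j, u)) ` hp l' j i))"
    unfolding HF_def by (rule card_UN_le) simp
  also have "\<dots> \<le> (\<Sum>l'\<in>{..<l}. t)"
  proof (rule sum_mono)
    fix l' assume "l' \<in> {..<l}"
    then have l': "l' < L" using assms by simp
    have "card (\<Union>j\<in>{1..N}. (\<lambda>u. (l' + 2, j, u)) ` hp l' j i)
        \<le> (\<Sum>j\<in>{1..N}. card ((\<lambda>u. (l' + 2, j, u)) ` hp l' j i))"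
      by (rule card_UN_le) simp
    also have "\<dots> \<le> (\<Sum>j\<in>{1..N}. card (hp l' j i))"
      by (intro sum_mono card_image_le finite_hp)
    also have "\<dots> \<le> t" using bal l' hp_empty[OF l', of _ i] by (cases "i \<in> {1..N}") (simp_all add: balanced_def)
    finally show "card (\<Union>j\<in>{1..N}. (\<lambda>u. (l' + 2, j, u)) ` hp l' j i) \<le> t" .
  qed
  also have "\<dots> \<le> L * t" using assms by simp
  finally have "card (HF l i) \<le> L * t" .
  moreover have "card (edge_facts (F i) \<union> {(1, s, 0)} \<union> HF l i)
      \<le> card (edge_facts (F i)) + card {(1::nat, s, 0::nat)} + card (HF l i)"
    by (intro order.trans[OF card_Un_le] add_mono order.refl)
  ultimately show ?thesis using card_F[of i] small(2) by (simp add: MS_def)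
qed

lemma lt_w: "u < n \<Longrightarrow> u < 2 ^ w" "j \<in> {1..N} \<Longrightarrow> j < 2 ^ w" "s < 2 ^ w" "l \<le> L \<Longrightarrow> l + 2 < 2 ^ w"
  "0 < (2::nat) ^ w" "1 < (2::nat) ^ w"
  using w s n by auto

lemma edge_facts_valid: "Y \<subseteq> X \<Longrightarrow> edge_facts Y \<subseteq> facts w"
  using X_subset lt_w(1) by (fastforce simp: edge_facts_def)

lemma vertex_facts_valid: "U \<subseteq> {..<n} \<Longrightarrow> vertex_facts U \<subseteq> facts w"
  using lt_w(1) by (auto simp: vertex_facts_def)

lemma query_facts_valid: "U \<subseteq> {..<n} \<Longrightarrow> query_facts U \<subseteq> facts w"
  using lt_w(1,6) by (auto simp: query_facts_def)

lemma MS_valid: "l \<le> L \<Longrightarrow> MS l i \<subseteq> facts w"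
proof -
  assume l: "l \<le> L"
  have "HF l i \<subseteq> facts w"
  proof
    fix x assume "x \<in> HF l i"
    then obtain l' j u where x: "l' < l" "j \<in> {1..N}" "u \<in> hp l' j i" "x = (l' + 2, j, u)"
      unfolding HF_def by blast
    have "u < n" using hp_subset x(3) by blast
    then show "x \<in> facts w"
      using lt_w(1)[of u] lt_w(2)[OF x(2)] lt_w(4)[of l'] x(1) l unfolding x(4) mem_facts by simp
  qed
  then show ?thesis
    using edge_facts_valid[OF F_subset] lt_w by (auto simp: MS_def simp del: atLeastAtMost_iff)
qed

lemma edges_MS: "i \<in> {1..N} \<Longrightarrow> edges (MS l i) = F i"
  by (auto simp: edges_def MS_def HF_def)

lemma seed_MS: "i \<in> {1..N} \<Longrightarrow> seed (MS l i) = s"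
  by (auto simp: seed_def MS_def HF_def)

lemma request_MS:
  assumes "i \<in> {1..N}" "l' < l" "l \<le> L"
  shows "(l' + 2, j, u) \<in> MS l i \<longleftrightarrow> u \<in> hp l' j i"
  using assms hp_empty[of l' j i] by (auto simp: MS_def HF_def simp del: atLeastAtMost_iff)

lemma requested_MS:
  assumes "i \<in> {1..N}" "l' \<le> l" "l \<le> L"
  shows "requested (MS l i) l' = rch l' i"
proof (cases l')
  case 0
  then show ?thesis using assms edges_MS by (simp add: requested_def reaching_0 Q_def)
next
  case (Suc l'')
  then have l'': "l'' < l" "l'' < L" using assms by auto
  have "requested (MS l i) l' = {u. \<exists>j. u \<in> hp l'' j i}"
    using request_MS[OF assms(1) l''(1) assms(3)] Suc by (simp add: requested_def)
  also have "\<dots> = (\<Union>j\<in>{1..N}. hp l'' j i)" using hp_empty[OF l''(2), of _ i] by blast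
  also have "\<dots> = rch l' i" using reaching_Suc[OF B l''(2) refl] Suc by simp
  finally show ?thesis .
qed

end

lemma set_Pi_pmfD: "finite A \<Longrightarrow> \<omega> \<in> set_pmf (Pi_pmf A d p) \<Longrightarrow> x \<in> A \<Longrightarrow> \<omega> x \<in> set_pmf (p x)"
  by (auto simp: set_Pi_pmf PiE_dflt_def)

section \<open>The placement round\<close>

context run
begin

definition PL :: "(nat \<times> nat \<Rightarrow> nat) \<Rightarrow> config set" where
  "PL \<rho> = Collect (conf K (\<lambda>_. []) (\<lambda>i j. if i \<in> {1..K}
     then encode_edges n (filter (\<lambda>p. \<rho> p = j) (D i)) else []))"

lemma decode_D: "i \<in> {1..K} \<Longrightarrow> decode_edges n (encode_edges n (D i)) = D i"
  using D(1) n by simp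

lemma sum_length_filter:
  assumes "finite J" "\<And>p. p \<in> set xs \<Longrightarrow> f p \<in> J"
  shows "(\<Sum>j\<in>J. length (filter (\<lambda>p. f p = j) xs)) = length xs"
  using assms(2)
proof (induction xs)
  case (Cons x xs)
  have "(\<Sum>j\<in>J. length (filter (\<lambda>p. f p = j) (x # xs)))
      = (\<Sum>j\<in>J. (if f x = j then 1 else 0) + length (filter (\<lambda>p. f p = j) xs))"
    by (intro sum.cong) auto
  then show ?case using Cons assms(1) by (simp add: sum.distrib)
qed simp

text \<open>What machine \<open>i\<close> sends is its input cut into pieces, so this traffic is
  exactly as long as the initial memory contents and fits even if the memory was full. What it
  receives is bounded through the load \<open>q0\<close>.\<close>

lemma placement_legal:
  assumes \<rho>: "\<And>p. p \<in> X \<Longrightarrow> \<rho> p \<in> {1..N}"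
    and even: "\<And>j. j \<in> {1..N} \<Longrightarrow> card {p \<in> X. \<rho> p = j} \<le> q0"
  shows "legal_traffic K (memory sl ss) (\<lambda>_. []) (\<lambda>i j. if i \<in> {1..K}
     then encode_edges n (filter (\<lambda>p. \<rho> p = j) (D i)) else [])"
  unfolding legal_traffic_def
proof (intro allI impI conjI)
  fix i assume i: "i \<le> K"
  let ?g = "\<lambda>i j. if i \<in> {1..K} then encode_edges n (filter (\<lambda>p. \<rho> p = j) (D i)) else []"
  show "length [] \<le> memory sl ss i" by simp
  show "(\<Sum>j\<le>K. length (?g i j)) \<le> memory sl ss i"
  proof (cases "i \<in> {1..K}")
    case True
    have "\<rho> p \<in> {..K}" if "p \<in> set (D i)" for p
    proof -
      have "p \<in> X" using that True unfolding X_def by blast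
      from \<rho>[OF this] NK show ?thesis by simp
    qed
    then have "(\<Sum>j\<le>K. length (filter (\<lambda>p. \<rho> p = j) (D i))) = length (D i)"
      by (intro sum_length_filter) auto
    then have "(\<Sum>j\<le>K. length (?g i j)) = length (encode_edges n (D i))"
      using True by (simp add: length_encode_edges flip: sum_distrib_left)
    then show ?thesis using D(4)[OF True] True by (simp add: memory_def)
  qed (simp del: atLeastAtMost_iff)
  have "length (?g j i) = (if j \<in> {1..K} then 2 * ceillog2 n * card {p \<in> set (D j). \<rho> p = i} else 0)" for j
    using D(2)[of j] by (simp add: length_encode_edges distinct_card[symmetric])
  then have "(\<Sum>j\<le>K. length (?g j i))
      = (\<Sum>j\<le>K. if j \<in> {1..K} then 2 * ceillog2 n * card {p \<in> set (D j). \<rho> p = i} else 0)"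
    by (simp only:)
  also have "\<dots> = (\<Sum>j\<in>{1..K}. 2 * ceillog2 n * card {p \<in> set (D j). \<rho> p = i})"
    by (subst sum.inter_filter[symmetric]) (auto intro!: sum.cong)
  also have "\<dots> = 2 * ceillog2 n * (\<Sum>j\<in>{1..K}. card {p \<in> set (D j). \<rho> p = i})"
    by (rule sum_distrib_left[symmetric])
  also have "(\<Sum>j\<in>{1..K}. card {p \<in> set (D j). \<rho> p = i}) = card (\<Union>j\<in>{1..K}. {p \<in> set (D j). \<rho> p = i})"
    using D(3) by (subst card_UN_disjoint) (auto simp: disjoint_family_on_def)
  also have "(\<Union>j\<in>{1..K}. {p \<in> set (D j). \<rho> p = i}) = {p \<in> X. \<rho> p = i}"
    by (auto simp: X_def)
  finally have eq: "(\<Sum>j\<le>K. length (?g j i)) = 2 * ceillog2 n * card {p \<in> X. \<rho> p = i}" .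
  show "(\<Sum>j\<le>K. length (?g j i)) \<le> memory sl ss i"
  proof (cases "i \<in> {1..N}")
    case True
    have "2 * ceillog2 n * card {p \<in> X. \<rho> p = i} \<le> 3 * w * cs"
      using w(5) even[OF True] small(2) by (intro mult_mono) auto
    then show ?thesis unfolding eq using True small(1) by (simp add: memory_def)
  next
    case False
    then have "{p \<in> X. \<rho> p = i} = {}" using \<rho> by auto
    then show ?thesis unfolding eq by (simp only: card.empty)
  qed
qed

lemma placement_round:
  assumes e: "real N * (exp (real (card X) / real N) * 2 powr (- real q0)) \<le> e"
  shows "measure_pmf.prob (round_step K (memory sl ss) program 0 (initial_config n D))
     (Some ` (\<Union>\<rho>\<in>{\<rho>. placed n K B L w R H D sl ss q0 t cs cy cl \<rho>}. PL \<rho>)) \<ge> 1 - e"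
proof -
  let ?cfg = "initial_config n D"
  define A where "A = (\<lambda>i. keys i 0 (fst ?cfg i) (snd ?cfg i))"
  have A: "A i = (if i = 0 then {} else set (D i))" if "i \<le> K" for i
    using decode_D[of i] that by (auto simp: A_def keys_def initial_config_def)
  have UA: "(\<Union>i\<in>{..K}. A i) = X"
  proof -
    have "(\<Union>i\<in>{..K}. A i) = (\<Union>i\<in>{..K}. if i = 0 then {} else set (D i))"
      by (intro SUP_cong refl A) simp
    also have "\<dots> = X" by (fastforce simp: X_def split: if_splits)
    finally show ?thesis .
  qed
  define G where "G = {\<omega>. \<not> (\<exists>j\<in>{1..N}. q0 \<le> card {x \<in> X. \<omega> x = j})}"
  let ?M = "Pi_pmf X 0 (\<lambda>_. coin 0)"
  show ?thesis
  proof (rule prob_round_step_ge[where P = program and act = act and keys = keys and q = "coin 0"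
        and A = A and G = G, OF program_def], unfold UA)
    show "keys i 0 (fst ?cfg i) (snd ?cfg i) = A i" for i by (simp add: A_def)
    show "finite (A i)" if "i \<le> K" for i using A[OF that] by simp
    show "disjoint_family_on A {..K}"
      using D(3) A by (auto simp: disjoint_family_on_def)
    have "measure_pmf.prob ?M (- G) \<le> e"
      using prob_uneven_placement_le[OF finite_X N0, of 0 q0] e
      by (auto simp: coin_def G_def Compl_eq)
    then show "1 - e \<le> measure_pmf.prob ?M G"
      using measure_pmf.prob_compl[of G ?M] by (simp add: Compl_eq_Diff_UNIV)
  next
    fix \<omega> assume \<omega>: "\<omega> \<in> G" "\<omega> \<in> set_pmf ?M"
    have r: "\<omega> p \<in> {1..N}" if "p \<in> X" for p
    proof -
      have "set_pmf (coin 0) = {1..N}"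
        using N0 unfolding coin_def if_P[OF refl] by (intro set_pmf_of_set) auto
      moreover have "\<omega> p \<in> set_pmf (coin 0)"
        by (rule set_Pi_pmfD[OF finite_X \<omega>(2) that])
      ultimately show ?thesis by simp
    qed
    have ev: "card {p \<in> X. \<omega> p = j} \<le> q0" if "j \<in> {1..N}" for j
    proof -
      have "\<not> q0 \<le> card {p \<in> X. \<omega> p = j}" using \<omega>(1) that unfolding G_def by blast
      then show ?thesis by simp
    qed
    have pl: "placed n K B L w R H D sl ss q0 t cs cy cl \<omega>"
      using r ev by unfold_locales
    let ?g = "\<lambda>i j. if i \<in> {1..K} then encode_edges n (filter (\<lambda>p. \<omega> p = j) (D i)) else []"
    have act: "act i 0 (fst ?cfg i) (snd ?cfg i) (\<lambda>x. if x \<in> A i then \<omega> x else 0)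
        = ([], \<lambda>j. ?g i j)" if "i \<le> K" for i
    proof (cases "i = 0")
      case True
      then show ?thesis by (simp add: act_def large_act_def initial_config_def prelude_def)
    next
      case False
      with that have i: "i \<in> {1..K}" by simp
      have "filter (\<lambda>p. (if p \<in> A i then \<omega> p else 0) = j) (D i) = filter (\<lambda>p. \<omega> p = j) (D i)" for j
        using A[OF that] False by (intro filter_cong) auto
      then show ?thesis
        using False i by (simp add: act_def small_act_def place_act_def initial_config_def decode_D)
    qed
    show "\<exists>m g. (\<forall>i\<le>K. fst (act i 0 (fst ?cfg i) (snd ?cfg i) (\<lambda>x. if x \<in> A i then \<omega> x else 0)) = m i \<and>
        (\<forall>j\<le>K. snd (act i 0 (fst ?cfg i) (snd ?cfg i) (\<lambda>x. if x \<in> A i then \<omega> x else 0)) j = g i j)) \<and>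
       legal_traffic K (memory sl ss) m g \<and>
       Collect (conf K m g) \<subseteq> (\<Union>\<rho>\<in>{\<rho>. placed n K B L w R H D sl ss q0 t cs cy cl \<rho>}. PL \<rho>)"
      using placement_legal[OF r ev] pl act
      by (intro exI[of _ "\<lambda>_. []"] exI[of _ ?g]) (auto simp: PL_def)
  qed
qed

end

section \<open>Storing the edges and drawing the seed\<close>

context placed
begin

text \<open>The next step depends only on what is heard and not on who sent it, so the traffic
  \<open>G\<close> is left open and only the union of each inbox is fixed.\<close>

definition BC :: "nat \<Rightarrow> nat \<Rightarrow> config set" where
  "BC s l = {cfg. \<exists>G. econf [] (\<lambda>i. edge_facts (F i)) G cfg \<and> valid [] (\<lambda>i. edge_facts (F i)) G \<and>
     (\<forall>j\<le>K. (\<Union>i\<in>{..K}. G i j) = (if j \<in> {1..N} \<and> j - 1 < B ^ l then {(0, s, 0)} else {}))}"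

lemma edge_facts_F_valid: "edge_facts (F i) \<subseteq> facts w"
proof
  fix x assume "x \<in> edge_facts (F i)"
  then obtain u v where x: "x = (0, u, v)" "(u, v) \<in> X" using F_subset[of i] by (auto simp: edge_facts_def)
  then have "u < n" "v < n" using X_subset by auto
  then show "x \<in> facts w" using w(1) x by simp
qed

text \<open>The requests \<open>Q\<close> are determined by the placement before the seed is drawn,
  so a uniform seed fails with the fraction of functions that are bad for this one
  \<open>Q\<close>.\<close>

lemma seed_round:
  assumes cfg: "cfg \<in> PL \<rho>"
    and bad: "real (card {s. s < R \<and> \<not> balanced B N L t Q (H s)}) \<le> e * real R"
  shows "measure_pmf.prob (round_step K (memory sl ss) program 1 cfg)
     (Some ` (\<Union>s\<in>{s. s < R \<and> balanced B N L t Q (H s)}. BC s 0)) \<ge> 1 - e"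
proof -
  define A where "A = (\<lambda>i. keys i 1 (fst cfg i) (snd cfg i))"
  have A: "A i = (if i = 0 then {(0, 0)} else {})" for i
    by (simp add: A_def keys_def prelude_def)
  have UA: "(\<Union>i\<in>{..K}. A i) = {(0, 0)}"
    by (auto simp: A)
  define G where "G = {\<omega> :: coins. balanced B N L t Q (H (\<omega> (0, 0)))}"
  let ?M = "Pi_pmf {(0, 0)} 0 (\<lambda>_. coin 1) :: coins pmf"
  show ?thesis
  proof (rule prob_round_step_ge[where P = program and act = act and keys = keys and q = "coin 1"
        and A = A and G = G, OF program_def], unfold UA)
    show "keys i 1 (fst cfg i) (snd cfg i) = A i" for i by (simp add: A_def)
    show "finite (A i)" for i by (simp add: A)
    show "disjoint_family_on A {..K}" by (auto simp: A disjoint_family_on_def)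
    have neR: "{..<R} \<noteq> {}" using R by (simp add: lessThan_empty_iff)
    have "measure_pmf.prob ?M (- G)
        = measure_pmf.prob (map_pmf (\<lambda>\<omega>. \<omega> (0, 0)) ?M) {s. \<not> balanced B N L t Q (H s)}"
      unfolding measure_map_pmf by (intro arg_cong[where f = "measure_pmf.prob ?M"]) (auto simp: G_def)
    also have "\<dots> = measure_pmf.prob (pmf_of_set {..<R}) {s. \<not> balanced B N L t Q (H s)}"
      by (subst Pi_pmf_component) (auto simp: coin_def)
    also have "\<dots> = real (card {s. s < R \<and> \<not> balanced B N L t Q (H s)}) / real R"
      using neR by (subst measure_pmf_of_set) (auto intro!: arg_cong[where f = card] simp: lessThan_def)
    also have "\<dots> \<le> e" using bad R by (simp add: divide_le_eq)
    finally show "1 - e \<le> measure_pmf.prob ?M G"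
      using measure_pmf.prob_compl[of G ?M] by (simp add: Compl_eq_Diff_UNIV)
  next
    fix \<omega> assume \<omega>: "\<omega> \<in> G" "\<omega> \<in> set_pmf ?M"
    define s where "s = \<omega> (0, 0)"
    have "s \<in> set_pmf (coin 1)"
      unfolding s_def by (rule set_Pi_pmfD[OF _ \<omega>(2)]) auto
    then have sR: "s < R"
      using R by (simp add: coin_def set_pmf_of_set lessThan_empty_iff)
    have sb: "balanced B N L t Q (H s)" using \<omega>(1) by (simp add: G_def s_def)
    let ?G = "\<lambda>i j. if i = 0 \<and> j = 1 then {(0, s, 0)} else {} :: fact set"
    let ?S = "\<lambda>i. edge_facts (F i)"
    have val: "valid [] ?S ?G"
      using edge_facts_F_valid w sR by (auto simp: valid_def)
    have ft: "fits [] ?S ?G"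
    proof -
      have out: "(\<Sum>j\<le>K. card (?G i j)) \<le> 1" for i
        by (rule order.trans[of _ "\<Sum>j\<le>K. if j = 1 then 1 else 0"]) (intro sum_mono, auto)
      have inn: "(\<Sum>j\<le>K. card (?G j i)) \<le> 1" for i
        by (rule order.trans[of _ "\<Sum>j\<le>K. if j = 0 then 1 else 0"]) (intro sum_mono, auto)
      have one: "1 \<le> cl" "1 \<le> cs" using large(2) n small by auto
      have "card (?S i) \<le> cs" for i using card_F[of i] small by simp
      then show ?thesis unfolding fits_def
        using one by (intro conjI ballI order.trans[OF out] order.trans[OF inn]) auto
    qed
    have cf: "snd cfg i j = (if j \<in> {1..K} then encode_edges n (filter (\<lambda>p. \<rho> p = i) (D j)) else [])"
      "fst cfg i = []" if "i \<le> K" "j \<le> K" for i j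
      using cfg that by (auto simp: PL_def conf_def)
    have stored: "(\<Union>j\<in>{..K}. set (decode_edges n (snd cfg i j))) = F i" if "i \<le> K" for i
    proof -
      have dec: "set (decode_edges n (snd cfg i j))
          = (if j \<in> {1..K} then {p \<in> set (D j). \<rho> p = i} else {})" if "j \<le> K" for j
      proof (cases "j \<in> {1..K}")
        case True
        have "set (filter (\<lambda>p. \<rho> p = i) (D j)) \<subseteq> {..<n} \<times> {..<n}" using D(1)[OF True] by auto
        from decode_encode_edges[OF n this] show ?thesis
          using True unfolding cf(1)[OF \<open>i \<le> K\<close> that] by (simp del: atLeastAtMost_iff)
      next
        case False
        then show ?thesis using n unfolding cf(1)[OF \<open>i \<le> K\<close> that] by (simp del: atLeastAtMost_iff)
      qed
      have "(\<Union>j\<in>{..K}. set (decode_edges n (snd cfg i j)))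
          = (\<Union>j\<in>{..K}. if j \<in> {1..K} then {p \<in> set (D j). \<rho> p = i} else {})"
        by (intro SUP_cong refl dec) simp
      also have "\<dots> = F i" by (auto simp: F_def X_def split: if_splits)
      finally show ?thesis .
    qed
    have act: "fst (act i 1 (fst cfg i) (snd cfg i) (\<lambda>x. if x \<in> A i then \<omega> x else 0)) = enc_mem [] ?S i \<and>
        (\<forall>j\<le>K. snd (act i 1 (fst cfg i) (snd cfg i) (\<lambda>x. if x \<in> A i then \<omega> x else 0)) j = code w (?G i j))"
      if "i \<le> K" for i
      using cf(2)[OF that le0] stored[OF that]
      by (cases "i = 0") (auto simp: act_def large_act_def small_act_def store_act_def enc_mem_def A s_def)
    have "Collect (conf K (enc_mem [] ?S) (\<lambda>i j. code w (?G i j))) \<subseteq> BC s 0"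
    proof
      fix c assume "c \<in> Collect (conf K (enc_mem [] ?S) (\<lambda>i j. code w (?G i j)))"
      then have "econf [] ?S ?G c" by (simp add: econf_def)
      moreover have "(\<Union>i\<in>{..K}. ?G i j) = (if j \<in> {1..N} \<and> j - 1 < B ^ 0 then {(0, s, 0)} else {})" for j
        using N0 by (auto split: if_splits)
      ultimately show "c \<in> BC s 0" using val unfolding BC_def by blast
    qed
    then have sub: "Collect (conf K (enc_mem [] ?S) (\<lambda>i j. code w (?G i j)))
        \<subseteq> (\<Union>s\<in>{s. s < R \<and> balanced B N L t Q (H s)}. BC s 0)"
      using sR sb by blast
    show "\<exists>m g. (\<forall>i\<le>K. fst (act i 1 (fst cfg i) (snd cfg i) (\<lambda>x. if x \<in> A i then \<omega> x else 0)) = m i \<and>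
        (\<forall>j\<le>K. snd (act i 1 (fst cfg i) (snd cfg i) (\<lambda>x. if x \<in> A i then \<omega> x else 0)) j = g i j)) \<and>
       legal_traffic K (memory sl ss) m g \<and>
       Collect (conf K m g) \<subseteq> (\<Union>s\<in>{s. s < R \<and> balanced B N L t Q (H s)}. BC s 0)"
      using legal_traffic_encoded[OF val ft] sub act
      by (intro exI[of _ "enc_mem [] ?S"] exI[of _ "\<lambda>i j. code w (?G i j)"] conjI allI impI) blast+
  qed
qed

end

section \<open>Spreading the seed, routing the requests and returning the answers\<close>

context seeded
begin

definition UP :: "nat \<Rightarrow> config set" where
  "UP l = Collect (econf [] (MS l) (\<lambda>i j. vertex_facts (hp l i j)))"

text \<open>The invariant at the start of phase \<open>k\<close>. The last clause yields the final
  result: after a phase that samples everything no live edge is left.\<close>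

definition matched :: "nat \<Rightarrow> (nat \<times> nat) list \<Rightarrow> bool" where
  "matched k es \<longleftrightarrow> distinct es \<and> set es \<subseteq> X \<and> indep (set es) \<and>
     real (card (alive X (set es))) \<le> bnd k \<and> (0 < k \<longrightarrow> pr (k - 1) = 1 \<longrightarrow> alive X (set es) = {})"

text \<open>The answers for phase \<open>k\<close> have travelled back to level \<open>l\<close>;
  \<open>DN 0 k\<close> is the start of the phase.\<close>

definition DN :: "nat \<Rightarrow> nat \<Rightarrow> config set" where
  "DN l k = {cfg. \<exists>es G. econf es (MS L) G cfg \<and> valid es (MS L) G \<and> matched k es \<and>
     (\<forall>j\<in>{1..N}. {u. (0, u, 0) \<in> (\<Union>i\<in>{..K}. G i j)} = rch l j \<inter> covered (set es))}"

definition query_msgs :: "(nat \<times> nat) set \<Rightarrow> nat \<Rightarrow> nat \<Rightarrow> fact set" where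
  "query_msgs Y i j = (if j = 0 \<and> i \<in> {1..N} then edge_facts (Y \<inter> F i) \<union> query_facts (rch L i) else {})"

text \<open>Keeps the outcome of the sampling as a statement about all vertex sets \<open>U\<close>,
  which turns the extension of the matching in the next round into a deterministic step.\<close>

definition QS :: "nat \<Rightarrow> config set" where
  "QS k = {cfg. \<exists>es Y. econf es (MS L) (query_msgs Y) cfg \<and> matched k es \<and> Y \<subseteq> alive X (set es) \<and>
     (\<forall>U\<subseteq>{..<n}. (\<forall>x\<in>alive X (set es). unordered x \<subseteq> U \<longrightarrow> x \<notin> Y) \<longrightarrow>
        real (card {x \<in> alive X (set es). unordered x \<subseteq> U}) \<le> bnd (Suc k)) \<and>
     (pr k = 1 \<longrightarrow> Y = alive X (set es))}"

lemma valid_MS: "set es \<subseteq> X \<Longrightarrow> l \<le> L \<Longrightarrow> (\<And>i j. i \<le> K \<Longrightarrow> j \<le> K \<Longrightarrow> G i j \<subseteq> facts w) \<Longrightarrow> valid es (MS l) G"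
  using X_subset MS_valid[of l] by (simp add: valid_def)

lemma length_matched: "distinct es \<Longrightarrow> set es \<subseteq> X \<Longrightarrow> indep (set es) \<Longrightarrow> length es \<le> n"
  using card_indep_le[of "set es" n] X_subset by (auto simp: distinct_card)

lemma spread_fanout: "card {j \<in> {1..N}. j - 1 < B ^ Suc l \<and> (j - 1) mod B ^ l = x} \<le> B"
proof -
  have "card {j \<in> {1..N}. j - 1 < B ^ Suc l \<and> (j - 1) mod B ^ l = x} \<le> card {..<B}"
  proof (rule card_inj_on_le[where f = "\<lambda>j. (j - 1) div B ^ l"])
    show "inj_on (\<lambda>j. (j - 1) div B ^ l) {j \<in> {1..N}. j - 1 < B ^ Suc l \<and> (j - 1) mod B ^ l = x}"
    proof (rule inj_onI)
      fix i j assume i: "i \<in> {j \<in> {1..N}. j - 1 < B ^ Suc l \<and> (j - 1) mod B ^ l = x}"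
        and j: "j \<in> {j \<in> {1..N}. j - 1 < B ^ Suc l \<and> (j - 1) mod B ^ l = x}"
        and eq: "(i - 1) div B ^ l = (j - 1) div B ^ l"
      have "i - 1 = (i - 1) div B ^ l * B ^ l + (i - 1) mod B ^ l"
        "j - 1 = (j - 1) div B ^ l * B ^ l + (j - 1) mod B ^ l"
        by (rule div_mult_mod_eq[symmetric])+
      moreover have "(i - 1) mod B ^ l = (j - 1) mod B ^ l" using i j by simp
      ultimately have "i - 1 = j - 1" using eq by metis
      then show "i = j" using i j by (simp add: eq_diff_iff)
    qed
    show "(\<lambda>j. (j - 1) div B ^ l) ` {j \<in> {1..N}. j - 1 < B ^ Suc l \<and> (j - 1) mod B ^ l = x} \<subseteq> {..<B}"
      using B by (auto simp: less_mult_imp_div_less)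
  qed simp
  then show ?thesis by simp
qed

lemma spread_round:
  assumes l: "l < L" and cfg: "cfg \<in> BC s l"
  shows "measure_pmf.prob (round_step K (memory sl ss) program (2 + l) cfg) (Some ` BC s (Suc l)) \<ge> 1 - 0"
proof -
  let ?S = "\<lambda>i. edge_facts (F i)"
  obtain G where G: "econf [] ?S G cfg" "valid [] ?S G"
    and heard_G: "\<And>j. j \<le> K \<Longrightarrow> (\<Union>i\<in>{..K}. G i j) = (if j \<in> {1..N} \<and> j - 1 < B ^ l then {(0, s, 0)} else {})"
    using cfg unfolding BC_def by blast
  define c where "c = (\<lambda>i j. i \<in> {1..N} \<and> j \<in> {1..N} \<and> j - 1 < B ^ Suc l \<and> (j - 1) mod B ^ l = i - 1)"
  define G' :: "nat \<Rightarrow> nat \<Rightarrow> fact set" where "G' = (\<lambda>i j. if c i j then {(0, s, 0)} else {})"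
  have val: "valid [] ?S G'"
    using edge_facts_F_valid lt_w(3,5) by (auto simp: valid_def G'_def)
  have cardG': "card (G' i j) = (if c i j then 1 else 0)" for i j by (simp add: G'_def)
  have out: "(\<Sum>j\<le>K. card (G' i j)) \<le> B" for i
  proof -
    have "(\<Sum>j\<le>K. card (G' i j)) = card {j \<in> {..K}. c i j}"
      by (simp add: cardG' sum.inter_filter[symmetric])
    also have "\<dots> \<le> card {j \<in> {1..N}. j - 1 < B ^ Suc l \<and> (j - 1) mod B ^ l = i - 1}"
      by (intro card_mono) (auto simp: c_def)
    also have "\<dots> \<le> B" by (rule spread_fanout)
    finally show ?thesis .
  qed
  have inn: "(\<Sum>i\<le>K. card (G' i j)) \<le> 1" for j
  proof -
    have "(\<Sum>i\<le>K. card (G' i j)) = card {i \<in> {..K}. c i j}"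
      by (simp add: cardG' sum.inter_filter[symmetric])
    also have "\<dots> \<le> card {Suc ((j - 1) mod B ^ l)}"
      by (intro card_mono) (auto simp: c_def)
    finally show ?thesis by simp
  qed
  have G'0: "G' 0 j = {}" for j by (simp add: G'_def c_def)
  have ft: "fits [] ?S G'"
    unfolding fits_def
  proof (intro conjI ballI)
    show "(\<Sum>j\<le>K. card (G' 0 j)) \<le> cl" by (simp add: G'0)
    show "(\<Sum>j\<le>K. card (G' j 0)) \<le> cl" using inn[of 0] large(2) n by linarith
    fix i
    show "card (?S i) \<le> cs" using card_F[of i] small(2) by simp
    show "(\<Sum>j\<le>K. card (G' i j)) \<le> cs" using out[of i] small(3) by linarith
    show "(\<Sum>j\<le>K. card (G' j i)) \<le> cs" using inn[of i] small(2) by linarith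
  qed simp
  have union: "(\<Union>i\<in>{..K}. G' i j) = (if j \<in> {1..N} \<and> j - 1 < B ^ Suc l then {(0, s, 0)} else {})" for j
  proof (cases "j \<in> {1..N} \<and> j - 1 < B ^ Suc l")
    case True
    let ?i = "Suc ((j - 1) mod B ^ l)"
    have "(j - 1) mod B ^ l \<le> j - 1" by (rule mod_less_eq_dividend)
    moreover have "j - 1 < N" "1 \<le> j" using True by auto
    ultimately have "?i \<in> {1..N}" unfolding atLeastAtMost_iff by linarith
    then have "c ?i j" "?i \<in> {..K}" using True NK by (auto simp: c_def)
    then have "(0, s, 0) \<in> (\<Union>i\<in>{..K}. G' i j)" unfolding G'_def by (intro UN_I[of ?i]) auto
    moreover have "(\<Union>i\<in>{..K}. G' i j) \<subseteq> {(0, s, 0)}" by (auto simp: G'_def split: if_splits)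
    ultimately show ?thesis using True by auto
  next
    case False
    then show ?thesis by (auto simp: G'_def c_def)
  qed
  show ?thesis
  proof (rule round_det[where es = "[]" and S = ?S and G = G'])
    show "Collect (econf [] ?S G') \<subseteq> BC s (Suc l)"
      using val union unfolding BC_def by blast
    show "keys i (2 + l) (fst cfg i) (snd cfg i) = {}" for i
      using l by (intro keys_empty) (auto simp: prelude_def)
  next
    fix i assume i: "i \<le> K"
    consider (large) "i = 0" | (relay) "i \<in> {1..N}" | (idle) "i \<noteq> 0" "i \<notin> {1..N}" by blast
    then have "act i (2 + l) (fst cfg i) (snd cfg i) (\<lambda>_. 0) = (enc_mem [] ?S i, \<lambda>j. code w (G' i j))"
    proof cases
      case large
      have "act 0 (2 + l) (fst cfg 0) (snd cfg 0) (\<lambda>_. 0) = (fst cfg 0, \<lambda>_. [])"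
        using l by (intro act_large_idle) (auto simp: prelude_def)
      then show ?thesis using large fst_cfg[OF G, of 0] G'0 by simp
    next
      case relay
      have "(if j \<in> {1..N} \<and> j - 1 < B ^ Suc l \<and> (j - 1) mod B ^ l = i - 1 then code w (heard (snd cfg i)) else [])
          = code w (G' i j)" for j
      proof (cases "c i j")
        case True
        then have "i - 1 = (j - 1) mod B ^ l" by (simp add: c_def)
        then have "i - 1 < B ^ l" using B by simp
        then have "heard (snd cfg i) = {(0, s, 0)}"
          using heard_eq[OF G i] heard_G[OF i] relay by simp
        moreover have "j \<in> {1..N} \<and> j - 1 < B ^ Suc l \<and> (j - 1) mod B ^ l = i - 1"
          using True unfolding c_def by blast
        ultimately show ?thesis using True by (simp only: G'_def if_True simp_thms)
      next
        case False
        then have "\<not> (j \<in> {1..N} \<and> j - 1 < B ^ Suc l \<and> (j - 1) mod B ^ l = i - 1)"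
          using relay unfolding c_def by blast
        then show ?thesis using False by (simp only: G'_def if_False code_empty)
      qed
      then show ?thesis
        using act_spread[OF l relay] fst_cfg[OF G i] by (simp add: spread_act_def del: atLeastAtMost_iff)
    next
      case idle
      have "G' i j = {}" for j using idle by (simp add: G'_def c_def del: atLeastAtMost_iff)
      moreover have "act i (2 + l) (fst cfg i) (snd cfg i) (\<lambda>_. 0) = ([], \<lambda>_. [])"
        by (rule act_idle) (use idle in auto)
      ultimately show ?thesis using idle F_empty[OF idle(2)] by (simp add: enc_mem_def del: atLeastAtMost_iff)
    qed
    then show "fst (act i (2 + l) (fst cfg i) (snd cfg i) (\<lambda>_. 0)) = enc_mem [] ?S i"
      "snd (act i (2 + l) (fst cfg i) (snd cfg i) (\<lambda>_. 0)) j = code w (G' i j)" for j by simp_all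
  qed (rule val ft)+
qed

lemma hp_0: "l < L \<Longrightarrow> hp l 0 j = {}" "l < L \<Longrightarrow> hp l j 0 = {}"
  using hp_empty[of l 0 j] hp_empty[of l j 0] by auto

lemma sum_hp_le: "l < L \<Longrightarrow> (\<Sum>j\<le>K. card (hp l j i)) \<le> cs" "l < L \<Longrightarrow> (\<Sum>j\<le>K. card (hp l i j)) \<le> cs"
  using sum_in[of l i] sum_out[of l i] card_rch[of l i] t_le by simp_all

text \<open>One argument for all hops: the hypothesis on \<open>S\<close> absorbs whether the seed
  or a batch of requests is recorded.\<close>

lemma up_round:
  assumes l: "l \<le> L" and G: "econf [] S G cfg" "valid [] S G"
    and S: "\<And>i. i \<in> {1..N} \<Longrightarrow> S i \<union>
        (if l = 0 then (\<lambda>s. (1, s, 0)) ` {s. (0, s, 0) \<in> (\<Union>j\<in>{..K}. G j i)}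
         else (\<Union>j\<in>{..K}. (\<lambda>u. (l + 1, j, u)) ` {u. (0, u, 0) \<in> G j i})) = MS l i"
    and C: "Collect (econf [] (MS l) (\<lambda>i j. if l < L then vertex_facts (hp l i j) else {})) \<subseteq> C"
  shows "measure_pmf.prob (round_step K (memory sl ss) program (L + 2 + l) cfg) (Some ` C) \<ge> 1 - 0"
proof (rule round_det[OF C])
  let ?G' = "\<lambda>i j. if l < L then vertex_facts (hp l i j) else {}"
  show "keys i (L + 2 + l) (fst cfg i) (snd cfg i) = {}" for i
    using l by (intro keys_empty) (auto simp: prelude_def)
  show "valid [] (MS l) ?G'"
    using l hp_subset by (intro valid_MS) (auto simp del: subset_iff intro!: vertex_facts_valid)
  show "fits [] (MS l) ?G'"
    unfolding fits_def
    using l card_MS[OF l] sum_hp_le[of l] hp_0[of l] by (cases "l < L") simp_all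
  fix i assume i: "i \<le> K"
  consider (large) "i = 0" | (relay) "i \<in> {1..N}" | (idle) "i \<noteq> 0" "i \<notin> {1..N}" by blast
  then have "fst (act i (L + 2 + l) (fst cfg i) (snd cfg i) (\<lambda>_. 0)) = enc_mem [] (MS l) i \<and>
    (\<forall>j. snd (act i (L + 2 + l) (fst cfg i) (snd cfg i) (\<lambda>_. 0)) j = code w (?G' i j))"
  proof cases
    case large
    have "act 0 (L + 2 + l) (fst cfg 0) (snd cfg 0) (\<lambda>_. 0) = (fst cfg 0, \<lambda>_. [])"
      using l by (intro act_large_idle) (auto simp: prelude_def)
    then show ?thesis using large fst_cfg[OF G, of 0] hp_0 by (simp add: enc_mem_def)
  next
    case relay
    have dec: "decode w (snd cfg i j) = G j i" if "j \<in> {..K}" for j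
      using decode_msg[OF G i] that by simp
    have mem: "decode w (fst cfg i) = S i"
      using decode_mem[OF G] relay NK by simp
    have "(\<Union>j\<in>{..K}. (\<lambda>u. (l + 1, j, u)) ` {u. (0, u, 0) \<in> decode w (snd cfg i j)})
        = (\<Union>j\<in>{..K}. (\<lambda>u. (l + 1, j, u)) ` {u. (0, u, 0) \<in> G j i})"
      by (intro SUP_cong refl) (simp only: dec)
    then have new: "decode w (fst cfg i) \<union>
        (if l = 0 then (\<lambda>s. (1, s, 0)) ` {s. (0, s, 0) \<in> heard (snd cfg i)}
         else (\<Union>j\<in>{..K}. (\<lambda>u. (l + 1, j, u)) ` {u. (0, u, 0) \<in> decode w (snd cfg i j)})) = MS l i"
      using S[OF relay] by (simp only: mem heard_eq[OF G i])
    have "{u \<in> requested (MS l i) l. node B (H (seed (MS l i))) (Suc l) i u = j} = hp l i j" for j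
      unfolding requested_MS[OF relay order.refl l] seed_MS[OF relay] hop_eq[OF B] ..
    then show ?thesis
      unfolding act_up[OF l relay] up_act_def new Let_def fst_conv snd_conv using relay
      by (simp add: enc_mem_def)
  next
    case idle
    have "act i (L + 2 + l) (fst cfg i) (snd cfg i) (\<lambda>_. 0) = ([], \<lambda>_. [])"
      by (rule act_idle) (use idle in auto)
    moreover have "hp l i j = {}" if "l < L" for j
      using hp_empty[OF that] idle by blast
    moreover have "MS l i = {}" using idle by (simp only: MS_def if_False)
    ultimately show ?thesis using idle by (simp add: enc_mem_def del: atLeastAtMost_iff)
  qed
  then show "fst (act i (L + 2 + l) (fst cfg i) (snd cfg i) (\<lambda>_. 0)) = enc_mem [] (MS l) i"
    "snd (act i (L + 2 + l) (fst cfg i) (snd cfg i) (\<lambda>_. 0)) j = code w (?G' i j)" for j by simp_all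
qed

lemma up_first:
  assumes cfg: "cfg \<in> BC s L"
  shows "measure_pmf.prob (round_step K (memory sl ss) program (L + 2) cfg) (Some ` UP 0) \<ge> 1 - 0"
proof -
  let ?S = "\<lambda>i. edge_facts (F i)"
  obtain G where G: "econf [] ?S G cfg" "valid [] ?S G"
    and heard_G: "\<And>j. j \<le> K \<Longrightarrow> (\<Union>i\<in>{..K}. G i j) = (if j \<in> {1..N} \<and> j - 1 < B ^ L then {(0, s, 0)} else {})"
    using cfg unfolding BC_def by blast
  have "?S i \<union> (if (0::nat) = 0 then (\<lambda>s. (1, s, 0)) ` {s. (0, s, 0) \<in> (\<Union>j\<in>{..K}. G j i)}
         else (\<Union>j\<in>{..K}. (\<lambda>u. (0 + 1, j, u)) ` {u. (0, u, 0) \<in> G j i})) = MS 0 i"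
    if i: "i \<in> {1..N}" for i
  proof -
    have "(\<Union>j\<in>{..K}. G j i) = {(0, s, 0)}"
      using heard_G[of i] i NK by auto
    then show ?thesis using i by (simp add: MS_def HF_def del: atLeastAtMost_iff)
  qed
  moreover have "Collect (econf [] (MS 0) (\<lambda>i j. if 0 < L then vertex_facts (hp 0 i j) else {})) \<subseteq> UP 0"
    using L by (simp add: UP_def)
  ultimately show ?thesis using up_round[of 0, OF _ G] by simp
qed

lemma MS_Suc:
  assumes "Suc l \<le> L" "i \<in> {1..N}"
  shows "MS l i \<union> (\<Union>j\<in>{..K}. (\<lambda>u. (Suc l + 1, j, u)) ` hp l j i) = MS (Suc l) i"
proof -
  have "(\<Union>j\<in>{..K}. (\<lambda>u. (Suc l + 1, j, u)) ` hp l j i) = (\<Union>j\<in>{1..N}. (\<lambda>u. (l + 2, j, u)) ` hp l j i)"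
  proof (rule SUP_eq)
    show "\<exists>j'\<in>{1..N}. (\<lambda>u. (Suc l + 1, j, u)) ` hp l j i \<subseteq> (\<lambda>u. (l + 2, j', u)) ` hp l j' i" if "j \<in> {..K}" for j
      using hp_empty[of l j i] assms N0 by (cases "j \<in> {1..N}") (auto simp: Suc_le_eq)
    show "\<exists>j'\<in>{..K}. (\<lambda>u. (l + 2, j, u)) ` hp l j i \<subseteq> (\<lambda>u. (Suc l + 1, j', u)) ` hp l j' i" if "j \<in> {1..N}" for j
      using that NK by (intro bexI[of _ j]) auto
  qed
  then show ?thesis using assms(2) unfolding MS_def HF_def by (auto simp: lessThan_Suc)
qed

lemma UP_econf:
  assumes "cfg \<in> UP l" "Suc l \<le> L"
  shows "econf [] (MS l) (\<lambda>i j. vertex_facts (hp l i j)) cfg" "valid [] (MS l) (\<lambda>i j. vertex_facts (hp l i j))"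
  using assms hp_subset by (auto simp: UP_def simp del: subset_iff intro!: valid_MS vertex_facts_valid)

lemma up_next:
  assumes l: "Suc l < L" and cfg: "cfg \<in> UP l"
  shows "measure_pmf.prob (round_step K (memory sl ss) program (L + 2 + Suc l) cfg) (Some ` UP (Suc l)) \<ge> 1 - 0"
proof (rule up_round)
  show "Suc l \<le> L" using l by simp
  show "econf [] (MS l) (\<lambda>i j. vertex_facts (hp l i j)) cfg" "valid [] (MS l) (\<lambda>i j. vertex_facts (hp l i j))"
    using UP_econf[OF cfg] l by auto
next
  fix i assume i: "i \<in> {1..N}"
  show "MS l i \<union>
      (if Suc l = 0 then (\<lambda>s. (1, s, 0)) ` {s. (0, s, 0) \<in> (\<Union>j\<in>{..K}. vertex_facts (hp l j i))}
       else (\<Union>j\<in>{..K}. (\<lambda>u. (Suc l + 1, j, u)) ` {u. (0, u, 0) \<in> vertex_facts (hp l j i)})) = MS (Suc l) i"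
    using MS_Suc[OF _ i, of l] l by simp
next
  show "Collect (econf [] (MS (Suc l)) (\<lambda>i j. if Suc l < L then vertex_facts (hp (Suc l) i j) else {})) \<subseteq> UP (Suc l)"
    using l by (simp add: UP_def)
qed

text \<open>After the last hop no message is in transit and the matching is empty. Silence is the
  right answer for an empty set of covered vertices, so phase \<open>0\<close> starts like any
  other.\<close>

lemma up_last:
  assumes cfg: "cfg \<in> UP (L - 1)" and bnd: "real (card X) \<le> bnd 0"
  shows "measure_pmf.prob (round_step K (memory sl ss) program (L + 2 + L) cfg) (Some ` DN 0 0) \<ge> 1 - 0"
proof (rule up_round)
  have L1: "Suc (L - 1) = L" using L by simp
  show "econf [] (MS (L - 1)) (\<lambda>i j. vertex_facts (hp (L - 1) i j)) cfg"
    "valid [] (MS (L - 1)) (\<lambda>i j. vertex_facts (hp (L - 1) i j))"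
    using UP_econf[OF cfg] L1 by auto
  fix i assume i: "i \<in> {1..N}"
  show "MS (L - 1) i \<union>
      (if L = 0 then (\<lambda>s. (1, s, 0)) ` {s. (0, s, 0) \<in> (\<Union>j\<in>{..K}. vertex_facts (hp (L - 1) j i))}
       else (\<Union>j\<in>{..K}. (\<lambda>u. (L + 1, j, u)) ` {u. (0, u, 0) \<in> vertex_facts (hp (L - 1) j i)})) = MS L i"
    using MS_Suc[OF _ i, of "L - 1"] L unfolding L1 by simp
next
  show "Collect (econf [] (MS L) (\<lambda>i j. if L < L then vertex_facts (hp L i j) else {})) \<subseteq> DN 0 0"
  proof
    fix c assume "c \<in> Collect (econf [] (MS L) (\<lambda>i j. if L < L then vertex_facts (hp L i j) else {}))"
    then have "econf [] (MS L) (\<lambda>i j. {}) c" by simp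
    moreover have "valid [] (MS L) (\<lambda>i j. {})" by (rule valid_MS) auto
    moreover have "matched 0 []" using bnd by (simp add: matched_def indep_def alive_def covered_def)
    moreover have "covered (set []) = {}" by (simp add: covered_def)
    ultimately show "c \<in> DN 0 0" unfolding DN_def by blast
  qed
qed simp

text \<open>Whatever \<open>j\<close> sent to \<open>i\<close> in hop \<open>l - 1\<close> is among
  the requests of \<open>i\<close> at level \<open>l\<close>, so \<open>i\<close> can answer it; and
  every request held by \<open>j\<close> at level \<open>l - 1\<close> was sent to some
  \<open>i\<close>, so \<open>j\<close> hears about all of them. The traffic is that of the hop,
  reversed.\<close>

lemma down_round:
  assumes r: "prelude \<le> r" "(r - prelude) mod (L + 2) = L + 2 - l" and l: "1 \<le> l" "l \<le> L"
    and cfg: "cfg \<in> DN l k"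
  shows "measure_pmf.prob (round_step K (memory sl ss) program r cfg) (Some ` DN (l - 1) k) \<ge> 1 - 0"
proof -
  obtain es G where G: "econf es (MS L) G cfg" "valid es (MS L) G" and es: "matched k es"
    and heard_G: "\<And>j. j \<in> {1..N} \<Longrightarrow> {u. (0, u, 0) \<in> (\<Union>i\<in>{..K}. G i j)} = rch l j \<inter> covered (set es)"
    using cfg unfolding DN_def by blast
  have l1: "l - 1 < L" "Suc (l - 1) = l" using l by auto
  define G' where "G' = (\<lambda>i j. vertex_facts (hp (l - 1) j i \<inter> covered (set es)))"
  have es': "distinct es" "set es \<subseteq> X" "indep (set es)" using es by (auto simp: matched_def)
  have val: "valid es (MS L) G'"
    using hp_subset by (intro valid_MS es' order.refl) (auto simp: G'_def simp del: subset_iff intro!: vertex_facts_valid)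
  have card_G': "card (G' i j) \<le> card (hp (l - 1) j i)" for i j
    unfolding G'_def card_vertex_facts by (intro card_mono finite_hp) auto
  have sums: "(\<Sum>j\<le>K. card (G' i j)) \<le> (\<Sum>j\<le>K. card (hp (l - 1) j i))"
    "(\<Sum>j\<le>K. card (G' j i)) \<le> (\<Sum>j\<le>K. card (hp (l - 1) i j))" for i
    by (intro sum_mono card_G')+
  have "(\<Sum>j\<le>K. card (G' 0 j)) = 0" "(\<Sum>j\<le>K. card (G' j 0)) = 0"
    using sums[of 0] hp_0[OF l1(1)] by simp_all
  then have ft: "fits es (MS L) G'"
    unfolding fits_def
    using length_matched[OF es'] card_MS order.trans[OF sums(1) sum_hp_le(1)[OF l1(1)]]
      order.trans[OF sums(2) sum_hp_le(2)[OF l1(1)]] by simp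
  have union: "{u. (0, u, 0) \<in> (\<Union>i\<in>{..K}. G' i j)} = rch (l - 1) j \<inter> covered (set es)" if j: "j \<in> {1..N}" for j
  proof -
    have "{u. (0, u, 0) \<in> (\<Union>i\<in>{..K}. G' i j)} = (\<Union>i\<in>{..K}. hp (l - 1) j i) \<inter> covered (set es)"
      by (auto simp: G'_def)
    also have "(\<Union>i\<in>{..K}. hp (l - 1) j i) = (\<Union>i\<in>{1..N}. hp (l - 1) j i)"
    proof (intro antisym UN_least)
      show "hp (l - 1) j i \<subseteq> (\<Union>i\<in>{1..N}. hp (l - 1) j i)" for i
        using hp_empty[OF l1(1), of j i] by (cases "i \<in> {1..N}") auto
      show "hp (l - 1) j i \<subseteq> (\<Union>i\<in>{..K}. hp (l - 1) j i)" if "i \<in> {1..N}" for i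
        using that NK by (intro UN_upper) auto
    qed
    also have "\<dots> = rch (l - 1) j" by (rule reaching_eq_UN_hop[OF B l1(1) refl, symmetric])
    finally show ?thesis .
  qed
  have r2: "2 \<le> r" using r(1) prelude_ge by simp
  have modr: "(r - prelude) mod (L + 2) \<noteq> 0" "(r - prelude) mod (L + 2) \<noteq> 1"
    unfolding r(2) using l by auto
  show ?thesis
  proof (rule round_det[where es = es and S = "MS L" and G = G'])
    show "Collect (econf es (MS L) G') \<subseteq> DN (l - 1) k"
      using val union es unfolding DN_def by blast
    show "keys i r (fst cfg i) (snd cfg i) = {}" for i
      by (rule keys_empty[OF r2]) (use modr in blast)
  next
    fix i assume i: "i \<le> K"
    consider (large) "i = 0" | (relay) "i \<in> {1..N}" | (idle) "i \<noteq> 0" "i \<notin> {1..N}" by blast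
    then have "act i r (fst cfg i) (snd cfg i) (\<lambda>_. 0) = (enc_mem es (MS L) i, \<lambda>j. code w (G' i j))"
    proof cases
      case large
      have "act 0 r (fst cfg 0) (snd cfg 0) (\<lambda>_. 0) = (fst cfg 0, \<lambda>_. [])"
        by (rule act_large_idle) (use r2 modr in auto)
      then show ?thesis using large fst_cfg[OF G, of 0] hp_0[OF l1(1)] by (simp add: G'_def)
    next
      case relay
      have mem: "decode w (fst cfg i) = MS L i"
        using decode_mem[OF G] relay NK by simp
      have dead: "dead (snd cfg i) = rch l i \<inter> covered (set es)"
        unfolding dead_def heard_eq[OF G i] by (rule heard_G[OF relay])
      have "{u \<in> dead (snd cfg i). (l + 1, j, u) \<in> decode w (fst cfg i)} = hp (l - 1) j i \<inter> covered (set es)" for j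
      proof -
        have "(l + 1, j, u) \<in> MS L i \<longleftrightarrow> u \<in> hp (l - 1) j i" for u
          using request_MS[OF relay l1(1) order.refl, of j u] l by simp
        moreover have "hp (l - 1) j i \<subseteq> rch l i"
          using hp_empty[OF l1(1), of j i] reaching_Suc[OF B l1(1) refl, of "H s" Q i] unfolding l1(2)
          by (cases "j \<in> {1..N}") auto
        ultimately show ?thesis unfolding dead mem by blast
      qed
      then show ?thesis
        unfolding act_down[OF r l relay] down_act_def G'_def using fst_cfg[OF G i] by simp
    next
      case idle
      have "act i r (fst cfg i) (snd cfg i) (\<lambda>_. 0) = ([], \<lambda>_. [])"
        by (rule act_idle) (use idle r2 in auto)
      moreover have "hp (l - 1) j i = {}" for j using hp_empty[OF l1(1)] idle by blast
      moreover have "MS L i = {}" using idle by (simp only: MS_def if_False)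
      ultimately show ?thesis using idle by (simp add: enc_mem_def G'_def del: atLeastAtMost_iff)
    qed
    then show "fst (act i r (fst cfg i) (snd cfg i) (\<lambda>_. 0)) = enc_mem es (MS L) i"
      "snd (act i r (fst cfg i) (snd cfg i) (\<lambda>_. 0)) j = code w (G' i j)" for j by simp_all
  qed (rule val ft)+
qed

end

section \<open>Sampling live edges and extending the matching\<close>

context seeded
begin

lemma rch_0: "i \<in> {1..N} \<Longrightarrow> rch 0 i = Q i"
  by (rule reaching_0)

lemma unordered_subset_Q: "p \<in> F i \<Longrightarrow> unordered p \<subseteq> Q i"
  by (auto simp: Q_def covered_def)

lemma sum_query_msgs:
  assumes "Y \<subseteq> X"
  shows "(\<Sum>i\<le>K. card (query_msgs Y i 0)) \<le> card Y + n"
proof -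
  have "card (query_msgs Y i 0) \<le> card (Y \<inter> F i) + card (rch L i)" for i
    unfolding query_msgs_def using card_Un_le[of "edge_facts (Y \<inter> F i)" "query_facts (rch L i)"] by simp
  then have "(\<Sum>i\<le>K. card (query_msgs Y i 0)) \<le> (\<Sum>i\<le>K. card (Y \<inter> F i)) + (\<Sum>i\<le>K. card (rch L i))"
    unfolding sum.distrib[symmetric] by (intro sum_mono)
  moreover have "(\<Sum>i\<le>K. card (Y \<inter> F i)) = card (\<Union>i\<in>{..K}. Y \<inter> F i)"
    using finite_F by (subst card_UN_disjoint) (auto simp: F_def)
  moreover have "card (\<Union>i\<in>{..K}. Y \<inter> F i) \<le> card Y"
    using finite_subset[OF assms finite_X] by (intro card_mono) auto
  ultimately show ?thesis using sum_rch_top by linarith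
qed

lemma query_msgs_valid: "query_msgs Y i j \<subseteq> facts w"
proof -
  have "edge_facts (Y \<inter> F i) \<subseteq> facts w" using F_subset[of i] by (intro edge_facts_valid) auto
  moreover have "query_facts (rch L i) \<subseteq> facts w" by (rule query_facts_valid[OF rch_subset])
  ultimately show ?thesis unfolding query_msgs_def by (cases "j = 0 \<and> i \<in> {1..N}") (simp_all only: if_True if_False Un_subset_iff, auto)
qed

lemma query_msgs_fit:
  assumes es: "distinct es" "set es \<subseteq> X" "indep (set es)" and Y: "Y \<subseteq> X" "card Y \<le> cy"
  shows "fits es (MS L) (query_msgs Y)"
  unfolding fits_def
proof (intro conjI ballI)
  show "length es \<le> n" by (rule length_matched[OF es])
  show "(\<Sum>j\<le>K. card (query_msgs Y 0 j)) \<le> cl" by (simp add: query_msgs_def)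
  show "(\<Sum>j\<le>K. card (query_msgs Y j 0)) \<le> cl" using sum_query_msgs[OF Y(1)] Y(2) large(2) by linarith
  fix i assume i: "i \<in> {1..K}"
  show "card (MS L i) \<le> cs" by (rule card_MS) simp
  have "(\<Sum>j\<le>K. card (query_msgs Y i j)) = card (query_msgs Y i 0)"
    by (subst sum.remove[of _ 0]) (auto simp: query_msgs_def)
  also have "\<dots> \<le> card (Y \<inter> F i) + card (rch L i)"
    unfolding query_msgs_def using card_Un_le[of "edge_facts (Y \<inter> F i)" "query_facts (rch L i)"] by simp
  also have "\<dots> \<le> q0 + t"
    using card_mono[OF finite_F, of "Y \<inter> F i" i] card_F[of i] card_rch[of L i] by (intro add_mono) auto
  also have "\<dots> \<le> cs" by (rule t_le)
  finally show "(\<Sum>j\<le>K. card (query_msgs Y i j)) \<le> cs" .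
  show "(\<Sum>j\<le>K. card (query_msgs Y j i)) \<le> cs" using i by (simp add: query_msgs_def)
qed

text \<open>The requests at level \<open>0\<close> are the endpoints of a machine's own edges, so
  each machine recognises exactly its live edges. The coins of all machines together form one
  Bernoulli sample of \<open>alive X (set es)\<close>.\<close>

lemma sample_round:
  assumes r: "r = prelude + k * (L + 2)" and cfg: "cfg \<in> DN 0 k"
    and pr: "0 < pr k" "pr k \<le> 1"
    and e: "exp (pr k * bnd k) * 2 powr (- real cy) + 2 ^ n * exp (- pr k * bnd (Suc k)) \<le> e"
  shows "measure_pmf.prob (round_step K (memory sl ss) program r cfg) (Some ` QS k) \<ge> 1 - e"
proof -
  obtain es G where G: "econf es (MS L) G cfg" "valid es (MS L) G" and es: "matched k es"
    and heard_G: "\<And>j. j \<in> {1..N} \<Longrightarrow> {u. (0, u, 0) \<in> (\<Union>i\<in>{..K}. G i j)} = rch 0 j \<inter> covered (set es)"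
    using cfg unfolding DN_def by blast
  have es': "distinct es" "set es \<subseteq> X" "indep (set es)" "real (card (alive X (set es))) \<le> bnd k"
    using es by (auto simp: matched_def)
  let ?Z = "alive X (set es)"
  have ZX: "?Z \<subseteq> X" by (auto simp: alive_def)
  have finZ: "finite ?Z" using finite_subset[OF ZX finite_X] .
  have rp: "prelude \<le> r" "(r - prelude) mod (L + 2) = 0" "(r - prelude) div (L + 2) = k" "2 \<le> r"
  proof -
    have L2: "L + 2 \<noteq> 0" by simp
    have eq: "r - prelude = k * (L + 2)" by (simp only: r diff_add_inverse)
    show "(r - prelude) mod (L + 2) = 0" unfolding eq by (rule mod_mult_self2_is_0)
    show "(r - prelude) div (L + 2) = k" unfolding eq by (rule nonzero_mult_div_cancel_right[OF L2])
    show "prelude \<le> r" "2 \<le> r" using prelude_ge by (simp_all add: r)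
  qed
  have coin: "coin r = map_pmf of_bool (bernoulli_pmf (pr k))"
    using rp by (simp add: coin_def)
  define A where "A = (\<lambda>i. ?Z \<inter> F i)"
  have live: "live_edges (fst cfg i) (snd cfg i) = A i" if i: "i \<in> {1..N}" for i
  proof -
    have iK: "i \<le> K" "i \<in> {1..K}" using i NK by auto
    have "dead (snd cfg i) = Q i \<inter> covered (set es)"
      unfolding dead_def heard_eq[OF G iK(1)] using heard_G[OF i] rch_0[OF i] by simp
    moreover have "edges (decode w (fst cfg i)) = F i"
      using decode_mem[OF G iK(2)] edges_MS[OF i] by simp
    ultimately show ?thesis
      using unordered_subset_Q[of _ i] F_subset[of i] unfolding live_edges_def A_def alive_def by blast
  qed
  have A: "keys i r (fst cfg i) (snd cfg i) = A i" for i
  proof (cases "i \<in> {1..N}")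
    case True
    then show ?thesis using rp live[OF True] by (simp add: keys_def)
  next
    case False
    have "keys i r (fst cfg i) (snd cfg i) = {}"
      using rp(4) False unfolding keys_def by auto
    then show ?thesis using F_empty[OF False] by (simp add: A_def)
  qed
  have UA: "(\<Union>i\<in>{..K}. A i) = ?Z"
  proof -
    have "(\<Union>i\<in>{1..N}. F i) \<subseteq> (\<Union>i\<in>{..K}. F i)" using NK by (intro UN_mono) auto
    then have "?Z \<subseteq> (\<Union>i\<in>{..K}. F i)" using UN_F ZX by simp
    then show ?thesis unfolding A_def Int_UN_distrib[symmetric] by (rule Int_absorb2)
  qed
  let ?M = "Pi_pmf ?Z 0 (\<lambda>_. coin r)"
  define bad where "bad = {\<omega> :: coins. cy \<le> card {x \<in> ?Z. \<omega> x = 1} \<or>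
      (\<exists>U\<subseteq>{..<n}. bnd (Suc k) < card {x \<in> ?Z. unordered x \<subseteq> U} \<and> (\<forall>x\<in>?Z. unordered x \<subseteq> U \<longrightarrow> \<omega> x \<noteq> 1))}"
  show ?thesis
  proof (rule prob_round_step_ge[where P = program and act = act and keys = keys and q = "coin r"
        and A = A and G = "- bad", OF program_def], unfold UA)
    show "keys i r (fst cfg i) (snd cfg i) = A i" for i by (rule A)
    show "finite (A i)" for i using finZ by (simp add: A_def)
    show "disjoint_family_on A {..K}" by (auto simp: A_def F_def disjoint_family_on_def)
    have "measure_pmf.prob ?M bad \<le> e"
      unfolding coin bad_def by (rule order.trans[OF prob_bad_sample_le[OF finZ pr es'(4)] e])
    then show "1 - e \<le> measure_pmf.prob ?M (- bad)"
      using measure_pmf.prob_compl[of bad ?M] by (simp add: Compl_eq_Diff_UNIV)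
  next
    fix \<omega> assume \<omega>: "\<omega> \<in> - bad" "\<omega> \<in> set_pmf ?M"
    define Y where "Y = {x \<in> ?Z. \<omega> x = 1}"
    have YX: "Y \<subseteq> X" using ZX by (auto simp: Y_def)
    have cY: "card Y \<le> cy" using \<omega>(1) by (simp add: bad_def Y_def)
    have cover: "real (card {x \<in> ?Z. unordered x \<subseteq> U}) \<le> bnd (Suc k)"
      if "U \<subseteq> {..<n}" "\<forall>x\<in>?Z. unordered x \<subseteq> U \<longrightarrow> x \<notin> Y" for U
    proof (rule ccontr)
      assume "\<not> ?thesis"
      then have "\<omega> \<in> bad" using that unfolding bad_def Y_def by (simp add: not_le) blast
      with \<omega>(1) show False by simp
    qed
    \<comment> \<open>At rate \<open>1\<close> the coin has no outcome other than \<open>1\<close>,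
      so the sample is complete for every outcome in the support.\<close>
    have full: "Y = ?Z" if "pr k = 1"
    proof -
      have "False \<notin> set_pmf (bernoulli_pmf 1)" by (simp add: set_pmf_iff)
      then have "set_pmf (bernoulli_pmf 1) \<subseteq> {True}" by (metis (full_types) insertI1 subsetI)
      then have "set_pmf (coin r) \<subseteq> {1}" unfolding coin that by auto
      then have "\<omega> x = 1" if "x \<in> ?Z" for x using set_Pi_pmfD[OF finZ \<omega>(2) that] by blast
      then show ?thesis by (auto simp: Y_def)
    qed
    have val: "valid es (MS L) (query_msgs Y)"
      by (rule valid_MS[OF es'(2) order.refl query_msgs_valid])
    have ft: "fits es (MS L) (query_msgs Y)"
      by (rule query_msgs_fit[OF es'(1-3) YX cY])
    have sub: "Collect (conf K (enc_mem es (MS L)) (\<lambda>i j. code w (query_msgs Y i j))) \<subseteq> QS k"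
    proof
      fix c assume "c \<in> Collect (conf K (enc_mem es (MS L)) (\<lambda>i j. code w (query_msgs Y i j)))"
      then have "econf es (MS L) (query_msgs Y) c" by (simp add: econf_def)
      moreover have "Y \<subseteq> ?Z" by (auto simp: Y_def)
      ultimately show "c \<in> QS k" using es cover full unfolding QS_def by blast
    qed
    have act: "act i r (fst cfg i) (snd cfg i) (\<lambda>x. if x \<in> A i then \<omega> x else 0)
        = (enc_mem es (MS L) i, \<lambda>j. code w (query_msgs Y i j))" if i: "i \<le> K" for i
    proof -
      consider (large) "i = 0" | (relay) "i \<in> {1..N}" | (idle) "i \<noteq> 0" "i \<notin> {1..N}" by blast
      then show ?thesis
      proof cases
        case large
        have "act 0 r (fst cfg 0) (snd cfg 0) \<omega>' = (fst cfg 0, \<lambda>_. [])" for \<omega>'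
          by (rule act_large_idle) (use rp in auto)
        then show ?thesis using large fst_cfg[OF G, of 0] by (simp add: query_msgs_def)
      next
        case relay
        have mem: "requested (decode w (fst cfg i)) L = rch L i"
          using decode_mem[OF G] requested_MS[OF relay, of L L] relay NK by simp
        have Y: "{p \<in> A i. (if p \<in> A i then \<omega> p else 0) = 1} = Y \<inter> F i"
          by (auto simp: A_def Y_def)
        have "act i r (fst cfg i) (snd cfg i) (\<lambda>x. if x \<in> A i then \<omega> x else 0)
            = (fst cfg i, \<lambda>j. if j = 0 then code w (edge_facts (Y \<inter> F i) \<union> query_facts (rch L i)) else [])"
          unfolding act_sample[OF rp(1,2) relay] sample_act_def live[OF relay] mem Y ..
        then show ?thesis
          using relay fst_cfg[OF G i] by (simp add: query_msgs_def fun_eq_iff)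
      next
        case idle
        have "act i r (fst cfg i) (snd cfg i) \<omega>' = ([], \<lambda>_. [])" for \<omega>'
          by (rule act_idle) (use idle rp in auto)
        moreover have "MS L i = {}" using idle by (simp only: MS_def if_False)
        ultimately show ?thesis using idle by (simp add: enc_mem_def query_msgs_def del: atLeastAtMost_iff)
      qed
    qed
    show "\<exists>m g. (\<forall>i\<le>K. fst (act i r (fst cfg i) (snd cfg i) (\<lambda>x. if x \<in> A i then \<omega> x else 0)) = m i \<and>
        (\<forall>j\<le>K. snd (act i r (fst cfg i) (snd cfg i) (\<lambda>x. if x \<in> A i then \<omega> x else 0)) j = g i j)) \<and>
       legal_traffic K (memory sl ss) m g \<and> Collect (conf K m g) \<subseteq> QS k"
      using legal_traffic_encoded[OF val ft] sub
      by (intro exI[of _ "enc_mem es (MS L)"] exI[of _ "\<lambda>i j. code w (query_msgs Y i j)"] conjI allI impI)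
        (simp_all add: act)
  qed
qed

text \<open>
  The edges surviving the extended matching lie inside the set of its uncovered vertices, which
  contains no sampled edge.
\<close>

lemma grow_matched:
  assumes es: "matched k es" and Y: "Y \<subseteq> alive X (set es)"
    and cover: "\<And>U. U \<subseteq> {..<n} \<Longrightarrow> (\<forall>x\<in>alive X (set es). unordered x \<subseteq> U \<longrightarrow> x \<notin> Y) \<Longrightarrow>
        real (card {x \<in> alive X (set es). unordered x \<subseteq> U}) \<le> bnd (Suc k)"
    and full: "pr k = 1 \<Longrightarrow> Y = alive X (set es)"
  shows "matched (Suc k) (grow (set es) Y)"
proof -
  have es': "set es \<subseteq> X" "indep (set es)" using es by (auto simp: matched_def)
  have YX: "Y \<subseteq> X" using Y by (auto simp: alive_def)
  note g = grow[OF finite_set[of es] finite_subset[OF YX finite_X] es'(2)]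
  let ?es = "grow (set es) Y"
  let ?U = "{..<n} - covered (set ?es)"
  have mono: "covered (set es) \<subseteq> covered (set ?es)" by (rule covered_mono[OF g(2)])
  have lt: "unordered x \<subseteq> {..<n}" if "x \<in> X" for x
    using that X_subset by (auto simp: unordered_def)
  have eq: "alive X (set ?es) = {x \<in> alive X (set es). unordered x \<subseteq> ?U}"
    using mono lt unfolding alive_def by blast
  have none: "\<forall>x\<in>alive X (set es). unordered x \<subseteq> ?U \<longrightarrow> x \<notin> Y"
    using g(5) unfolding alive_def by blast
  have "real (card (alive X (set ?es))) \<le> bnd (Suc k)"
    unfolding eq by (rule cover) (use none in auto)
  moreover have "alive X (set ?es) = {}" if "pr k = 1"
    using none full[OF that] unfolding eq by blast
  ultimately show ?thesis using g(1,3,4) es' YX by (auto simp: matched_def)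
qed

text \<open>Only the large machine sends, and machine \<open>j\<close> receives a part of
  \<open>rch L j\<close>. These sets are disjoint, so the replies amount to at most \<open>n\<close>
  facts.\<close>

lemma grow_round:
  assumes r: "prelude \<le> r" "(r - prelude) mod (L + 2) = 1" and cfg: "cfg \<in> QS k"
  shows "measure_pmf.prob (round_step K (memory sl ss) program r cfg) (Some ` DN L (Suc k)) \<ge> 1 - 0"
proof -
  obtain es Y where es: "matched k es" and Y: "Y \<subseteq> alive X (set es)"
    and c: "econf es (MS L) (query_msgs Y) cfg"
    and cover: "\<And>U. U \<subseteq> {..<n} \<Longrightarrow> (\<forall>x\<in>alive X (set es). unordered x \<subseteq> U \<longrightarrow> x \<notin> Y) \<Longrightarrow>
        real (card {x \<in> alive X (set es). unordered x \<subseteq> U}) \<le> bnd (Suc k)"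
    and full: "pr k = 1 \<Longrightarrow> Y = alive X (set es)"
    using cfg unfolding QS_def by blast
  have es0: "set es \<subseteq> X" using es by (simp add: matched_def)
  have YX: "Y \<subseteq> X" using Y by (auto simp: alive_def)
  have G: "econf es (MS L) (query_msgs Y) cfg" "valid es (MS L) (query_msgs Y)"
    using c valid_MS[OF es0 order.refl query_msgs_valid] by auto
  define es' where "es' = grow (set es) Y"
  have es': "matched (Suc k) es'"
    unfolding es'_def by (rule grow_matched[OF es Y cover full])
  then have m: "distinct es'" "set es' \<subseteq> X" "indep (set es')" by (auto simp: matched_def)
  define G' :: "nat \<Rightarrow> nat \<Rightarrow> fact set"
    where "G' = (\<lambda>i j. if i = 0 then vertex_facts (rch L j \<inter> covered (set es')) else {})"
  have val: "valid es' (MS L) G'"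
    using rch_subset by (intro valid_MS m order.refl) (auto simp: G'_def simp del: subset_iff intro!: vertex_facts_valid)
  have cG: "card (G' 0 j) \<le> card (rch L j)" for j
    unfolding G'_def by (simp add: card_mono[OF finite_rch])
  have cG0: "card (G' i j) = 0" if "i \<noteq> 0" for i j using that by (simp add: G'_def)
  have s0: "(\<Sum>j\<le>K. card (G' j i)) = card (G' 0 i)" for i
    by (subst sum.remove[of _ 0]) (auto simp: cG0)
  have ft: "fits es' (MS L) G'"
    unfolding fits_def
  proof (intro conjI ballI)
    show "length es' \<le> n" by (rule length_matched[OF m])
    have "(\<Sum>j\<le>K. card (G' 0 j)) \<le> (\<Sum>j\<le>K. card (rch L j))" by (intro sum_mono cG)
    then show "(\<Sum>j\<le>K. card (G' 0 j)) \<le> cl" using sum_rch_top large(2) by linarith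
    show "(\<Sum>j\<le>K. card (G' j 0)) \<le> cl" unfolding s0 by (simp add: G'_def rch_empty)
    fix i assume i: "i \<in> {1..K}"
    show "card (MS L i) \<le> cs" by (rule card_MS) simp
    show "(\<Sum>j\<le>K. card (G' i j)) \<le> cs" using i by (simp add: cG0)
    show "(\<Sum>j\<le>K. card (G' j i)) \<le> cs"
      unfolding s0 using cG[of i] card_rch[of L i] t_le by simp
  qed
  have r2: "2 \<le> r" using r(1) prelude_ge by simp
  show ?thesis
  proof (rule round_det[where es = es' and S = "MS L" and G = G'])
    have "{u. (0, u, 0) \<in> (\<Union>i\<in>{..K}. G' i j)} = rch L j \<inter> covered (set es')" for j
      by (auto simp: G'_def split: if_splits)
    then show "Collect (econf es' (MS L) G') \<subseteq> DN L (Suc k)"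
      using val es' unfolding DN_def by blast
    show "keys i r (fst cfg i) (snd cfg i) = {}" for i
      by (rule keys_empty[OF r2]) (use r in simp)
  next
    fix i assume i: "i \<le> K"
    consider (large) "i = 0" | (relay) "i \<in> {1..N}" | (idle) "i \<noteq> 0" "i \<notin> {1..N}" by blast
    then have "fst (act i r (fst cfg i) (snd cfg i) (\<lambda>_. 0)) = enc_mem es' (MS L) i \<and>
      (\<forall>j\<le>K. snd (act i r (fst cfg i) (snd cfg i) (\<lambda>_. 0)) j = code w (G' i j))"
    proof cases
      case large
      have "edges (\<Union>j\<in>{..K}. query_msgs Y j 0) = (\<Union>j\<in>{1..N}. Y \<inter> F j)"
        using NK by (auto simp: edges_def query_msgs_def split: if_splits)
      also have "\<dots> = Y" unfolding Int_UN_distrib[symmetric] UN_F by (rule Int_absorb2[OF YX])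
      finally have ed: "edges (heard (snd cfg 0)) = Y"
        unfolding heard_eq[OF G le0] .
      have act: "act 0 r (fst cfg 0) (snd cfg 0) (\<lambda>_. 0) = (encode_edges n es',
          \<lambda>j. code w (vertex_facts {u \<in> covered (set es'). (1, u, 0) \<in> decode w (snd cfg 0 j)}))"
        using r r2 by (simp add: act_def large_act_def decode_large[OF G] ed es'_def Let_def)
      have "{u \<in> covered (set es'). (1, u, 0) \<in> decode w (snd cfg 0 j)} = rch L j \<inter> covered (set es')"
        if "j \<le> K" for j
        unfolding decode_msg[OF G le0 that] query_msgs_def
        using rch_empty[OF order.refl, of j] by (cases "j \<in> {1..N}") auto
      then show ?thesis unfolding large act by (simp add: enc_mem_def G'_def)
    next
      case relay
      then show ?thesis
        unfolding act_wait[OF r relay] using fst_cfg[OF G i] by (simp add: enc_mem_def G'_def)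
    next
      case idle
      have "act i r (fst cfg i) (snd cfg i) (\<lambda>_. 0) = ([], \<lambda>_. [])"
        by (rule act_idle) (use idle r2 in auto)
      moreover have "MS L i = {}" using idle by (simp only: MS_def if_False)
      ultimately show ?thesis using idle by (simp add: enc_mem_def G'_def del: atLeastAtMost_iff)
    qed
    then show "fst (act i r (fst cfg i) (snd cfg i) (\<lambda>_. 0)) = enc_mem es' (MS L) i"
      "j \<le> K \<Longrightarrow> snd (act i r (fst cfg i) (snd cfg i) (\<lambda>_. 0)) j = code w (G' i j)" for j by simp_all
  qed (rule val ft)+
qed

text \<open>The invariant before round \<open>r \<ge> 2\<close>; the two rounds before it produce
  \<open>\<rho>\<close> and \<open>s\<close>. From offset \<open>2\<close> of a phase on, the
  extended matching already counts for the next phase, hence \<open>Suc k\<close>.\<close>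

definition stage :: "nat \<Rightarrow> config set" where
  "stage r =
     (if r \<le> L + 2 then BC s (r - 2)
      else if r < prelude then UP (r - (L + 3))
      else let k = (r - prelude) div (L + 2); t = (r - prelude) mod (L + 2)
        in if t = 0 then DN 0 k else if t = 1 then QS k else DN (L + 2 - t) (Suc k))"

lemma stage_step:
  assumes r: "2 \<le> r" and cfg: "cfg \<in> stage r"
    and bnd: "real (card X) \<le> bnd 0" and pr: "\<And>k. 0 < pr k" "\<And>k. pr k \<le> 1"
    and e: "0 \<le> e"
      "\<And>k. exp (pr k * bnd k) * 2 powr (- real cy) + 2 ^ n * exp (- pr k * bnd (Suc k)) \<le> e"
  shows "measure_pmf.prob (round_step K (memory sl ss) program r cfg) (Some ` stage (Suc r)) \<ge> 1 - e"
proof -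
  have det: ?thesis if "measure_pmf.prob (round_step K (memory sl ss) program r cfg) (Some ` stage (Suc r)) \<ge> 1 - 0"
    using that e(1) by linarith
  consider (spread) "r < L + 2" | (up0) "r = L + 2" | (up) "L + 2 < r" "Suc r < prelude"
    | (last) "Suc r = prelude" | (phase) "prelude \<le> r"
    using L unfolding prelude_def by linarith
  then show ?thesis
  proof cases
    case spread
    then obtain l where l: "r = 2 + l" "l < L" using r by (metis add.commute le_Suc_ex nat_add_left_cancel_less)
    then have "stage r = BC s l" "stage (Suc r) = BC s (Suc l)" by (auto simp: stage_def)
    then show ?thesis using spread_round[OF l(2)] cfg l(1) by (intro det) simp
  next
    case up0
    then have "stage r = BC s L" "stage (Suc r) = UP 0" using L by (auto simp: stage_def prelude_def)
    then show ?thesis using up_first cfg up0 by (intro det) simp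
  next
    case up
    define l where "l = r - (L + 3)"
    have l: "r = L + 2 + Suc l" "Suc l < L" using up by (auto simp: l_def prelude_def)
    then have "stage r = UP l" "stage (Suc r) = UP (Suc l)" by (auto simp: stage_def prelude_def)
    then show ?thesis using up_next[OF l(2)] cfg l(1) by (intro det) simp
  next
    case last
    then have "r = L + 2 + L" by (simp add: prelude_def)
    moreover from this have "stage r = UP (L - 1)" "stage (Suc r) = DN 0 0"
      using L by (auto simp: stage_def prelude_def)
    ultimately show ?thesis using up_last[OF _ bnd] cfg by (intro det) simp
  next
    case phase
    define k where "k = (r - prelude) div (L + 2)"
    define t where "t = (r - prelude) mod (L + 2)"
    have rk: "r - prelude = k * (L + 2) + t" "t < L + 2"
      by (simp_all only: k_def t_def div_mult_mod_eq) simp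
    have stage_r: "stage r = (if t = 0 then DN 0 k else if t = 1 then QS k else DN (L + 2 - t) (Suc k))"
      using phase unfolding stage_def k_def t_def by (simp add: prelude_def)
    have Sr: "Suc r - prelude = k * (L + 2) + Suc t" using rk phase by simp
    have stage_Sr: "stage (Suc r) = (if t = L + 1 then DN 0 (Suc k) else if t = 0 then QS k
        else DN (L + 2 - Suc t) (Suc k))"
    proof (cases "t = L + 1")
      case True
      then have eq: "Suc r - prelude = Suc k * (L + 2)" unfolding Sr by simp
      have "(Suc r - prelude) div (L + 2) = Suc k" "(Suc r - prelude) mod (L + 2) = 0"
        unfolding eq by (rule nonzero_mult_div_cancel_right, simp, rule mod_mult_self2_is_0)
      then show ?thesis using phase True unfolding stage_def by (simp add: prelude_def)
    next
      case False
      then have "Suc t < L + 2" using rk(2) by simp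
      moreover have "(k * b + c) div b = k" "(k * b + c) mod b = c" if "c < b" for b c :: nat
        using that by simp_all
      ultimately have "(Suc r - prelude) div (L + 2) = k" "(Suc r - prelude) mod (L + 2) = Suc t"
        unfolding Sr by blast+
      then show ?thesis using phase False unfolding stage_def by (simp add: prelude_def)
    qed
    consider "t = 0" | "t = 1" | "2 \<le> t" by linarith
    then show ?thesis
    proof cases
      case 1
      have "r = prelude + k * (L + 2)" using rk(1) phase 1 by simp
      moreover have "cfg \<in> DN 0 k" "stage (Suc r) = QS k" using cfg stage_r stage_Sr 1 by auto
      ultimately show ?thesis using sample_round[OF _ _ pr e(2)] by simp
    next
      case 2
      then have "cfg \<in> QS k" "stage (Suc r) = DN L (Suc k)" using cfg stage_r stage_Sr L by auto
      then show ?thesis using grow_round[OF phase] 2 by (intro det) (simp add: t_def)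
    next
      case 3
      let ?l = "L + 2 - t"
      have l: "1 \<le> ?l" "?l \<le> L" "t = L + 2 - ?l" using 3 rk(2) by auto
      have "stage (Suc r) = DN (?l - 1) (Suc k)" using 3 rk(2) stage_Sr by (cases "t = L + 1") auto
      moreover have "cfg \<in> DN ?l (Suc k)" using cfg stage_r 3 by simp
      moreover have "(r - prelude) mod (L + 2) = L + 2 - ?l" using l(3) by (simp add: t_def)
      ultimately show ?thesis using down_round[OF phase _ l(1,2)] by (intro det) simp
    qed
  qed
qed

lemma DN_correct:
  assumes "cfg \<in> DN l (Suc k)" "pr k = 1"
  shows "outputs_maximal_matching n (unordered ` X) cfg"
proof -
  obtain es G where G: "econf es (MS L) G cfg" "valid es (MS L) G" and es: "matched (Suc k) es"
    using assms(1) unfolding DN_def by blast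
  have "fst cfg 0 = encode_edges n es" using fst_cfg[OF G, of 0] by (simp add: enc_mem_def)
  moreover have "maximal_matching (unordered ` X) (unordered ` set es)"
    using es assms(2) by (intro maximal_matchingI) (auto simp: matched_def)
  ultimately show ?thesis unfolding outputs_maximal_matching_def by blast
qed

end

section \<open>Accumulating the failure probabilities\<close>

context run
begin

text \<open>Uniting over all good placements and seeds forgets which of them occurred, so the rounds
  can be chained through plain sets of configurations.\<close>

definition reached :: "nat \<Rightarrow> config set" where
  "reached r = (\<Union>(\<rho>, s)\<in>{(\<rho>, s). seeded n K B L w R H D sl ss q0 t cs cy cl \<rho> s}.
     seeded.stage n K B L w H pr D bnd \<rho> s r)"

text \<open>Every round from the third on is charged \<open>e\<close>, although only samples can
  fail; this costs a factor of about \<open>L + 2\<close>, which the exponentially small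
  \<open>e\<close> absorbs.\<close>

lemma prob_reached_ge:
  assumes e0: "real N * (exp (real (card X) / real N) * 2 powr (- real q0)) \<le> e0"
    and e1: "\<And>Q. \<forall>i\<in>{1..N}. Q i \<subseteq> {..<n} \<and> card (Q i) \<le> 2 * q0 \<Longrightarrow>
      real (card {s. s < R \<and> \<not> balanced B N L t Q (H s)}) \<le> e1 * real R"
    and bnd: "real (card X) \<le> bnd 0" and pr: "\<And>k. 0 < pr k" "\<And>k. pr k \<le> 1"
    and e: "0 \<le> e"
      "\<And>k. exp (pr k * bnd k) * 2 powr (- real cy) + 2 ^ n * exp (- pr k * bnd (Suc k)) \<le> e"
    and "0 \<le> e1"
  shows "measure_pmf.prob (execution K (memory sl ss) program (initial_config n D) (2 + r))
     (Some ` reached (2 + r)) \<ge> 1 - (e0 + e1 + real r * e)"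
proof -
  let ?mem = "memory sl ss"
  let ?exec = "execution K ?mem program (initial_config n D)"
  have "0 \<le> real N * (exp (real (card X) / real N) * 2 powr (- real q0))" by simp
  then have e00: "0 \<le> e0" using e0 by linarith
  let ?P = "\<Union>\<rho>\<in>{\<rho>. placed n K B L w R H D sl ss q0 t cs cy cl \<rho>}. PL \<rho>"
  have 1: "measure_pmf.prob (?exec 1) (Some ` ?P) \<ge> 1 - e0"
    using placement_round[OF e0] by simp
  have seed: "measure_pmf.prob (round_step K ?mem program 1 cfg) (Some ` reached 2) \<ge> 1 - e1"
    if in_P: "cfg \<in> ?P" for cfg
  proof -
    obtain \<rho> where pl: "placed n K B L w R H D sl ss q0 t cs cy cl \<rho>" and cfg: "cfg \<in> PL \<rho>"
      using in_P by blast
    interpret placed n K B L w R H pr D sl ss q0 t cs cy cl bnd \<rho> by (rule pl)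
    have "real (card {s. s < R \<and> \<not> balanced B N L t Q (H s)}) \<le> e1 * real R"
      using Q_subset card_Q by (intro e1) auto
    note step = seed_round[OF cfg this]
    have "(\<Union>s\<in>{s. s < R \<and> balanced B N L t Q (H s)}. BC s 0) \<subseteq> reached 2"
    proof safe
      fix s c assume s: "s < R" "balanced B N L t Q (H s)" and c: "c \<in> BC s 0"
      interpret seeded n K B L w R H pr D sl ss q0 t cs cy cl bnd \<rho> s
        using s by unfold_locales
      have "seeded n K B L w R H D sl ss q0 t cs cy cl \<rho> s" by (rule seeded_axioms)
      moreover have "c \<in> stage 2" using c by (simp add: stage_def)
      ultimately show "c \<in> reached 2" unfolding reached_def by blast
    qed
    then have "measure_pmf.prob (round_step K ?mem program 1 cfg) (Some ` (\<Union>s\<in>{s. s < R \<and> balanced B N L t Q (H s)}. BC s 0))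
       \<le> measure_pmf.prob (round_step K ?mem program 1 cfg) (Some ` reached 2)"
      by (intro measure_pmf.finite_measure_mono image_mono) auto
    with step show ?thesis by linarith
  qed
  have 2: "measure_pmf.prob (?exec 2) (Some ` reached 2) \<ge> 1 - (e0 + e1)"
    using prob_bind_spmf_ge[OF e00 \<open>0 \<le> e1\<close> 1 seed] by (simp add: numeral_2_eq_2)
  have step: "measure_pmf.prob (round_step K ?mem program (2 + r) cfg) (Some ` reached (Suc (2 + r))) \<ge> 1 - e"
    if in_reached: "cfg \<in> reached (2 + r)" for cfg r
  proof -
    obtain \<rho> s where sd: "seeded n K B L w R H D sl ss q0 t cs cy cl \<rho> s"
      and cfg: "cfg \<in> seeded.stage n K B L w H pr D bnd \<rho> s (2 + r)"
      using in_reached unfolding reached_def by blast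
    have "seeded.stage n K B L w H pr D bnd \<rho> s (Suc (2 + r)) \<subseteq> reached (Suc (2 + r))"
      using sd unfolding reached_def by blast
    then have "measure_pmf.prob (round_step K ?mem program (2 + r) cfg)
        (Some ` seeded.stage n K B L w H pr D bnd \<rho> s (Suc (2 + r)))
       \<le> measure_pmf.prob (round_step K ?mem program (2 + r) cfg) (Some ` reached (Suc (2 + r)))"
      by (intro measure_pmf.finite_measure_mono image_mono) auto
    with seeded.stage_step[OF sd _ cfg bnd pr e] show ?thesis by simp
  qed
  show ?thesis
  proof (induction r)
    case 0
    then show ?case using 2 by simp
  next
    case (Suc r)
    have "0 \<le> e0 + e1 + real r * e" using e00 \<open>0 \<le> e1\<close> e(1) by simp
    from prob_bind_spmf_ge[OF this e(1) Suc step] show ?case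
      by (simp add: algebra_simps)
  qed
qed

lemma prob_correct_ge:
  assumes "real N * (exp (real (card X) / real N) * 2 powr (- real q0)) \<le> e0"
    and "\<And>Q. \<forall>i\<in>{1..N}. Q i \<subseteq> {..<n} \<and> card (Q i) \<le> 2 * q0 \<Longrightarrow>
      real (card {s. s < R \<and> \<not> balanced B N L t Q (H s)}) \<le> e1 * real R"
    and "real (card X) \<le> bnd 0" and "\<And>k. 0 < pr k" "\<And>k. pr k \<le> 1"
    and e: "0 \<le> e"
      "\<And>k. exp (pr k * bnd k) * 2 powr (- real cy) + 2 ^ n * exp (- pr k * bnd (Suc k)) \<le> e"
    and "0 \<le> e1" and P: "0 < P" "pr (P - 1) = 1"
  shows "measure_pmf.prob
     (execution K (memory sl ss) program (initial_config n D) (prelude + P * (L + 2)))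
     {Some cfg | cfg. outputs_maximal_matching n (unordered ` X) cfg}
    \<ge> 1 - (e0 + e1 + real (prelude + P * (L + 2)) * e)"
proof -
  let ?T = "prelude + P * (L + 2)"
  let ?p = "measure_pmf.prob (execution K (memory sl ss) program (initial_config n D) ?T)"
  have T: "?T = 2 + (?T - 2)" using prelude_ge by simp
  have "reached ?T \<subseteq> {cfg. outputs_maximal_matching n (unordered ` X) cfg}"
  proof
    fix cfg assume "cfg \<in> reached ?T"
    then obtain \<rho> s where sd: "seeded n K B L w R H D sl ss q0 t cs cy cl \<rho> s"
      and cfg: "cfg \<in> seeded.stage n K B L w H pr D bnd \<rho> s ?T"
      unfolding reached_def by blast
    have d: "(?T - prelude) div (L + 2) = P" "(?T - prelude) mod (L + 2) = 0"
      unfolding diff_add_inverse by (rule nonzero_mult_div_cancel_right, simp, rule mod_mult_self2_is_0)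
    have "\<not> ?T \<le> L + 2" "\<not> ?T < prelude" by (simp_all add: prelude_def)
    then have dn: "cfg \<in> seeded.DN n K B L w H pr D bnd \<rho> s 0 (Suc (P - 1))"
      using cfg d P(1) unfolding seeded.stage_def[OF sd] Let_def by (simp only: if_False if_True) simp
    show "cfg \<in> {cfg. outputs_maximal_matching n (unordered ` X) cfg}"
      using seeded.DN_correct[OF sd dn P(2)] by simp
  qed
  then have "?p (Some ` reached ?T) \<le> ?p {Some cfg | cfg. outputs_maximal_matching n (unordered ` X) cfg}"
    by (intro measure_pmf.finite_measure_mono) auto
  moreover have "?p (Some ` reached ?T) \<ge> 1 - (e0 + e1 + real (?T - 2) * e)"
    using prob_reached_ge[OF assms(1-8), of "?T - 2"] unfolding T[symmetric] by simp
  moreover have "real (?T - 2) * e \<le> real ?T * e"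
    by (intro mult_right_mono of_nat_mono diff_le_self e(1))
  ultimately show ?thesis by linarith
qed

end

section \<open>Choice of the parameters\<close>

lemma distinct_concat_map:
  assumes "distinct is" "distinct (concat (map D is))"
  shows "\<And>i. i \<in> set is \<Longrightarrow> distinct (D i)" "disjoint_family_on (\<lambda>i. set (D i)) (set is)"
  using assms by (induction "is") (auto simp: disjoint_family_on_def)

lemma input_distributionD:
  assumes "simple_graph n E" "input_distribution n E K ss D"
  defines "X \<equiv> \<Union>i\<in>{1..K}. set (D i)"
  shows "E = unordered ` X" "card E = card X" "X \<subseteq> {..<n} \<times> {..<n}"
    "\<And>i. i \<in> {1..K} \<Longrightarrow> distinct (D i)" "disjoint_family_on (\<lambda>i. set (D i)) {1..K}"
proof -
  have I: "set [1..<Suc K] = {1..K}" by auto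
  have X: "set (concat (map D [1..<Suc K])) = X"
    unfolding X_def set_concat set_map I by simp
  have es: "distinct (map unordered (concat (map D [1..<Suc K])))"
    "set (map unordered (concat (map D [1..<Suc K]))) = E"
    using assms(2) by (auto simp: input_distribution_def Let_def)
  then have inj: "inj_on unordered X" and dist: "distinct (concat (map D [1..<Suc K]))"
    unfolding distinct_map X by auto
  show E: "E = unordered ` X" using es(2) unfolding set_map X by simp
  show "card E = card X" unfolding E by (rule card_image[OF inj])
  show "X \<subseteq> {..<n} \<times> {..<n}"
  proof
    fix p assume "p \<in> X"
    then have "unordered p \<subseteq> {..<n}" using assms(1) E by (auto simp: simple_graph_def)
    then show "p \<in> {..<n} \<times> {..<n}" by (cases p) (simp add: unordered_def)
  qed
  note distinct_concat_map[OF distinct_upt dist, unfolded I]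
  then show "\<And>i. i \<in> {1..K} \<Longrightarrow> distinct (D i)" "disjoint_family_on (\<lambda>i. set (D i)) {1..K}"
    by blast+
qed

text \<open>The largest base whose \<open>L\<close>-digit numbers fit into the available machines.
  The cap \<open>n ^ 2\<close> keeps machine numbers short when \<open>K\<close> is huge and is
  affordable because there are at most \<open>n ^ 2\<close> edges. Rounding down costs at most a
  factor \<open>2 ^ L\<close>.\<close>

definition fan :: "nat \<Rightarrow> nat \<Rightarrow> nat \<Rightarrow> nat" where
  "fan L n K = (GREATEST b. b ^ L \<le> min K (n ^ 2))"

lemma fan:
  assumes "0 < L" "1 \<le> K" "1 \<le> n"
  shows "0 < fan L n K" "fan L n K ^ L \<le> min K (n ^ 2)" "min K (n ^ 2) \<le> 2 ^ L * fan L n K ^ L"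
proof -
  let ?m = "min K (n ^ 2)"
  have m: "1 \<le> ?m" using assms by simp
  have bound: "b \<le> ?m" if "b ^ L \<le> ?m" for b
  proof (cases "b = 0")
    case False
    then have "b ^ 1 \<le> b ^ L" using assms(1) by (intro power_increasing) auto
    then show ?thesis using that by simp
  qed simp
  have one: "1 ^ L \<le> ?m" using m by simp
  show le: "fan L n K ^ L \<le> ?m"
    unfolding fan_def by (rule GreatestI_nat[of "\<lambda>b. b ^ L \<le> ?m", OF one bound])
  have max: "b \<le> fan L n K" if "b ^ L \<le> ?m" for b
    unfolding fan_def by (rule Greatest_le_nat[of "\<lambda>b. b ^ L \<le> ?m", OF that bound])
  show pos: "0 < fan L n K" using max[OF one] by simp
  have "?m < Suc (fan L n K) ^ L"
  proof (rule ccontr)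
    assume "\<not> ?thesis"
    then have "Suc (fan L n K) \<le> fan L n K" by (intro max) (rule leI)
    then show False by simp
  qed
  also have "\<dots> \<le> (2 * fan L n K) ^ L" using pos by (intro power_mono) auto
  finally show "?m \<le> 2 ^ L * fan L n K ^ L" by (simp add: power_mult_distrib)
qed

text \<open>Since \<open>L \<ge> 4 / \<gamma>\<close>, the cap gives
  \<open>B \<le> n powr (2 / L) \<le> n powr (\<gamma> / 2)\<close>. A load of order
  \<open>n powr \<gamma>\<close> is then still \<open>n powr (\<gamma> / 2)\<close> in units of
  \<open>B\<close>, enough for the tail bound.\<close>

lemma fan_le_powr:
  assumes "0 < L" "1 \<le> K" "1 \<le> n" "4 / \<gamma> \<le> real L" "0 < \<gamma>"
  shows "real (fan L n K) \<le> real n powr (\<gamma> / 2)"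
proof -
  let ?B = "fan L n K"
  have "?B ^ L \<le> n ^ 2" using fan(2)[OF assms(1-3)] by simp
  then have le: "real ?B ^ L \<le> real n ^ 2" by (metis of_nat_le_iff of_nat_power)
  have pos: "0 < real ?B" using fan(1)[OF assms(1-3)] by simp
  have "real ?B = (real ?B ^ L) powr (1 / L)"
    using pos assms(1) by (simp add: powr_realpow[symmetric] powr_powr)
  also have "\<dots> \<le> (real n ^ 2) powr (1 / L)" using le pos by (intro powr_mono2) auto
  also have "real n ^ 2 = real n powr 2"
    using assms(3) by (simp add: powr_numeral)
  also have "(real n powr 2) powr (1 / L) = real n powr (2 / L)"
    by (simp only: powr_powr) simp
  also have "\<dots> \<le> real n powr (\<gamma> / 2)"
    using assms by (intro powr_mono) (auto simp: field_simps)
  finally show ?thesis .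
qed

text \<open>The lower bound \<open>2\<close> ends the process after at most
  \<open>ceillog2 n\<close> phases even if \<open>f n\<close> is tiny, which keeps the accumulated
  error small; it costs at most a factor \<open>2\<close> in memory.\<close>

definition growth :: "(nat \<Rightarrow> real) \<Rightarrow> nat \<Rightarrow> real" where
  "growth f n = max 2 (real n powr f n)"

definition phases :: "(nat \<Rightarrow> real) \<Rightarrow> nat \<Rightarrow> nat" where
  "phases f n = min (nat \<lceil>1 / f n\<rceil>) (ceillog2 n)"

text \<open>Starts at \<open>1 / n\<close>, for which the bound \<open>2 * n / rate f n 0\<close> on
  live edges covers all \<open>n ^ 2\<close> possible edges. Phase \<open>k\<close> samples at rate
  \<open>rate f n (Suc k)\<close>.\<close>

definition rate :: "(nat \<Rightarrow> real) \<Rightarrow> nat \<Rightarrow> nat \<Rightarrow> real" where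
  "rate f n k = min 1 (growth f n ^ k / real n)"

lemma rate:
  assumes "1 \<le> n"
  shows "0 < rate f n k" "rate f n k \<le> 1" "rate f n (Suc k) \<le> growth f n * rate f n k"
    "rate f n 0 = 1 / real n"
proof -
  have g: "2 \<le> growth f n" by (simp add: growth_def)
  then show "0 < rate f n k" "rate f n k \<le> 1" "rate f n 0 = 1 / real n"
    using assms by (auto simp: rate_def)
  have "rate f n (Suc k) \<le> growth f n * 1" using g by (simp add: rate_def)
  moreover have "rate f n (Suc k) \<le> growth f n * (growth f n ^ k / real n)" by (simp add: rate_def)
  ultimately show "rate f n (Suc k) \<le> growth f n * rate f n k"
    using g by (simp add: rate_def min_mult_distrib_left)
qed

lemma rate_phases:
  assumes "2 \<le> n" "0 < f n"
  shows "rate f n (phases f n) = 1"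
proof -
  have "real n \<le> growth f n ^ phases f n"
  proof (cases "nat \<lceil>1 / f n\<rceil> \<le> ceillog2 n")
    case True
    have "1 / f n \<le> real (nat \<lceil>1 / f n\<rceil>)" by linarith
    then have "f n * (1 / f n) \<le> f n * real (nat \<lceil>1 / f n\<rceil>)"
      using assms(2) by (intro mult_left_mono) auto
    then have "1 \<le> f n * real (nat \<lceil>1 / f n\<rceil>)" using assms(2) by simp
    then have "real n powr 1 \<le> real n powr (f n * real (nat \<lceil>1 / f n\<rceil>))"
      using assms(1) by (intro powr_mono) auto
    also have "\<dots> = (real n powr f n) ^ nat \<lceil>1 / f n\<rceil>"
      using assms(1) by (simp only: powr_powr[symmetric]) (simp add: powr_realpow)
    also have "\<dots> \<le> growth f n ^ nat \<lceil>1 / f n\<rceil>"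
      by (intro power_mono) (auto simp: growth_def)
    finally show ?thesis using True assms(1) by (simp add: phases_def)
  next
    case False
    have "real n \<le> real (2 ^ ceillog2 n)" by (intro of_nat_mono le_two_power_ceillog2)
    also have "\<dots> \<le> growth f n ^ ceillog2 n"
      unfolding of_nat_power by (intro power_mono) (auto simp: growth_def)
    also have "ceillog2 n = phases f n" using False unfolding phases_def by linarith
    finally show ?thesis .
  qed
  then show ?thesis using assms(1) by (simp add: rate_def)
qed

lemma phases_pos: "2 \<le> n \<Longrightarrow> 0 < f n \<Longrightarrow> 0 < phases f n"
  using ceillog2_pos[of n] by (simp add: phases_def)

lemma two_powr_eq_exp: "2 powr x = exp (x * ln 2)" for x :: real
  by (simp add: powr_def)

text \<open>The mean sample size is at most \<open>2 * n\<close> times the ratio of consecutive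
  rates, hence at most \<open>2 * n * growth f n\<close>. The threshold is four times that, and
  \<open>ln 2 \<ge> 1 / 2\<close> makes the exponent negative. In the second term the exponent
  \<open>- 2 * n\<close> outweighs the \<open>2 ^ n\<close> vertex sets.\<close>

lemma sampling_error_le:
  assumes "1 \<le> n" "8 * real n * growth f n \<le> real cy"
  shows "exp (rate f n (Suc k) * (2 * real n / rate f n k)) * 2 powr (- real cy)
     + 2 ^ n * exp (- rate f n (Suc k) * (2 * real n / rate f n (Suc k))) \<le> 2 * exp (- real n)"
proof -
  note r = rate[OF assms(1), of f]
  let ?g = "real n * growth f n"
  have g: "real n \<le> ?g" using assms(1) by (simp add: growth_def)
  have "rate f n (Suc k) / rate f n k \<le> growth f n"
    using r by (simp add: divide_le_eq)
  then have "2 * real n * (rate f n (Suc k) / rate f n k) \<le> 2 * real n * growth f n"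
    by (intro mult_left_mono) auto
  then have mu: "rate f n (Suc k) * (2 * real n / rate f n k) \<le> 2 * ?g" by (simp add: mult_ac)
  have ln2: "1 / 2 \<le> ln (2 :: real)" using ln2_ge_two_thirds by simp
  have "8 * ?g * (1 / 2) \<le> real cy * ln 2"
    using assms ln2 g by (intro mult_mono) (auto simp: mult_ac)
  then have "exp (rate f n (Suc k) * (2 * real n / rate f n k)) * 2 powr (- real cy) \<le> exp (- real n)"
    using mu g unfolding two_powr_eq_exp mult_exp_exp exp_le_cancel_iff by linarith
  moreover have "2 ^ n * exp (- rate f n (Suc k) * (2 * real n / rate f n (Suc k))) \<le> exp (- real n)"
  proof -
    have "(2 :: real) ^ n \<le> exp 1 ^ n"
      using exp_ge_add_one_self[of "1 :: real"] by (intro power_mono) auto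
    also have "\<dots> = exp (real n)" by (simp add: exp_of_nat_mult[symmetric])
    finally have "2 ^ n * exp (- (2 * real n)) \<le> exp (real n) * exp (- (2 * real n))"
      by (intro mult_right_mono) auto
    also have "\<dots> = exp (- real n)" by (simp add: mult_exp_exp)
    finally show ?thesis using r(1)[of "Suc k"] by simp
  qed
  ultimately show ?thesis by simp
qed

text \<open>A machine gets at most \<open>2 ^ L * n powr \<gamma>\<close> edges on average,
  \<open>2 ^ L\<close> being the rounding loss in \<open>fan\<close>. The factor \<open>4\<close>
  brings the tail below \<open>exp (- (n powr \<gamma>))\<close>.\<close>

definition load :: "real \<Rightarrow> nat \<Rightarrow> nat \<Rightarrow> nat" where
  "load \<gamma> L n = nat \<lceil>4 * 2 ^ L * real n powr \<gamma>\<rceil>"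

text \<open>In the capacity condition, \<open>24\<close> stems from three words of
  \<open>8 * ceillog2 n\<close> bits per fact, and \<open>19\<close> covers both the seed on a small
  machine and the factor \<open>18\<close> of the large one. The power \<open>n ^ 8\<close> is
  \<open>n ^ 6\<close> hash functions times \<open>n ^ 2\<close> machines; the last condition allows
  for \<open>n\<close> phases.\<close>

definition large_enough :: "real \<Rightarrow> nat \<Rightarrow> nat \<Rightarrow> bool" where
  "large_enough \<gamma> L n \<longleftrightarrow> 2 \<le> n \<and> real L + 2 < real n \<and>
     24 * ((2 + 8 * real L) * (4 * 2 ^ L + 1) + 19) * (log 2 (real n) + 1) \<le> ln (real n) ^ 2 \<and>
     real n ^ 2 * exp (- (real n powr \<gamma>)) \<le> 1 / (4 * real n) \<and>
     real n ^ 3 + 1 \<le> real n ^ 5 / 4 \<and>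
     real n ^ 8 * real L * exp (- (real n powr (\<gamma> / 2))) \<le> 1 / 2 \<and>
     (2 * real L + 3 + real n * (real L + 2)) * (2 * exp (- real n)) \<le> 1 / (4 * real n)"

lemma eventually_large_enough:
  assumes "0 < \<gamma>"
  shows "\<forall>\<^sub>F n in sequentially. large_enough \<gamma> L n"
  unfolding large_enough_def
proof (intro eventually_conj)
  show "\<forall>\<^sub>F n in sequentially. 2 \<le> n" by (rule eventually_ge_at_top)
  show "\<forall>\<^sub>F n in sequentially. real L + 2 < real n" by real_asymp
  show "\<forall>\<^sub>F n in sequentially.
      24 * ((2 + 8 * real L) * (4 * 2 ^ L + 1) + 19) * (log 2 (real n) + 1) \<le> ln (real n) ^ 2"
    unfolding log_def by real_asymp
  show "\<forall>\<^sub>F n in sequentially. real n ^ 2 * exp (- (real n powr \<gamma>)) \<le> 1 / (4 * real n)"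
    using assms by real_asymp
  show "\<forall>\<^sub>F n in sequentially. real n ^ 3 + 1 \<le> real n ^ 5 / 4" by real_asymp
  show "\<forall>\<^sub>F n in sequentially. real n ^ 8 * real L * exp (- (real n powr (\<gamma> / 2))) \<le> 1 / 2"
    using assms by real_asymp
  show "\<forall>\<^sub>F n in sequentially.
      (2 * real L + 3 + real n * (real L + 2)) * (2 * exp (- real n)) \<le> 1 / (4 * real n)"
    by real_asymp
qed

text \<open>The choice depends on the parameters but not on the graph or its distribution, so the
  family is part of the program and only an index has to be communicated.\<close>

definition hashes :: "real \<Rightarrow> nat \<Rightarrow> nat \<Rightarrow> nat \<Rightarrow> nat \<Rightarrow> nat \<Rightarrow> nat" where
  "hashes \<gamma> L n K = (SOME H. (\<forall>s<n ^ 6. \<forall>u<n. H s u < fan L n K ^ L) \<and>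
     (\<forall>Q. (\<forall>i\<in>{1..fan L n K ^ L}. Q i \<subseteq> {..<n} \<and> card (Q i) \<le> 2 * load \<gamma> L n) \<longrightarrow>
        card {s. s < n ^ 6 \<and> \<not> balanced (fan L n K) (fan L n K ^ L) L (8 * load \<gamma> L n) Q (H s)}
          \<le> n * fan L n K ^ L + 1))"

text \<open>Without small machines there are no edges; the idle program leaves the empty string,
  which encodes the empty matching.\<close>

definition solver :: "real \<Rightarrow> (nat \<Rightarrow> real) \<Rightarrow> nat \<Rightarrow> nat \<Rightarrow> nat \<Rightarrow> program" where
  "solver \<gamma> f L n K =
     (if K = 0 then \<lambda>i r m b. return_pmf ([], \<lambda>_. [])
      else algorithm.program n K (fan L n K) L (8 * ceillog2 n) (n ^ 6) (hashes \<gamma> L n K)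
        (\<lambda>k. rate f n (Suc k)))"

definition rounds :: "(nat \<Rightarrow> real) \<Rightarrow> nat \<Rightarrow> nat \<Rightarrow> nat" where
  "rounds f L n = 2 * L + 3 + phases f n * (L + 2)"

lemma rounds_bigo:
  assumes "\<And>n. 0 < f n"
  shows "(\<lambda>n. real (rounds f L n)) \<in> O(\<lambda>n. real_of_int \<lceil>1 / f n\<rceil>)"
proof (rule bigoI, rule always_eventually, rule allI)
  fix n
  have one: "1 \<le> \<lceil>1 / f n\<rceil>" using assms[of n] by (simp add: one_le_ceiling)
  have "phases f n \<le> nat \<lceil>1 / f n\<rceil>" by (simp add: phases_def)
  then have "real (phases f n) \<le> real_of_int \<lceil>1 / f n\<rceil>" using one by linarith
  then have "real (phases f n) * (real L + 2) \<le> real_of_int \<lceil>1 / f n\<rceil> * (real L + 2)"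
    by (intro mult_right_mono) auto
  moreover have "(2 * real L + 3) * 1 \<le> (2 * real L + 3) * real_of_int \<lceil>1 / f n\<rceil>"
    using one by (intro mult_left_mono) auto
  ultimately have "real (rounds f L n) \<le> (3 * real L + 5) * real_of_int \<lceil>1 / f n\<rceil>"
    by (simp add: rounds_def algebra_simps)
  moreover have "\<bar>real_of_int \<lceil>1 / f n\<rceil>\<bar> = real_of_int \<lceil>1 / f n\<rceil>" using one by linarith
  ultimately show "norm (real (rounds f L n)) \<le> (3 * real L + 5) * norm (real_of_int \<lceil>1 / f n\<rceil>)"
    by (simp only: real_norm_def abs_of_nat)
qed

lemma idle_execution:
  "measure_pmf.prob (execution 0 mem (\<lambda>i r m b. return_pmf ([], \<lambda>_. [])) (initial_config n D) T)
     (Some ` {cfg. fst cfg 0 = []}) \<ge> 1 - 0"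
proof (induction T)
  case 0
  then show ?case by (simp add: initial_config_def)
next
  case (Suc T)
  let ?P = "\<lambda>i r m b. return_pmf ([], \<lambda>_. []) :: (bits \<times> mailbox) pmf"
  have step: "measure_pmf.prob (round_step 0 mem ?P T cfg) (Some ` {cfg. fst cfg 0 = []}) \<ge> 1 - 0" for cfg
    by (simp add: round_step_def legal_round_def next_config_def)
  from prob_bind_spmf_ge[OF order.refl order.refl Suc step] show ?case by simp
qed

section \<open>The parameters for one large \<open>n\<close> and one input\<close>

context
  fixes \<gamma> :: real and f :: "nat \<Rightarrow> real" and n K L sl ss :: nat and E :: "nat set set"
    and D :: "nat \<Rightarrow> (nat \<times> nat) list"
  assumes \<gamma>: "0 < \<gamma>" and f: "0 < f n" and L: "4 / \<gamma> \<le> real L"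
    and large_n: "large_enough \<gamma> L n" and K: "1 \<le> K"
    and graph: "simple_graph n E"
    and sl: "real sl \<ge> real n powr (1 + f n) * ln (real n) ^ 2"
    and ss: "real ss \<ge> real n powr \<gamma> * ln (real n) ^ 2"
    and machines: "real K \<ge> real (card E) / real n powr \<gamma>"
    and input: "input_distribution n E K ss D"
begin

private abbreviation (input) "x \<equiv> real n powr \<gamma>"
private abbreviation (input) "B \<equiv> fan L n K"
private abbreviation (input) "q0 \<equiv> load \<gamma> L n"
private abbreviation (input) "H \<equiv> hashes \<gamma> L n K"
text \<open>Counts \<open>q0\<close> edges, the seed and \<open>L\<close> levels of
  \<open>8 * q0\<close> requests, with \<open>q0\<close> to spare.\<close>

private abbreviation (input) "cs \<equiv> (2 + 8 * L) * q0 + 1"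
private abbreviation (input) "cy \<equiv> nat \<lceil>8 * real n * growth f n\<rceil>"

lemma n2: "2 \<le> n"
  using large_n by (simp add: large_enough_def)

lemma L0: "0 < L"
proof -
  have "0 < 4 / \<gamma>" using \<gamma> by simp
  then show ?thesis using L by (intro gr0I) auto
qed

lemma x1: "1 \<le> x"
  using n2 \<gamma> by (simp add: ge_one_powr_ge_zero)

lemma fan_props: "0 < B" "B ^ L \<le> K" "B ^ L \<le> n ^ 2" "min K (n ^ 2) \<le> 2 ^ L * B ^ L"
  using fan[OF L0 K, of n] n2 by auto

lemma B_le: "real B \<le> real n powr (\<gamma> / 2)"
  using fan_le_powr[OF L0 K _ L \<gamma>, of n] n2 by simp

lemma q0_bounds: "4 * 2 ^ L * x \<le> real q0" "real q0 \<le> 4 * 2 ^ L * x + 1"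
  using x1 unfolding load_def by (auto intro: order.trans[OF _ of_nat_ceiling])

lemma x_le_q0: "x \<le> real q0"
proof -
  have "(1 :: real) \<le> 2 ^ L" by simp
  then have "1 \<le> 4 * (2 :: real) ^ L" by linarith
  then have "1 * x \<le> (4 * 2 ^ L) * x" by (intro mult_right_mono) auto
  then show ?thesis using q0_bounds(1) by simp
qed

lemma B_le_q0: "B \<le> q0"
proof -
  have "real n powr (\<gamma> / 2) \<le> x" using n2 \<gamma> by (intro powr_mono) auto
  then show ?thesis using B_le x_le_q0 by linarith
qed

lemma log_w: "real (8 * ceillog2 n) \<le> 8 * (log 2 (real n) + 1)"
  using ceillog2_less_log[of n] n2 by simp

lemma log_nonneg: "0 \<le> log 2 (real n) + 1"
  using n2 by (intro add_nonneg_nonneg zero_le_log_cancel_iff[THEN iffD2]) auto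

text \<open>One of the two logarithms in the memory bounds pays for the word length, the other
  outgrows the constants that depend on \<open>L\<close>.\<close>

lemma log_bound: "C \<le> (2 + 8 * real L) * (4 * 2 ^ L + 1) + 19 \<Longrightarrow> 24 * C * (log 2 (real n) + 1) \<le> ln (real n) ^ 2"
proof -
  assume "C \<le> (2 + 8 * real L) * (4 * 2 ^ L + 1) + 19"
  then have "24 * C * (log 2 (real n) + 1)
      \<le> 24 * ((2 + 8 * real L) * (4 * 2 ^ L + 1) + 19) * (log 2 (real n) + 1)"
    using log_nonneg by (intro mult_right_mono) auto
  then show ?thesis using large_n unfolding large_enough_def by linarith
qed

lemma rearrange: "3 * (8 * a) * (b * c) = 24 * b * a * c" for a b c :: real
  by simp

lemma small_capacity: "3 * (8 * ceillog2 n) * cs \<le> ss"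
proof -
  let ?C = "(2 + 8 * real L) * (4 * 2 ^ L + 1) + 1"
  have "real cs = (2 + 8 * real L) * real q0 + 1" by (simp add: algebra_simps)
  also have "\<dots> \<le> (2 + 8 * real L) * ((4 * 2 ^ L + 1) * x) + 1 * x"
    using q0_bounds(2) x1 by (intro add_mono mult_left_mono) (auto simp: algebra_simps)
  also have "\<dots> = ?C * x" by (simp add: algebra_simps)
  finally have cs: "real cs \<le> ?C * x" .
  have "real (3 * (8 * ceillog2 n) * cs) = 3 * real (8 * ceillog2 n) * real cs"
    by (simp only: of_nat_mult of_nat_numeral)
  also have "\<dots> \<le> 3 * (8 * (log 2 (real n) + 1)) * (?C * x)"
    using log_w cs log_nonneg by (intro mult_mono) auto
  also have "\<dots> = (24 * ?C * (log 2 (real n) + 1)) * x" by (rule rearrange)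
  also have "\<dots> \<le> ln (real n) ^ 2 * x" using log_bound[of ?C] x1 by (intro mult_right_mono) auto
  also have "\<dots> \<le> real ss" using ss by (simp add: mult.commute)
  finally show ?thesis by (simp only: of_nat_le_iff)
qed

lemma large_capacity: "3 * (8 * ceillog2 n) * (cy + n) \<le> sl"
proof -
  let ?y = "real n powr (1 + f n)"
  have y: "?y = real n * real n powr f n" using n2 by (simp add: powr_add)
  have nf: "1 \<le> real n powr f n" using n2 f by (simp add: ge_one_powr_ge_zero)
  have n_y: "real n \<le> ?y" unfolding y using nf n2 by simp
  have "growth f n \<le> 2 * real n powr f n" unfolding growth_def using nf by auto
  then have "8 * real n * growth f n \<le> 8 * real n * (2 * real n powr f n)"
    by (intro mult_left_mono) auto
  then have "8 * real n * growth f n \<le> 16 * ?y" unfolding y by simp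
  moreover have "real cy \<le> 8 * real n * growth f n + 1"
    using n2 by (simp add: growth_def of_nat_nat)
  moreover have "1 \<le> real n" using n2 by simp
  ultimately have c: "real (cy + n) \<le> 18 * ?y" using n_y by simp
  have "real (3 * (8 * ceillog2 n) * (cy + n)) = 3 * real (8 * ceillog2 n) * real (cy + n)"
    by (simp only: of_nat_mult of_nat_numeral)
  also have "\<dots> \<le> 3 * (8 * (log 2 (real n) + 1)) * (18 * ?y)"
    using log_w c log_nonneg by (intro mult_mono) auto
  also have "\<dots> = (24 * 18 * (log 2 (real n) + 1)) * ?y" by (rule rearrange)
  also have "\<dots> \<le> ln (real n) ^ 2 * ?y"
    by (intro mult_right_mono log_bound) (auto intro: order.trans[of _ 19])
  also have "\<dots> \<le> real sl" using sl by (simp add: mult.commute)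
  finally show ?thesis by (simp only: of_nat_le_iff)
qed

lemma ln2_half: "1 / 2 \<le> ln (2 :: real)"
  using ln2_ge_two_thirds by simp

text \<open>With at most \<open>2 * q0\<close> requests per machine and threshold
  \<open>8 * q0\<close>, the exponent is at most \<open>2 * y - 4 * y\<close> for
  \<open>y = q0 / B\<close>, and \<open>y \<ge> n powr (\<gamma> / 2)\<close> by the bounds on
  \<open>B\<close> and \<open>q0\<close>.\<close>

lemma hash_error:
  "real (n ^ 6) * (real L * real (B ^ L) * (exp (real (2 * q0) / real B) * 2 powr (- real (8 * q0) / real B))) \<le> 1 / 2"
proof -
  have B0: "0 < real B" using fan_props(1) by simp
  let ?z = "real n powr (\<gamma> / 2)"
  have "real B * ?z \<le> ?z * ?z" using B_le by (intro mult_right_mono) auto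
  also have "\<dots> = x" by (simp add: powr_add[symmetric])
  also have "\<dots> \<le> real q0" by (rule x_le_q0)
  finally have z: "?z \<le> real q0 / real B" using B0 by (simp add: le_divide_eq mult.commute)
  define y where "y = real q0 / real B"
  have y0: "0 \<le> y" by (simp add: y_def)
  have "8 * y * (1 / 2) \<le> 8 * y * ln 2" using y0 ln2_half by (intro mult_left_mono) auto
  then have le: "2 * y + - (8 * y) * ln 2 \<le> - ?z" using z y0 unfolding y_def[symmetric] by linarith
  have "exp (real (2 * q0) / real B) * 2 powr (- real (8 * q0) / real B) = exp (2 * y + - (8 * y) * ln 2)"
    unfolding two_powr_eq_exp mult_exp_exp y_def by simp
  also have "\<dots> \<le> exp (- ?z)" using le by simp
  finally have e: "exp (real (2 * q0) / real B) * 2 powr (- real (8 * q0) / real B) \<le> exp (- ?z)" .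
  have N: "real (B ^ L) \<le> real n ^ 2"
    using fan_props(3) by (metis of_nat_le_iff of_nat_power)
  have "real (n ^ 6) * (real L * real (B ^ L) * (exp (real (2 * q0) / real B) * 2 powr (- real (8 * q0) / real B)))
      \<le> real (n ^ 6) * (real L * real n ^ 2 * exp (- ?z))"
    using N e by (intro mult_left_mono mult_mono) auto
  also have "\<dots> = real n ^ 8 * real L * exp (- ?z)"
  proof -
    have "real n ^ 8 = real n ^ 6 * real n ^ 2" by (simp flip: power_add)
    then show ?thesis by (simp add: mult_ac)
  qed
  also have "\<dots> \<le> 1 / 2" using large_n by (simp add: large_enough_def)
  finally show ?thesis .
qed

lemma hashes_good:
  "(\<forall>s<n ^ 6. \<forall>u<n. H s u < B ^ L) \<and>
     (\<forall>Q. (\<forall>i\<in>{1..B ^ L}. Q i \<subseteq> {..<n} \<and> card (Q i) \<le> 2 * q0) \<longrightarrow>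
        card {s. s < n ^ 6 \<and> \<not> balanced B (B ^ L) L (8 * q0) Q (H s)} \<le> n * B ^ L + 1)"
  using someI_ex[OF exists_hash_family[OF fan_props(1) refl hash_error]] unfolding hashes_def .

lemma w_bounds: "n \<le> 2 ^ (8 * ceillog2 n)" "n ^ 6 \<le> 2 ^ (8 * ceillog2 n)"
  "B ^ L < 2 ^ (8 * ceillog2 n)" "L + 2 < 2 ^ (8 * ceillog2 n)"
proof -
  have "n ^ 8 \<le> (2 ^ ceillog2 n) ^ 8" by (intro power_mono le_two_power_ceillog2) auto
  then have w: "n ^ 8 \<le> 2 ^ (8 * ceillog2 n)" by (simp add: power_mult[symmetric] mult.commute)
  have "n \<le> n ^ 8" "n ^ 6 \<le> n ^ 8" "n ^ 2 < n ^ 8"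
    using n2 by (auto intro!: self_le_power power_increasing power_strict_increasing)
  moreover have "L + 2 < n" using large_n by (simp add: large_enough_def)
  ultimately show "n \<le> 2 ^ (8 * ceillog2 n)" "n ^ 6 \<le> 2 ^ (8 * ceillog2 n)"
    "B ^ L < 2 ^ (8 * ceillog2 n)" "L + 2 < 2 ^ (8 * ceillog2 n)"
    using w fan_props(3) by linarith+
qed

lemma run_params: "run n K B L (8 * ceillog2 n) (n ^ 6) H D sl ss q0 (8 * q0) cs cy (cy + n)"
proof unfold_locales
  note inp = input_distributionD[OF graph input]
  show "set (D i) \<subseteq> {..<n} \<times> {..<n}" if "i \<in> {1..K}" for i using inp(3) that by blast
  show "distinct (D i)" if "i \<in> {1..K}" for i by (rule inp(4)[OF that])
  show "disjoint_family_on (\<lambda>i. set (D i)) {1..K}" by (rule inp(5))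
  show "length (encode_edges n (D i)) \<le> ss" if "i \<in> {1..K}" for i
    using input that by (simp add: input_distribution_def Let_def)
  show "0 < n ^ 6" using n2 by simp
  show "H s u < B ^ L" if "s < n ^ 6" "u < n" for s u using hashes_good that by blast
  show "B \<le> cs" using B_le_q0 by simp
  show "q0 + 1 + L * (8 * q0) \<le> cs" by (simp add: algebra_simps)
qed (use n2 fan_props L0 w_bounds small_capacity large_capacity in auto)

text \<open>Both \<open>K\<close> and \<open>n ^ 2\<close> are at least
  \<open>card E / n powr \<gamma>\<close>, hence so is their minimum, and \<open>B ^ L\<close>
  reaches this minimum up to the factor \<open>2 ^ L\<close>.\<close>

lemma card_X_le: "real (card (\<Union>i\<in>{1..K}. set (D i))) \<le> real (B ^ L) * (2 ^ L * x)"
  "real (card (\<Union>i\<in>{1..K}. set (D i))) \<le> real n ^ 2"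
proof -
  note inp = input_distributionD[OF graph input]
  let ?m = "real (card E)"
  have "card (\<Union>i\<in>{1..K}. set (D i)) \<le> card ({..<n} \<times> {..<n})"
    using inp(3) by (intro card_mono) auto
  then have m: "card E \<le> n ^ 2" unfolding inp(2) by (simp add: power2_eq_square)
  then have m': "real (card E) \<le> real n ^ 2" by (metis of_nat_le_iff of_nat_power)
  then show "real (card (\<Union>i\<in>{1..K}. set (D i))) \<le> real n ^ 2" unfolding inp(2) .
  have "?m / x \<le> ?m" using x1 by (simp add: divide_le_eq mult_le_cancel_left1)
  then have "?m / x \<le> min (real K) (real n ^ 2)"
    using machines m' by (intro min.boundedI) linarith+
  also have "\<dots> = real (min K (n ^ 2))" by (simp add: of_nat_min)
  also have "\<dots> \<le> real (2 ^ L * B ^ L)" using fan_props(4) by (intro of_nat_mono)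
  finally have "?m \<le> real (2 ^ L * B ^ L) * x" using n2 by (simp add: divide_le_eq)
  then show "real (card (\<Union>i\<in>{1..K}. set (D i))) \<le> real (B ^ L) * (2 ^ L * x)"
    unfolding inp(2) by (simp add: mult_ac)
qed

lemma placement_error:
  "real (B ^ L) * (exp (real (card (\<Union>i\<in>{1..K}. set (D i))) / real (B ^ L)) * 2 powr (- real q0)) \<le> 1 / (4 * real n)"
proof -
  let ?c = "2 ^ L * x"
  have N0: "0 < real (B ^ L)" using fan_props(1) by simp
  have "1 * x \<le> ?c" using x1 by (intro mult_right_mono) auto
  then have c: "x \<le> ?c" by simp
  have m: "real (card (\<Union>i\<in>{1..K}. set (D i))) / real (B ^ L) \<le> ?c"
    using card_X_le(1) N0 by (simp add: divide_le_eq mult.commute)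
  have "4 * ?c * (1 / 2) \<le> real q0 * ln 2"
    using q0_bounds(1) ln2_half x1 by (intro mult_mono) auto
  then have "exp (real (card (\<Union>i\<in>{1..K}. set (D i))) / real (B ^ L)) * 2 powr (- real q0) \<le> exp (- x)"
    unfolding two_powr_eq_exp mult_exp_exp exp_le_cancel_iff using m c by linarith
  moreover have "real (B ^ L) \<le> real n ^ 2"
    using fan_props(3) by (metis of_nat_le_iff of_nat_power)
  ultimately have "real (B ^ L) * (exp (real (card (\<Union>i\<in>{1..K}. set (D i))) / real (B ^ L)) * 2 powr (- real q0))
      \<le> real n ^ 2 * exp (- x)" by (intro mult_mono) auto
  also have "\<dots> \<le> 1 / (4 * real n)" using large_n by (simp add: large_enough_def)
  finally show ?thesis .
qed

lemma seed_error: "real (n * B ^ L + 1) \<le> 1 / (4 * real n) * real (n ^ 6)"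
proof -
  have "n * B ^ L + 1 \<le> n * n ^ 2 + 1" using fan_props(3) by simp
  then have "real (n * B ^ L + 1) \<le> real (n * n ^ 2 + 1)" by (rule of_nat_mono)
  also have "\<dots> = real n ^ 3 + 1" by (simp add: power3_eq_cube power2_eq_square)
  also have "\<dots> \<le> real n ^ 5 / 4" using large_n by (simp add: large_enough_def)
  also have "\<dots> = 1 / (4 * real n) * real (n ^ 6)"
    using n2 by (simp add: eval_nat_numeral)
  finally show ?thesis .
qed

lemma solver_correct:
  "measure_pmf.prob (execution K (memory sl ss) (solver \<gamma> f L n K) (initial_config n D) (rounds f L n))
     {Some cfg | cfg. outputs_maximal_matching n E cfg} \<ge> 1 - 1 / real n"
proof -
  let ?pr = "\<lambda>k. rate f n (Suc k)" and ?bnd = "\<lambda>k. 2 * real n / rate f n k"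
  interpret run n K B L "8 * ceillog2 n" "n ^ 6" H ?pr D sl ss q0 "8 * q0" cs cy "cy + n" ?bnd
    by (rule run_params)
  have n1: "1 \<le> n" using n2 by simp
  have X: "E = unordered ` X"
    unfolding X_def by (rule input_distributionD(1)[OF graph input])
  have "8 * real n * growth f n \<le> real cy" by linarith
  note sampling = sampling_error_le[of n f, OF n1 this]
  have bnd0: "real (card X) \<le> ?bnd 0"
  proof -
    have "real (card X) \<le> real n ^ 2" unfolding X_def by (rule card_X_le(2))
    also have "\<dots> \<le> 2 * real n ^ 2" by simp
    also have "\<dots> = ?bnd 0" using n1 rate(4)[OF n1, of f] by (simp add: power2_eq_square)
    finally show ?thesis .
  qed
  have T: "prelude + phases f n * (L + 2) = rounds f L n"
    by (simp add: prelude_def rounds_def)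
  \<comment> \<open>The contributions are the placement, the seed and all later rounds; each is at
    most \<open>1 / (4 * n)\<close>.\<close>
  have "1 - (1 / (4 * real n) + 1 / (4 * real n) + real (prelude + phases f n * (L + 2)) * (2 * exp (- real n)))
     \<le> measure_pmf.prob (execution K (memory sl ss) program (initial_config n D) (prelude + phases f n * (L + 2)))
        {Some cfg | cfg. outputs_maximal_matching n (unordered ` X) cfg}"
  proof (rule prob_correct_ge)
    show "real (B ^ L) * (exp (real (card X) / real (B ^ L)) * 2 powr - real q0) \<le> 1 / (4 * real n)"
      unfolding X_def by (rule placement_error)
    fix Q assume "\<forall>i\<in>{1..B ^ L}. Q i \<subseteq> {..<n} \<and> card (Q i) \<le> 2 * q0"
    then have "card {s. s < n ^ 6 \<and> \<not> balanced B (B ^ L) L (8 * q0) Q (H s)} \<le> n * B ^ L + 1"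
      using hashes_good by blast
    then show "real (card {s. s < n ^ 6 \<and> \<not> balanced B (B ^ L) L (8 * q0) Q (H s)}) \<le> 1 / (4 * real n) * real (n ^ 6)"
      using seed_error by (intro order.trans[OF of_nat_mono seed_error])
  next
    show "real (card X) \<le> ?bnd 0" by (rule bnd0)
    show "0 < ?pr k" "?pr k \<le> 1" for k using rate[OF n1] by auto
    show "exp (?pr k * ?bnd k) * 2 powr - real cy + 2 ^ n * exp (- ?pr k * ?bnd (Suc k)) \<le> 2 * exp (- real n)" for k
      by (rule sampling)
    show "0 < phases f n" by (rule phases_pos[of n f, OF n2 f])
    then show "?pr (phases f n - 1) = 1" using rate_phases[of n f, OF n2 f] by simp
  qed auto
  moreover have "real (rounds f L n) * (2 * exp (- real n)) \<le> 1 / (4 * real n)"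
  proof -
    \<comment> \<open>The error has to be controlled through \<open>ceillog2 n\<close>, since
      \<open>1 / f n\<close> may grow arbitrarily fast.\<close>
    have "ceillog2 n \<le> n" using ceillog2_le_iff[of n n] n1 less_exp[of n] by simp
    then have "real (phases f n) \<le> real n" by (simp add: phases_def)
    then have "real (phases f n) * (real L + 2) \<le> real n * (real L + 2)"
      by (intro mult_right_mono) auto
    then have "real (rounds f L n) \<le> 2 * real L + 3 + real n * (real L + 2)"
      by (simp add: rounds_def algebra_simps)
    then have "real (rounds f L n) * (2 * exp (- real n))
        \<le> (2 * real L + 3 + real n * (real L + 2)) * (2 * exp (- real n))"
      by (intro mult_right_mono) auto
    then show ?thesis using large_n unfolding large_enough_def by linarith
  qed
  moreover have "1 / (4 * real n) + 1 / (4 * real n) + 1 / (4 * real n) \<le> 1 / real n"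
    using n1 by (simp add: field_simps)
  moreover have "solver \<gamma> f L n K = program" using K by (simp add: solver_def)
  ultimately show ?thesis unfolding T X by simp
qed

end

theorem theorem4:
  fixes \<gamma> :: real and f :: "nat \<Rightarrow> real"
  assumes "0 < \<gamma>" and "\<gamma> < 1" and "\<And>n. 0 < f n"
  shows "\<exists>(alg :: nat \<Rightarrow> nat \<Rightarrow> nat \<Rightarrow> nat \<Rightarrow> program) (T :: nat \<Rightarrow> nat)
            (C_large :: real) (k_large :: nat) (C_small :: real) (k_small :: nat)
            (C_num :: real) (c :: real).
    0 < C_large \<and> 0 < C_small \<and> 0 < C_num \<and> 1 \<le> c \<and>
    (\<lambda>n. real (T n)) \<in> O(\<lambda>n. real_of_int \<lceil>1 / f n\<rceil>) \<and>
    (\<forall>\<^sub>F n in sequentially.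
      \<forall>(K :: nat) (s_large :: nat) (s_small :: nat) (E :: nat set set)
        (D :: nat \<Rightarrow> (nat \<times> nat) list).
        simple_graph n E \<longrightarrow>
        real s_large \<ge> C_large * real n powr (1 + f n) * ln (real n) ^ k_large \<longrightarrow>
        real s_small \<ge> C_small * real n powr \<gamma> * ln (real n) ^ k_small \<longrightarrow>
        real K \<ge> C_num * (real (card E) / real n powr \<gamma>) \<longrightarrow>
        input_distribution n E K s_small D \<longrightarrow>
        measure_pmf.prob
          (execution K (memory s_large s_small) (alg n K s_large s_small) (initial_config n D) (T n))
          {Some cfg | cfg. outputs_maximal_matching n E cfg}
        \<ge> 1 - 1 / real n powr c)"
proof -
  \<comment> \<open>The number of levels depends on \<open>\<gamma>\<close> alone, so it is a
    constant in the round bound.\<close>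
  define L where "L = nat \<lceil>4 / \<gamma>\<rceil>"
  have L: "4 / \<gamma> \<le> real L" unfolding L_def by linarith
  let ?p = "\<lambda>n K sl ss E D. measure_pmf.prob
      (execution K (memory sl ss) (solver \<gamma> f L n K) (initial_config n D) (rounds f L n))
      {Some cfg | cfg. outputs_maximal_matching n E cfg}"
  have main: "?p n K sl ss E D \<ge> 1 - 1 / real n powr 1"
    if "large_enough \<gamma> L n" "simple_graph n E"
      "real sl \<ge> 1 * real n powr (1 + f n) * ln (real n) ^ 2"
      "real ss \<ge> 1 * real n powr \<gamma> * ln (real n) ^ 2"
      "real K \<ge> 1 * (real (card E) / real n powr \<gamma>)" "input_distribution n E K ss D"
    for n K sl ss E D
  proof (cases "K = 0")
    case True
    have E: "E = {}" using input_distributionD(1)[OF that(2,6)] True by simp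
    have "Some ` {cfg. fst cfg 0 = []} \<subseteq> {Some cfg | cfg. outputs_maximal_matching n E cfg}"
    proof safe
      fix cfg :: config assume "fst cfg 0 = []"
      then have "fst cfg 0 = encode_edges n [] \<and> maximal_matching E (unordered ` set [])"
        by (simp add: E maximal_matching_def matching_def)
      then show "\<exists>cfg'. Some cfg = Some cfg' \<and> outputs_maximal_matching n E cfg'"
        unfolding outputs_maximal_matching_def by blast
    qed
    then have "measure_pmf.prob (execution K (memory sl ss) (solver \<gamma> f L n K) (initial_config n D) (rounds f L n))
        (Some ` {cfg. fst cfg 0 = []}) \<le> ?p n K sl ss E D"
      by (intro measure_pmf.finite_measure_mono) auto
    moreover have "1 - 0 \<le> measure_pmf.prob
        (execution K (memory sl ss) (solver \<gamma> f L n K) (initial_config n D) (rounds f L n))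
        (Some ` {cfg. fst cfg 0 = []})"
      unfolding solver_def True if_P[OF refl] by (rule idle_execution)
    moreover have "0 \<le> 1 / real n powr 1" by simp
    ultimately show ?thesis by linarith
  next
    case False
    have "1 - 1 / real n \<le> ?p n K sl ss E D"
      by (rule solver_correct[OF assms(1) assms(3) L that(1) _ that(2)]) (use that False in auto)
    then show ?thesis using that(1) by (simp add: large_enough_def)
  qed
  show ?thesis
  proof (intro exI conjI)
    \<comment> \<open>The factors \<open>1\<close> and the applied abstraction are written out so
      that unification reads off the constants and \<open>alg\<close>.\<close>
    show "\<forall>\<^sub>F n in sequentially. \<forall>K sl ss E D. simple_graph n E \<longrightarrow>
        real sl \<ge> 1 * real n powr (1 + f n) * ln (real n) ^ 2 \<longrightarrow>
        real ss \<ge> 1 * real n powr \<gamma> * ln (real n) ^ 2 \<longrightarrow>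
        real K \<ge> 1 * (real (card E) / real n powr \<gamma>) \<longrightarrow>
        input_distribution n E K ss D \<longrightarrow>
        measure_pmf.prob (execution K (memory sl ss) ((\<lambda>n K _ _. solver \<gamma> f L n K) n K sl ss)
          (initial_config n D) (rounds f L n))
          {Some cfg | cfg. outputs_maximal_matching n E cfg} \<ge> 1 - 1 / real n powr 1"
      using eventually_large_enough[OF assms(1), of L]
    proof (rule eventually_mono)
      fix n assume n: "large_enough \<gamma> L n"
      show "\<forall>K sl ss E D. simple_graph n E \<longrightarrow>
        real sl \<ge> 1 * real n powr (1 + f n) * ln (real n) ^ 2 \<longrightarrow>
        real ss \<ge> 1 * real n powr \<gamma> * ln (real n) ^ 2 \<longrightarrow>
        real K \<ge> 1 * (real (card E) / real n powr \<gamma>) \<longrightarrow>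
        input_distribution n E K ss D \<longrightarrow>
        measure_pmf.prob (execution K (memory sl ss) ((\<lambda>n K _ _. solver \<gamma> f L n K) n K sl ss)
          (initial_config n D) (rounds f L n))
          {Some cfg | cfg. outputs_maximal_matching n E cfg} \<ge> 1 - 1 / real n powr 1"
        using main[OF n] by blast
    qed
    show "(\<lambda>n. real (rounds f L n)) \<in> O(\<lambda>n. real_of_int \<lceil>1 / f n\<rceil>)"
      by (rule rounds_bigo) (rule assms(3))
  qed auto
qed

end
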